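(* Let $1\le p<\infty$ and let $X_1,\dots,X_n,Y$ be Banach spaces over the same field ($\mathbb R$ or $\mathbb C$). Then $$\Pi_p^{Lip}(X_1,\dots,X_n;Y)\subset\mathcal{DP}(X_1,\dots,X_n;Y).$$
   Context: $\mathcal L(X_1,\dots,X_n)$ is the space of bounded scalar $n$-linear forms with the supremum norm over the product of unit balls, $B_E$ the closed unit ball of $E$. A bounded $n$-linear operator $T:X_1\times\cdots\times X_n\to Y$ is Lipschitz $p$-summing, $T\in\Pi_p^{Lip}(X_1,\dots,X_n;Y)$, if there is $c>0$ such that for all $k\in\mathbb N$ and all $u_1,\dots,u_k,v_1,\dots,v_k\in X_1\times\cdots\times X_n$, $$\Big(\sum_{i=1}^k\|T(u_i)-T(v_i)\|^p\Big)^{1/p}\le c\cdot\sup_{\varphi\in B_{\mathcal L(X_1,\dots,X_n)}}\Big(\sum_{i=1}^k|\varphi(u_i)-\varphi(v_i)|^p\Big)^{1/p}.$$ Let $\Sigma_{X_1,\dots,X_n}=\{x_1\otimes\cdots\otimes x_n:x_i\in X_i\}$, a subset of the completed projective tensor product $X_1\hat\otimes_\pi\cdots\hat\otimes_\pi X_n$. A bounded $n$-linear operator $T$ is Dunford-Pettis, $T\in\mathcal{DP}(X_1,\dots,X_n;Y)$, if the map $f_T:\Sigma_{X_1,\dots,X_n}\to Y$, $f_T(x_1\otimes\cdots\otimes x_n)=T(x_1,\dots,x_n)$, sends sequences of $\Sigma_{X_1,\dots,X_n}$ that are weakly Cauchy in $X_1\hat\otimes_\pi\cdots\hat\otimes_\pi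 X_n$ to norm convergent sequences in $Y$. *)

theory Defs
  imports "HOL-Analysis.Analysis" "HOL-Library.Poly_Mapping"
begin

section \<open>Normed spaces over a scalar field, with explicit carriers\<close>

text \<open>Carriers are explicit because a family of different spaces \<open>X i\<close> is needed, and the scalar
  field \<open>'k\<close> is a type variable of class \<open>real_normed_field\<close>, which covers both
  \<open>real\<close> and \<open>complex\<close> (up to isometric isomorphism these are the only instances, since the
  norm is multiplicative and multiplication commutative).\<close>

record ('k, 'a) nspace =
  vcarrier :: "'a set"
  vplus :: "'a \<Rightarrow> 'a \<Rightarrow> 'a"
  vzero :: "'a"
  vscale :: "'k \<Rightarrow> 'a \<Rightarrow> 'a"
  vnorm :: "'a \<Rightarrow> real"

locale normed_space =
  fixes V :: "('k::real_normed_field, 'a) nspace"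
  assumes plus_closed: "\<lbrakk>x \<in> vcarrier V; y \<in> vcarrier V\<rbrakk> \<Longrightarrow> vplus V x y \<in> vcarrier V"
    and zero_closed: "vzero V \<in> vcarrier V"
    and scale_closed: "x \<in> vcarrier V \<Longrightarrow> vscale V c x \<in> vcarrier V"
    and plus_assoc: "\<lbrakk>x \<in> vcarrier V; y \<in> vcarrier V; z \<in> vcarrier V\<rbrakk>
      \<Longrightarrow> vplus V (vplus V x y) z = vplus V x (vplus V y z)"
    and plus_commute: "\<lbrakk>x \<in> vcarrier V; y \<in> vcarrier V\<rbrakk> \<Longrightarrow> vplus V x y = vplus V y x"
    and plus_zero: "x \<in> vcarrier V \<Longrightarrow> vplus V x (vzero V) = x"
    and plus_inverse: "x \<in> vcarrier V \<Longrightarrow> \<exists>y\<in>vcarrier V. vplus V x y = vzero V"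
    and scale_one: "x \<in> vcarrier V \<Longrightarrow> vscale V 1 x = x"
    and scale_scale: "x \<in> vcarrier V \<Longrightarrow> vscale V c (vscale V d x) = vscale V (c * d) x"
    and scale_plus_right: "\<lbrakk>x \<in> vcarrier V; y \<in> vcarrier V\<rbrakk>
      \<Longrightarrow> vscale V c (vplus V x y) = vplus V (vscale V c x) (vscale V c y)"
    and scale_plus_left: "x \<in> vcarrier V
      \<Longrightarrow> vscale V (c + d) x = vplus V (vscale V c x) (vscale V d x)"
    and norm_nonneg: "x \<in> vcarrier V \<Longrightarrow> 0 \<le> vnorm V x"
    and norm_eq_zero: "x \<in> vcarrier V \<Longrightarrow> vnorm V x = 0 \<longleftrightarrow> x = vzero V"
    and norm_scale: "x \<in> vcarrier V \<Longrightarrow> vnorm V (vscale V c x) = norm c * vnorm V x"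
    and norm_triangle: "\<lbrakk>x \<in> vcarrier V; y \<in> vcarrier V\<rbrakk>
      \<Longrightarrow> vnorm V (vplus V x y) \<le> vnorm V x + vnorm V y"

text \<open>The value \<open>0\<close> outside the carrier is there because the locale \<open>Metric_space\<close> requires
  symmetry and nonnegativity on the whole type.\<close>

definition vdist :: "('k::real_normed_field, 'a) nspace \<Rightarrow> 'a \<Rightarrow> 'a \<Rightarrow> real" where
  "vdist V x y =
    (if x \<in> vcarrier V \<and> y \<in> vcarrier V then vnorm V (vplus V x (vscale V (- 1) y)) else 0)"

abbreviation vCauchy :: "('k::real_normed_field, 'a) nspace \<Rightarrow> (nat \<Rightarrow> 'a) \<Rightarrow> bool" where
  "vCauchy V \<equiv> Metric_space.MCauchy (vcarrier V) (vdist V)"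

abbreviation vtopology :: "('k::real_normed_field, 'a) nspace \<Rightarrow> 'a topology" where
  "vtopology V \<equiv> Metric_space.mtopology (vcarrier V) (vdist V)"

locale banach_space = normed_space +
  assumes complete: "Metric_space.mcomplete (vcarrier V) (vdist V)"

definition scalar_space :: "('k::real_normed_field, 'k) nspace" where
  "scalar_space = \<lparr>vcarrier = UNIV, vplus = (+), vzero = 0, vscale = (*), vnorm = norm\<rparr>"

context normed_space
begin

lemma scale_zero_left:
  assumes x: "x \<in> vcarrier V" shows "vscale V 0 x = vzero V"
proof -
  let ?z = "vscale V 0 x"
  have z: "?z \<in> vcarrier V" by (rule scale_closed[OF x])
  have zz: "vplus V ?z ?z = ?z" using scale_plus_left[OF x, of 0 0] by simp
  obtain y where y: "y \<in> vcarrier V" "vplus V ?z y = vzero V" using plus_inverse[OF z] by blast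
  show ?thesis using plus_assoc[OF z z y(1)] zz y(2) plus_zero[OF z] by simp
qed

lemma scale_minus_one:
  assumes x: "x \<in> vcarrier V"
  shows "vplus V x (vscale V (- 1) x) = vzero V"
  using scale_plus_left[OF x, of 1 "- 1"] scale_zero_left[OF x] scale_one[OF x] by simp

lemma Metric_space_vdist: "Metric_space (vcarrier V) (vdist V)"
proof
  have m: "vscale V (- 1) x \<in> vcarrier V" if "x \<in> vcarrier V" for x
    using that by (rule scale_closed)
  show "0 \<le> vdist V x y" for x y
    by (simp add: vdist_def norm_nonneg plus_closed m)
  show "vdist V x y = vdist V y x" for x y
  proof (cases "x \<in> vcarrier V \<and> y \<in> vcarrier V")
    case True
    then have x: "x \<in> vcarrier V" and y: "y \<in> vcarrier V" by auto
    have "vscale V (- 1) (vplus V x (vscale V (- 1) y)) = vplus V (vscale V (- 1) x) y"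
      using scale_plus_right[OF x m[OF y], of "- 1"] scale_scale[OF y, of "- 1" "- 1"] scale_one[OF y]
      by simp
    also have "\<dots> = vplus V y (vscale V (- 1) x)" by (rule plus_commute[OF m[OF x] y])
    finally have "vnorm V (vplus V y (vscale V (- 1) x)) = vnorm V (vplus V x (vscale V (- 1) y))"
      using norm_scale[OF plus_closed[OF x m[OF y]], of "- 1"] by simp
    then show ?thesis using x y by (simp add: vdist_def)
  qed (auto simp: vdist_def)
  have cancel: "vplus V (vplus V x (vscale V (- 1) y)) (vplus V y z) = vplus V x z"
    if x: "x \<in> vcarrier V" and y: "y \<in> vcarrier V" and z: "z \<in> vcarrier V" for x y z
  proof -
    have "vplus V (vscale V (- 1) y) (vplus V y z) = vplus V (vplus V (vscale V (- 1) y) y) z"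
      by (rule plus_assoc[OF m[OF y] y z, symmetric])
    also have "\<dots> = vplus V (vzero V) z"
      using plus_commute[OF m[OF y] y] scale_minus_one[OF y] by simp
    also have "\<dots> = z"
      using plus_commute[OF zero_closed z] plus_zero[OF z] by simp
    finally show ?thesis using plus_assoc[OF x m[OF y] plus_closed[OF y z]] by simp
  qed
  show "vdist V x y = 0 \<longleftrightarrow> x = y" if x: "x \<in> vcarrier V" and y: "y \<in> vcarrier V" for x y
  proof
    assume "vdist V x y = 0"
    then have 0: "vplus V x (vscale V (- 1) y) = vzero V"
      using x y norm_eq_zero[OF plus_closed[OF x m[OF y]]] by (simp add: vdist_def)
    show "x = y"
      using cancel[OF x y zero_closed] 0 plus_zero[OF x] plus_zero[OF y]
        plus_commute[OF zero_closed y] by simp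
  next
    assume "x = y"
    then show "vdist V x y = 0"
      using y scale_minus_one[OF y] norm_eq_zero[OF zero_closed] by (simp add: vdist_def)
  qed
  show "vdist V x z \<le> vdist V x y + vdist V y z"
    if x: "x \<in> vcarrier V" and y: "y \<in> vcarrier V" and z: "z \<in> vcarrier V" for x y z
    using cancel[OF x y m[OF z]]
      norm_triangle[OF plus_closed[OF x m[OF y]] plus_closed[OF y m[OF z]]] x y z
    by (simp add: vdist_def)
qed

end


section \<open>Bounded multilinear operators\<close>

text \<open>The product \<open>X\<^sub>1 \<times> \<dots> \<times> X\<^sub>n\<close>; the spaces are indexed by a finite type \<open>'n\<close>, so
  \<open>n = CARD('n) \<ge> 1\<close>. The carriers of the \<open>X i\<close> are arbitrary subsets of one type \<open>'a\<close>, with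
  unrelated operations and norms.\<close>

definition tuples :: "('n::finite \<Rightarrow> ('k, 'a) nspace) \<Rightarrow> ('n \<Rightarrow> 'a) set" where
  "tuples X = {x. \<forall>i. x i \<in> vcarrier (X i)}"

definition ball_tuples :: "('n::finite \<Rightarrow> ('k, 'a) nspace) \<Rightarrow> ('n \<Rightarrow> 'a) set" where
  "ball_tuples X = {x \<in> tuples X. \<forall>i. vnorm (X i) (x i) \<le> 1}"

text \<open>Operators are functions on the whole type \<open>'n \<Rightarrow> 'a\<close>; only their values on
  \<open>tuples X\<close> are ever used.\<close>

definition bounded_multilinear ::
    "('n::finite \<Rightarrow> ('k::real_normed_field, 'a) nspace) \<Rightarrow> ('k, 'b) nspace \<Rightarrow> (('n \<Rightarrow> 'a) \<Rightarrow> 'b) set"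
  where "bounded_multilinear X Y = {T.
    (\<forall>x\<in>tuples X. T x \<in> vcarrier Y) \<and>
    (\<forall>x\<in>tuples X. \<forall>i. \<forall>a\<in>vcarrier (X i). \<forall>b\<in>vcarrier (X i).
      T (x(i := vplus (X i) a b)) = vplus Y (T (x(i := a))) (T (x(i := b)))) \<and>
    (\<forall>x\<in>tuples X. \<forall>i. \<forall>a\<in>vcarrier (X i). \<forall>c.
      T (x(i := vscale (X i) c a)) = vscale Y c (T (x(i := a)))) \<and>
    (\<exists>C. \<forall>x\<in>tuples X. vnorm Y (T x) \<le> C * (\<Prod>i\<in>UNIV. vnorm (X i) (x i)))}"

abbreviation bounded_forms ::
    "('n::finite \<Rightarrow> ('k::real_normed_field, 'a) nspace) \<Rightarrow> (('n \<Rightarrow> 'a) \<Rightarrow> 'k) set" where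
  "bounded_forms X \<equiv> bounded_multilinear X scalar_space"

definition form_norm ::
    "('n::finite \<Rightarrow> ('k::real_normed_field, 'a) nspace) \<Rightarrow> (('n \<Rightarrow> 'a) \<Rightarrow> 'k) \<Rightarrow> real" where
  "form_norm X \<phi> = (SUP x\<in>ball_tuples X. norm (\<phi> x))"

definition form_ball ::
    "('n::finite \<Rightarrow> ('k::real_normed_field, 'a) nspace) \<Rightarrow> (('n \<Rightarrow> 'a) \<Rightarrow> 'k) set" where
  "form_ball X = {\<phi> \<in> bounded_forms X. form_norm X \<phi> \<le> 1}"


section \<open>Lipschitz summing operators\<close>

definition lip_summing ::
    "real \<Rightarrow> ('n::finite \<Rightarrow> ('k::real_normed_field, 'a) nspace) \<Rightarrow> ('k, 'b) nspace
      \<Rightarrow> (('n \<Rightarrow> 'a) \<Rightarrow> 'b) set"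
  where "lip_summing p X Y = {T \<in> bounded_multilinear X Y.
    \<exists>c>0. \<forall>k::nat. \<forall>u v. (\<forall>i\<in>{1..k}. u i \<in> tuples X \<and> v i \<in> tuples X) \<longrightarrow>
      (\<Sum>i=1..k. vdist Y (T (u i)) (T (v i)) powr p) powr (1 / p)
        \<le> c * (SUP \<phi>\<in>form_ball X. (\<Sum>i=1..k. norm (\<phi> (u i) - \<phi> (v i)) powr p) powr (1 / p))}"


section \<open>The algebraic tensor product with the projective norm\<close>

text \<open>Formal linear combinations of tuples are elements of \<open>('n \<Rightarrow> 'a) \<Rightarrow>\<^sub>0 'k\<close>.\<close>

definition fscale :: "'k::field \<Rightarrow> ('x \<Rightarrow>\<^sub>0 'k) \<Rightarrow> ('x \<Rightarrow>\<^sub>0 'k)" where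
  "fscale c f = Poly_Mapping.map (\<lambda>a. c * a) f"

lemma lookup_fscale [simp]: "poly_mapping.lookup (fscale c f) x = c * poly_mapping.lookup f x"
  by (simp add: fscale_def Poly_Mapping.map.rep_eq when_def)

lemma vector_space_fscale: "vector_space fscale"
  by unfold_locales (simp_all add: poly_mapping_eq_iff fun_eq_iff lookup_add distrib_left distrib_right mult.assoc)

definition formal_sums ::
    "('n::finite \<Rightarrow> ('k::real_normed_field, 'a) nspace) \<Rightarrow> (('n \<Rightarrow> 'a) \<Rightarrow>\<^sub>0 'k) set" where
  "formal_sums X = {f. Poly_Mapping.keys f \<subseteq> tuples X}"

definition multilinear_relations ::
    "('n::finite \<Rightarrow> ('k::real_normed_field, 'a) nspace) \<Rightarrow> (('n \<Rightarrow> 'a) \<Rightarrow>\<^sub>0 'k) set" where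
  "multilinear_relations X =
    {Poly_Mapping.single (x(i := vplus (X i) a b)) 1
        - Poly_Mapping.single (x(i := a)) 1 - Poly_Mapping.single (x(i := b)) 1 | x i a b.
      x \<in> tuples X \<and> a \<in> vcarrier (X i) \<and> b \<in> vcarrier (X i)} \<union>
    {Poly_Mapping.single (x(i := vscale (X i) c a)) 1
        - fscale c (Poly_Mapping.single (x(i := a)) 1) | x i a c.
      x \<in> tuples X \<and> a \<in> vcarrier (X i)}"

definition tensor_class ::
    "('n::finite \<Rightarrow> ('k::real_normed_field, 'a) nspace) \<Rightarrow> (('n \<Rightarrow> 'a) \<Rightarrow>\<^sub>0 'k)
      \<Rightarrow> (('n \<Rightarrow> 'a) \<Rightarrow>\<^sub>0 'k) set" where
  "tensor_class X f =
    {g \<in> formal_sums X. g - f \<in> module.span fscale (multilinear_relations X)}"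

text \<open>The norm is \<open>\<pi>(t) = inf {\<Sum>\<^sub>j \<Prod>\<^sub>i \<parallel>x\<^sub>j i\<parallel> : t = \<Sum>\<^sub>j x\<^sub>j 1 \<otimes> \<dots> \<otimes> x\<^sub>j n}\<close>, where the finite
  family of elementary tensors is the list \<open>xs\<close>.\<close>

definition alg_tensor ::
    "('n::finite \<Rightarrow> ('k::real_normed_field, 'a) nspace) \<Rightarrow> ('k, (('n \<Rightarrow> 'a) \<Rightarrow>\<^sub>0 'k) set) nspace"
  where "alg_tensor X = \<lparr>
    vcarrier = tensor_class X ` formal_sums X,
    vplus = (\<lambda>s t. \<Union>f\<in>s. \<Union>g\<in>t. tensor_class X (f + g)),
    vzero = tensor_class X 0,
    vscale = (\<lambda>c s. \<Union>f\<in>s. tensor_class X (fscale c f)),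
    vnorm = (\<lambda>t. Inf {\<Sum>x\<leftarrow>xs. \<Prod>i\<in>UNIV. vnorm (X i) (x i) | xs.
      set xs \<subseteq> tuples X \<and> (\<Sum>x\<leftarrow>xs. Poly_Mapping.single x 1) \<in> t})\<rparr>"


section \<open>Completion of a normed space\<close>

definition cauchy_class ::
    "('k::real_normed_field, 'a) nspace \<Rightarrow> (nat \<Rightarrow> 'a) \<Rightarrow> (nat \<Rightarrow> 'a) set" where
  "cauchy_class V s = {t. vCauchy V t \<and> (\<lambda>m. vdist V (s m) (t m)) \<longlonglongrightarrow> 0}"

definition completion ::
    "('k::real_normed_field, 'a) nspace \<Rightarrow> ('k, (nat \<Rightarrow> 'a) set) nspace" where
  "completion V = \<lparr>
    vcarrier = cauchy_class V ` {s. vCauchy V s},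
    vplus = (\<lambda>S T. \<Union>s\<in>S. \<Union>t\<in>T. cauchy_class V (\<lambda>m. vplus V (s m) (t m))),
    vzero = cauchy_class V (\<lambda>_. vzero V),
    vscale = (\<lambda>c S. \<Union>s\<in>S. cauchy_class V (\<lambda>m. vscale V c (s m))),
    vnorm = (\<lambda>S. THE r. \<forall>s\<in>S. (\<lambda>m. vnorm V (s m)) \<longlonglongrightarrow> r)\<rparr>"

definition completion_embed ::
    "('k::real_normed_field, 'a) nspace \<Rightarrow> 'a \<Rightarrow> (nat \<Rightarrow> 'a) set" where
  "completion_embed V x = cauchy_class V (\<lambda>_. x)"

definition proj_tensor ::
    "('n::finite \<Rightarrow> ('k::real_normed_field, 'a) nspace)
      \<Rightarrow> ('k, (nat \<Rightarrow> (('n \<Rightarrow> 'a) \<Rightarrow>\<^sub>0 'k) set) set) nspace" where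
  "proj_tensor X = completion (alg_tensor X)"

definition elem_tensor ::
    "('n::finite \<Rightarrow> ('k::real_normed_field, 'a) nspace) \<Rightarrow> ('n \<Rightarrow> 'a)
      \<Rightarrow> (nat \<Rightarrow> (('n \<Rightarrow> 'a) \<Rightarrow>\<^sub>0 'k) set) set" where
  "elem_tensor X x =
    completion_embed (alg_tensor X) (tensor_class X (Poly_Mapping.single x 1))"


section \<open>Dunford-Pettis multilinear operators\<close>

definition dual_space :: "('k::real_normed_field, 'a) nspace \<Rightarrow> ('a \<Rightarrow> 'k) set" where
  "dual_space V = {\<psi>.
    (\<forall>x\<in>vcarrier V. \<forall>y\<in>vcarrier V. \<psi> (vplus V x y) = \<psi> x + \<psi> y) \<and>
    (\<forall>c. \<forall>x\<in>vcarrier V. \<psi> (vscale V c x) = c * \<psi> x) \<and>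
    (\<exists>C. \<forall>x\<in>vcarrier V. norm (\<psi> x) \<le> C * vnorm V x)}"

definition weakly_Cauchy :: "('k::real_normed_field, 'a) nspace \<Rightarrow> (nat \<Rightarrow> 'a) \<Rightarrow> bool" where
  "weakly_Cauchy V z \<longleftrightarrow> range z \<subseteq> vcarrier V \<and> (\<forall>\<psi>\<in>dual_space V. Cauchy (\<lambda>m. \<psi> (z m)))"

definition segre ::
    "('n::finite \<Rightarrow> ('k::real_normed_field, 'a) nspace)
      \<Rightarrow> (nat \<Rightarrow> (('n \<Rightarrow> 'a) \<Rightarrow>\<^sub>0 'k) set) set set" where
  "segre X = elem_tensor X ` tuples X"

definition segre_map ::
    "('n::finite \<Rightarrow> ('k::real_normed_field, 'a) nspace) \<Rightarrow> (('n \<Rightarrow> 'a) \<Rightarrow> 'b)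
      \<Rightarrow> (nat \<Rightarrow> (('n \<Rightarrow> 'a) \<Rightarrow>\<^sub>0 'k) set) set \<Rightarrow> 'b" where
  "segre_map X T z = (THE y. \<exists>x\<in>tuples X. z = elem_tensor X x \<and> y = T x)"

definition dunford_pettis ::
    "('n::finite \<Rightarrow> ('k::real_normed_field, 'a) nspace) \<Rightarrow> ('k, 'b) nspace
      \<Rightarrow> (('n \<Rightarrow> 'a) \<Rightarrow> 'b) set"
  where "dunford_pettis X Y = {T \<in> bounded_multilinear X Y.
    \<forall>z. range z \<subseteq> segre X \<and> weakly_Cauchy (proj_tensor X) z \<longrightarrow>
      (\<exists>l. limitin (vtopology Y) (\<lambda>m. segre_map X T (z m)) l sequentially)}"

end

theory Submission
  imports Defs
begin

text \<open>
  Pietsch domination would turn the summing inequality into an integral inequality over the unit ball of the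
  multilinear forms, and dominated convergence would finish the proof. The argument below replaces
  the measure by convex combinations. Let \<open>x m\<close> be tuples whose elementary tensors are weakly Cauchy
  in the completed projective tensor product. Every bounded \<open>n\<close>-linear form \<open>\<phi>\<close> extends to a bounded functional there
  (\<open>bounded_form_factors_proj_tensor\<close>), so \<open>\<phi> (x m)\<close> is Cauchy. The unit ball \<open>K\<close> of the forms
  is compact for pointwise convergence, so the values \<open>\<phi> (x m)\<close> are bounded uniformly over \<open>\<phi>\<close> in \<open>K\<close>
  (\<open>pointwise_bounded_on_compact_absconvex\<close>).

  Suppose that \<open>T (x m)\<close> is not Cauchy: there are \<open>\<epsilon> > 0\<close> and indices \<open>a n, b n\<close> tending to infinity with
  \<open>\<parallel>T (x (a n)) - T (x (b n))\<parallel> \<ge> \<epsilon>\<close>. The continuous functions \<open>f n \<phi> = \<bar>\<phi> (x (a n)) - \<phi> (x (b n))\<bar> ^ p\<close>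
  on \<open>K\<close> are uniformly bounded and tend to \<open>0\<close> pointwise, so some convex combination of them is uniformly small
  (\<open>convex_combination_uniformly_small\<close>). The summing inequality holds with weights
  (\<open>weighted_summing_inequality\<close>); for the weights of that combination its left-hand side is at least
  \<open>\<epsilon> ^ p\<close> and its right-hand side is small, a contradiction.

  The completion of the algebraic tensor product is meaningful only if the projective norm is definite.
  This rests on enough bounded functionals on each \<open>X i\<close>, that is, on the
  Hahn-Banach theorem, which is proved over the reals by minimal sublinear functionals. To pass to
  the abstract scalar field one has to know that this field is the real or the complex numbers.\<close>

section \<open>The possible scalar fields\<close>

text \<open>The value at \<open>h\<close> of the real polynomial \<open>(t - z) * (t - cnj z)\<close>. It makes sense in
  every field over the reals, also in one that does not contain a square root of \<open>-1\<close>.\<close>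

definition cquad :: "'k::real_normed_field \<Rightarrow> complex \<Rightarrow> 'k" where
  "cquad h z = h\<^sup>2 - of_real (2 * Re z) * h + of_real ((cmod z)\<^sup>2)"

lemma cquad_power2: "cquad (h\<^sup>2) (z\<^sup>2) = cquad h z * cquad h (- z)"
proof -
  define x y where "x = (of_real (Re z) :: 'a)" and "y = (of_real (Im z) :: 'a)"
  have n: "(of_real ((cmod z)\<^sup>2) :: 'a) = x\<^sup>2 + y\<^sup>2"
    by (simp add: cmod_power2 x_def y_def)
  have n2: "(of_real ((cmod (z\<^sup>2))\<^sup>2) :: 'a) = (x\<^sup>2 + y\<^sup>2)\<^sup>2"
    by (simp add: norm_power flip: n)
  have r: "(of_real (2 * Re (z\<^sup>2)) :: 'a) = 2 * (x\<^sup>2 - y\<^sup>2)"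
    by (simp add: x_def y_def Re_power2)
  have r1: "(of_real (2 * Re z) :: 'a) = 2 * x" "(of_real (2 * Re (- z)) :: 'a) = - (2 * x)"
    by (simp_all add: x_def)
  show ?thesis
    unfolding cquad_def n2 r r1 norm_minus_cancel n by (simp add: power2_eq_square algebra_simps)
qed

lemma cquad_shift: "cquad (h + of_real t) (z + of_real t) = cquad h z"
proof -
  define x y where "x = (of_real (Re z) :: 'a)" and "y = (of_real (Im z) :: 'a)"
  define s where "s = (of_real t :: 'a)"
  have n: "(of_real ((cmod z)\<^sup>2) :: 'a) = x\<^sup>2 + y\<^sup>2"
    by (simp add: cmod_power2 x_def y_def)
  have n2: "(of_real ((cmod (z + of_real t))\<^sup>2) :: 'a) = (x + s)\<^sup>2 + y\<^sup>2"
    by (simp add: cmod_power2 x_def y_def s_def)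
  have r1: "(of_real (2 * Re z) :: 'a) = 2 * x" "(of_real (2 * Re (z + of_real t)) :: 'a) = 2 * (x + s)"
    by (simp_all add: x_def s_def)
  show ?thesis
    unfolding cquad_def n2 n r1 s_def[symmetric] by (simp add: power2_eq_square algebra_simps)
qed

lemma cquad_of_real: "cquad h (of_real t) = (h - of_real t)\<^sup>2"
  by (simp add: cquad_def power2_eq_square algebra_simps)

text \<open>Squaring multiplies: \<open>cquad_power2\<close> splits the quadratic of \<open>h\<^sup>2\<close> at \<open>\<zeta>\<^sup>2\<close> into the
  quadratics of \<open>h\<close> at the two square roots of \<open>\<zeta>\<^sup>2\<close>. After \<open>k\<close> squarings there are \<open>2 ^ k\<close> factors:
  one of them is the quadratic at \<open>\<zeta>\<close>, and each of the others is at least \<open>B\<close>.\<close>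

lemma cquad_iterated_square_lower_bound:
  fixes h :: "'k::real_normed_field"
  assumes lb: "\<And>\<zeta>. B \<le> norm (cquad h \<zeta>)" and B: "0 \<le> B"
  shows "norm (cquad h \<zeta>) * B ^ (2 ^ k - 1) \<le> norm (cquad (h ^ 2 ^ k) (\<zeta> ^ 2 ^ k))"
proof -
  have all: "B ^ 2 ^ k \<le> norm (cquad (h ^ 2 ^ k) (\<zeta> ^ 2 ^ k))
    \<and> norm (cquad h \<zeta>) * B ^ (2 ^ k - 1) \<le> norm (cquad (h ^ 2 ^ k) (\<zeta> ^ 2 ^ k))" for \<zeta>
  proof (induction k arbitrary: \<zeta>)
    case 0
    then show ?case using lb by simp
  next
    case (Suc k)
    obtain \<xi> where \<xi>: "- (\<zeta> ^ 2 ^ k) = \<xi> ^ 2 ^ k"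
      using exists_complex_root[of "2 ^ k" "- (\<zeta> ^ 2 ^ k)"] by auto
    let ?F = "norm (cquad (h ^ 2 ^ k) (\<zeta> ^ 2 ^ k))" and ?G = "norm (cquad (h ^ 2 ^ k) (\<xi> ^ 2 ^ k))"
    have e: "norm (cquad (h ^ 2 ^ Suc k) (\<zeta> ^ 2 ^ Suc k)) = ?F * ?G"
      using cquad_power2[of "h ^ 2 ^ k" "\<zeta> ^ 2 ^ k"]
      by (simp add: norm_mult \<xi> power_mult[symmetric] mult.commute)
    have G: "B ^ 2 ^ k \<le> ?G" using Suc.IH[of \<xi>] by blast
    have "B ^ 2 ^ k * B ^ 2 ^ k \<le> ?F * ?G"
      using Suc.IH[of \<zeta>] G B by (intro mult_mono) auto
    moreover have "norm (cquad h \<zeta>) * B ^ (2 ^ k - 1) * B ^ 2 ^ k \<le> ?F * ?G"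
      using Suc.IH[of \<zeta>] G B by (intro mult_mono) auto
    moreover have "(2::nat) ^ Suc k - 1 = (2 ^ k - 1) + 2 ^ k" "(2::nat) ^ Suc k = 2 ^ k + 2 ^ k" by simp_all
    ultimately show ?case unfolding e by (simp only: power_add mult.assoc)
  qed
  then show ?thesis by blast
qed

lemma le_if_le_one_plus_half_powers:
  fixes L \<mu> :: real
  assumes "0 < \<mu>" and le: "\<And>k. L \<le> \<mu> * (1 + (1 / 2) ^ 2 ^ k)"
  shows "L \<le> \<mu>"
proof (rule LIMSEQ_le_const)
  have "(\<lambda>k::nat. (1 / 2 :: real) ^ 2 ^ k) \<longlonglongrightarrow> 0"
  proof (rule tendsto_sandwich[OF _ _ tendsto_const])
    show "(\<lambda>k. (1 / 2 :: real) ^ k) \<longlonglongrightarrow> 0" by (rule LIMSEQ_power_zero) simp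
    show "\<forall>\<^sub>F k in sequentially. (1 / 2 :: real) ^ 2 ^ k \<le> (1 / 2) ^ k"
      by (intro always_eventually allI power_decreasing) (auto simp: less_imp_le)
  qed auto
  then show "(\<lambda>k. \<mu> * (1 + (1 / 2) ^ 2 ^ k)) \<longlonglongrightarrow> \<mu>"
    by (auto intro!: tendsto_eq_intros)
  show "\<exists>N. \<forall>n\<ge>N. L \<le> \<mu> * (1 + (1 / 2) ^ 2 ^ n)" using le by blast
qed

text \<open>The minimum \<open>\<mu>\<close> of \<open>z \<mapsto> \<parallel>(a - z) * (a - cnj z)\<parallel>\<close> over the complex plane is attained. Were it
  positive, then from every minimal value \<open>h\<close> one could pass to the minimal value \<open>h + \<mu> / 2\<close>: the
  quadratics of \<open>h\<close> are products of two quadratics of \<open>a\<close>, hence at least \<open>\<mu>\<^sup>2\<close>, and the squaring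
  bound with \<open>\<eta> = - \<mu> / 2\<close> leaves \<open>\<parallel>h - \<eta>\<parallel>\<close> no room above \<open>\<mu>\<close>. Repeating the
  step gives values that are arbitrarily large and yet of norm \<open>\<mu>\<close>.\<close>

lemma cquad_has_zero:
  fixes a :: "'k::real_normed_field"
  shows "\<exists>z. cquad a z = 0"
proof -
  have "continuous_on (cball 0 (3 * norm a)) (\<lambda>z. norm (cquad a z))"
    unfolding cquad_def by (intro continuous_intros)
  moreover have "cball (0::complex) (3 * norm a) \<noteq> {}" by simp
  ultimately obtain z0 where z0: "\<forall>z\<in>cball 0 (3 * norm a). norm (cquad a z0) \<le> norm (cquad a z)"
    using continuous_attains_inf[OF compact_cball] by blast
  define \<mu> where "\<mu> = norm (cquad a z0)"
  \<comment> \<open>Outside the disc the quadratic is at least as large as at \<open>0\<close>: there \<open>\<bar>z\<bar>\<close> is more than three times the norm of \<open>a\<close>.\<close>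
  have min: "\<mu> \<le> norm (cquad a z)" for z
  proof (cases "cmod z \<le> 3 * norm a")
    case True
    then show ?thesis using z0 by (simp add: \<mu>_def)
  next
    case False
    have "\<mu> \<le> norm (cquad a 0)" using z0 by (simp add: \<mu>_def)
    also have "\<dots> = (norm a)\<^sup>2" by (simp add: cquad_def norm_power)
    also have "\<dots> \<le> (cmod z)\<^sup>2 - 2 * cmod z * norm a - (norm a)\<^sup>2"
    proof -
      have "(3 * norm a) * norm a \<le> cmod z * (cmod z - 2 * norm a)"
        using False by (intro mult_mono) auto
      then have "3 * (norm a * norm a) \<le> cmod z * cmod z - 2 * (cmod z * norm a)"
        by (simp add: algebra_simps)
      moreover have "0 \<le> norm a * norm a" by simp
      ultimately show ?thesis unfolding power2_eq_square mult.assoc by linarith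
    qed
    also have "\<dots> \<le> norm (cquad a z)"
    proof -
      have "(cmod z)\<^sup>2 = norm (cquad a z - a\<^sup>2 + of_real (2 * Re z) * a)"
        by (simp add: cquad_def norm_power)
      also have "\<dots> \<le> norm (cquad a z - a\<^sup>2) + norm (of_real (2 * Re z) * a)"
        by (rule norm_triangle_ineq)
      also have "\<dots> \<le> (norm (cquad a z) + norm (a\<^sup>2)) + norm (of_real (2 * Re z) * a)"
        by (intro add_right_mono norm_triangle_ineq4)
      also have "norm (of_real (2 * Re z) * a) \<le> 2 * cmod z * norm a"
        using abs_Re_le_cmod[of z] by (simp add: norm_mult abs_mult mult_right_mono del: of_real_mult)
      finally show ?thesis by (simp add: norm_power)
    qed
    finally show ?thesis .
  qed
  have "\<mu> = 0"
  proof (rule ccontr)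
    assume "\<mu> \<noteq> 0"
    then have \<mu>: "0 < \<mu>" by (simp add: \<mu>_def)
    have step: "\<exists>w. cquad a w = cquad a z + of_real (\<mu> / 2) \<and> norm (cquad a w) = \<mu>"
      if z: "norm (cquad a z) = \<mu>" for z
    proof -
      define h where "h = cquad a z"
      \<comment> \<open>Completing the square, \<open>h = b\<^sup>2 + (Im z)\<^sup>2\<close>; so the quadratic of \<open>h\<close> at \<open>\<zeta>\<close> is that of \<open>b\<^sup>2\<close> at \<open>\<gamma>\<^sup>2\<close>.\<close>
      have h_min: "\<mu>\<^sup>2 \<le> norm (cquad h \<zeta>)" for \<zeta>
      proof -
        obtain \<gamma> where \<gamma>: "\<zeta> - of_real ((Im z)\<^sup>2) = \<gamma>\<^sup>2"
          using exists_complex_root[of 2 "\<zeta> - of_real ((Im z)\<^sup>2)"] by auto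
        define b where "b = a - of_real (Re z)"
        have h: "h = b\<^sup>2 + of_real ((Im z)\<^sup>2)"
          unfolding h_def cquad_def b_def cmod_power2 by (simp add: power2_eq_square algebra_simps)
        have "cquad h \<zeta> = cquad (b\<^sup>2) (\<gamma>\<^sup>2)"
          using cquad_shift[of "b\<^sup>2" "(Im z)\<^sup>2" "\<gamma>\<^sup>2"] by (simp add: h flip: \<gamma>)
        also have "\<dots> = cquad b \<gamma> * cquad b (- \<gamma>)" by (rule cquad_power2)
        also have "\<dots> = cquad a (\<gamma> + of_real (Re z)) * cquad a (- \<gamma> + of_real (Re z))"
          using cquad_shift[of b "Re z" \<gamma>] cquad_shift[of b "Re z" "- \<gamma>"] by (simp add: b_def)
        finally show ?thesis
          using mult_mono[OF min min, of "\<gamma> + of_real (Re z)" "- \<gamma> + of_real (Re z)"] \<mu>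
          by (simp add: norm_mult power2_eq_square)
      qed
      \<comment> \<open>Raising the imaginary part of \<open>z\<close> adds a positive constant to the quadratic.\<close>
      define \<eta> where "\<eta> = - \<mu> / 2"
      define w where "w = Complex (Re z) (sqrt ((Im z)\<^sup>2 + \<mu> / 2))"
      have w: "cquad a w = h - of_real \<eta>"
        using \<mu> by (simp add: w_def h_def \<eta>_def cquad_def cmod_power2)
      have "norm (h - of_real \<eta>) \<le> \<mu> * (1 + (1 / 2) ^ 2 ^ k)" for k :: nat
      proof -
        define M where "M = (2::nat) ^ k"
        have M: "0 < M" by (simp add: M_def)
        have "(norm (h - of_real \<eta>))\<^sup>2 * (\<mu>\<^sup>2) ^ (M - 1) \<le> norm (cquad (h ^ M) (of_real \<eta> ^ M))"
          using cquad_iterated_square_lower_bound[OF h_min, of "of_real \<eta>" k]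
          by (simp add: cquad_of_real norm_power M_def)
        also have "\<dots> = (norm (h ^ M - of_real (\<eta> ^ M)))\<^sup>2"
          using cquad_of_real[of "h ^ M" "\<eta> ^ M"] by (simp add: norm_power)
        also have "\<dots> \<le> (\<mu> ^ M + (\<mu> / 2) ^ M)\<^sup>2"
        proof (rule power_mono)
          have "norm (h ^ M - of_real (\<eta> ^ M)) \<le> norm (h ^ M) + norm (of_real (\<eta> ^ M) :: 'k)"
            by (rule norm_triangle_ineq4)
          also have "\<dots> = \<mu> ^ M + (\<mu> / 2) ^ M"
            using z \<mu> by (simp add: norm_power h_def \<eta>_def power_abs del: of_real_power)
          finally show "norm (h ^ M - of_real (\<eta> ^ M)) \<le> \<mu> ^ M + (\<mu> / 2) ^ M" .
        qed simp
        also have "\<mu> ^ M + (\<mu> / 2) ^ M = \<mu> ^ (M - 1) * (\<mu> * (1 + (1 / 2) ^ M))"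
          using M power_minus_mult[of M \<mu>] by (simp add: power_divide algebra_simps)
        finally have "(norm (h - of_real \<eta>) * \<mu> ^ (M - 1))\<^sup>2
            \<le> (\<mu> * (1 + (1 / 2) ^ M) * \<mu> ^ (M - 1))\<^sup>2"
          by (simp add: power_mult_distrib power_mult[symmetric] mult.commute)
        then have "norm (h - of_real \<eta>) * \<mu> ^ (M - 1) \<le> \<mu> * (1 + (1 / 2) ^ M) * \<mu> ^ (M - 1)"
          by (rule power2_le_imp_le) (use \<mu> in auto)
        then show ?thesis using \<mu> by (simp add: M_def)
      qed
      then have "norm (h - of_real \<eta>) \<le> \<mu>" by (rule le_if_le_one_plus_half_powers[OF \<mu>])
      then have "norm (cquad a w) = \<mu>" using min[of w] w by simp
      moreover have "cquad a w = cquad a z + of_real (\<mu> / 2)"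
        using w by (simp add: h_def \<eta>_def)
      ultimately show ?thesis by blast
    qed
    have "\<exists>w. cquad a w = cquad a z0 + of_real (real j * (\<mu> / 2)) \<and> norm (cquad a w) = \<mu>" for j
    proof (induction j)
      case 0
      then show ?case by (auto simp: \<mu>_def)
    next
      case (Suc j)
      then obtain w where "cquad a w = cquad a z0 + of_real (real j * (\<mu> / 2))" "norm (cquad a w) = \<mu>"
        by blast
      moreover from step[OF this(2)] obtain w' where
        "cquad a w' = cquad a w + of_real (\<mu> / 2)" "norm (cquad a w') = \<mu>" by blast
      ultimately show ?case by (intro exI[of _ w']) (simp add: algebra_simps add_divide_distrib)
    qed
    from this[of 5] obtain w where w: "cquad a w = cquad a z0 + of_real (5 * (\<mu> / 2))"
      "norm (cquad a w) = \<mu>" by auto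
    have "5 * (\<mu> / 2) = norm (of_real (5 * (\<mu> / 2)) :: 'k)" unfolding norm_of_real using \<mu> by simp
    also have "\<dots> = norm (cquad a w - cquad a z0)" by (simp add: w(1))
    also have "\<dots> \<le> \<mu> + \<mu>" using norm_triangle_ineq4[of "cquad a w" "cquad a z0"] w(2) by (simp add: \<mu>_def)
    finally show False using \<mu> by simp
  qed
  then show ?thesis by (auto simp: \<mu>_def)
qed

text \<open>Ostrowski's theorem. Every element is a root of a real quadratic, so adjoining a
  square root of \<open>-1\<close>, if there is one, exhausts the field.\<close>

theorem real_normed_field_real_or_complex:
  "(\<forall>a::'k::real_normed_field. \<exists>r. a = of_real r)
    \<or> (\<exists>j::'k. j\<^sup>2 = - 1 \<and> (\<forall>a. \<exists>r s. a = of_real r + of_real s * j))"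
proof (cases "\<exists>j::'k. j\<^sup>2 = - 1")
  case True
  then obtain j :: 'k where j: "j\<^sup>2 = - 1" by blast
  have "\<exists>r s. a = of_real r + of_real s * j" for a
  proof -
    obtain z where "cquad a z = 0" using cquad_has_zero by blast
    then have "(a - of_real (Re z))\<^sup>2 + of_real ((Im z)\<^sup>2) = 0"
      unfolding cquad_def cmod_power2 by (simp add: power2_eq_square algebra_simps)
    moreover have "(a - of_real (Re z))\<^sup>2 + of_real ((Im z)\<^sup>2)
        = (a - of_real (Re z) - of_real (Im z) * j) * (a - of_real (Re z) + of_real (Im z) * j)
          + of_real ((Im z)\<^sup>2) * (1 + j\<^sup>2)"
      by (simp add: power2_eq_square algebra_simps)
    ultimately have "(a - of_real (Re z) - of_real (Im z) * j) * (a - of_real (Re z) + of_real (Im z) * j) = 0"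
      by (simp add: j)
    then consider "a - of_real (Re z) - of_real (Im z) * j = 0" | "a - of_real (Re z) + of_real (Im z) * j = 0"
      by auto
    then have "a = of_real (Re z) + of_real (Im z) * j \<or> a = of_real (Re z) + of_real (- Im z) * j"
    proof cases
      case 1
      then show ?thesis by (simp add: algebra_simps)
    next
      case 2
      then show ?thesis using add_eq_0_iff2[of "a - of_real (Re z)" "of_real (Im z) * j"] by (simp add: algebra_simps)
    qed
    then show ?thesis by blast
  qed
  then show ?thesis using j by blast
next
  case False
  have "\<exists>r. a = of_real r" for a :: 'k
  proof -
    obtain z where "cquad a z = 0" using cquad_has_zero by blast
    then have e: "(a - of_real (Re z))\<^sup>2 = - of_real ((Im z)\<^sup>2)"
      unfolding cquad_def cmod_power2 by (simp add: power2_eq_square algebra_simps)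
    have "Im z = 0"
    proof (rule ccontr)
      assume "Im z \<noteq> 0"
      then have "((a - of_real (Re z)) / of_real (Im z))\<^sup>2 = - 1"
        by (simp add: power_divide e)
      then show False using False by blast
    qed
    then show ?thesis using e by auto
  qed
  then show ?thesis by blast
qed

section \<open>Separation of points by bounded functionals\<close>

lemma (in normed_space) plus_exchange:
  assumes "a \<in> vcarrier V" "b \<in> vcarrier V" "c \<in> vcarrier V" "d \<in> vcarrier V"
  shows "vplus V (vplus V a b) (vplus V c d) = vplus V (vplus V a c) (vplus V b d)"
proof -
  have "vplus V (vplus V a b) (vplus V c d) = vplus V a (vplus V (vplus V b c) d)"
    using assms by (simp add: plus_assoc plus_closed)
  also have "\<dots> = vplus V a (vplus V (vplus V c b) d)" using assms by (simp add: plus_commute)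
  also have "\<dots> = vplus V (vplus V a c) (vplus V b d)" using assms by (simp add: plus_assoc plus_closed)
  finally show ?thesis .
qed

lemma (in normed_space) plus_minus_cancel:
  assumes "a \<in> vcarrier V" "b \<in> vcarrier V"
  shows "vplus V (vplus V a b) (vscale V (- 1) a) = b"
  using assms plus_commute[of a b] plus_assoc[of b a "vscale V (- 1) a"]
  by (simp add: scale_closed scale_minus_one plus_zero)

definition (in normed_space) sublinear :: "('a \<Rightarrow> real) \<Rightarrow> bool" where
  "sublinear q \<longleftrightarrow>
    (\<forall>x\<in>vcarrier V. \<forall>y\<in>vcarrier V. q (vplus V x y) \<le> q x + q y) \<and>
    (\<forall>x\<in>vcarrier V. \<forall>t\<ge>0. q (vscale V (of_real t) x) \<le> t * q x)"

lemma (in normed_space) sublinear_plus: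
  "\<lbrakk>sublinear q; x \<in> vcarrier V; y \<in> vcarrier V\<rbrakk> \<Longrightarrow> q (vplus V x y) \<le> q x + q y"
  by (simp add: sublinear_def)

lemma (in normed_space) sublinear_zero:
  assumes "sublinear q" shows "q (vzero V) = 0"
proof -
  have "q (vscale V (of_real 0) (vzero V)) \<le> 0 * q (vzero V)"
    using assms zero_closed unfolding sublinear_def by blast
  moreover have "q (vplus V (vzero V) (vzero V)) \<le> q (vzero V) + q (vzero V)"
    using assms zero_closed by (intro sublinear_plus)
  ultimately show ?thesis by (simp add: plus_zero zero_closed scale_zero_left)
qed

lemma (in normed_space) sublinear_scale:
  assumes q: "sublinear q" and x: "x \<in> vcarrier V" and t: "0 \<le> t"
  shows "q (vscale V (of_real t) x) = t * q x"
proof (cases "t = 0")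
  case True
  then show ?thesis using x q by (simp add: scale_zero_left sublinear_zero)
next
  case False
  have "q (vscale V (of_real (1 / t)) (vscale V (of_real t) x)) \<le> 1 / t * q (vscale V (of_real t) x)"
    using q scale_closed[OF x] t unfolding sublinear_def by (meson divide_nonneg_nonneg zero_le_one)
  moreover have "vscale V (of_real (1 / t)) (vscale V (of_real t) x) = x"
    using x False by (simp add: scale_scale scale_one flip: of_real_mult)
  ultimately have "t * q x \<le> q (vscale V (of_real t) x)" using t False by (simp add: field_simps)
  moreover have "q (vscale V (of_real t) x) \<le> t * q x" using q x t by (simp add: sublinear_def)
  ultimately show ?thesis by simp
qed

lemma (in normed_space) sublinear_minus:
  assumes q: "sublinear q" and x: "x \<in> vcarrier V"
  shows "- q (vscale V (- 1) x) \<le> q x"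
  using sublinear_plus[OF q x scale_closed[OF x, of "- 1"]] scale_minus_one[OF x] sublinear_zero[OF q]
  by simp

lemma (in normed_space) sublinear_norm: "sublinear (vnorm V)"
  by (simp add: sublinear_def norm_triangle norm_scale)

text \<open>The largest sublinear functional below \<open>q\<close> whose value at \<open>- y\<close> is at most \<open>- q y\<close>.
  A minimal \<open>q\<close> equals all its reducts and is therefore odd, hence linear.\<close>

definition (in normed_space) sublinear_reduct :: "('a \<Rightarrow> real) \<Rightarrow> 'a \<Rightarrow> 'a \<Rightarrow> real" where
  "sublinear_reduct q y x =
    (if x \<in> vcarrier V then INF t\<in>{0..}. q (vplus V x (vscale V (of_real t) y)) - t * q y else 0)"

lemma (in normed_space) sublinear_reduct_le:
  assumes q: "sublinear q" and y: "y \<in> vcarrier V" and x: "x \<in> vcarrier V" and t: "0 \<le> t"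
  shows "sublinear_reduct q y x \<le> q (vplus V x (vscale V (of_real t) y)) - t * q y"
proof -
  have "- q (vscale V (- 1) x) \<le> q (vplus V x (vscale V (of_real s) y)) - s * q y" if s: "0 \<le> s" for s
  proof -
    have ys: "vscale V (of_real s) y \<in> vcarrier V" by (rule scale_closed[OF y])
    have "s * q y = q (vscale V (of_real s) y)" using sublinear_scale[OF q y s] by simp
    also have "\<dots> \<le> q (vplus V x (vscale V (of_real s) y)) + q (vscale V (- 1) x)"
      using sublinear_plus[OF q plus_closed[OF x ys] scale_closed[OF x, of "- 1"]]
        plus_minus_cancel[OF x ys] by simp
    finally show ?thesis by simp
  qed
  then have "bdd_below ((\<lambda>t. q (vplus V x (vscale V (of_real t) y)) - t * q y) ` {0..})"
    by (intro bdd_belowI2) auto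
  then show ?thesis unfolding sublinear_reduct_def using x t by (auto intro: cINF_lower)
qed

lemma (in normed_space) sublinear_reduct_greatest:
  assumes "x \<in> vcarrier V"
    and "\<And>t. 0 \<le> t \<Longrightarrow> b \<le> q (vplus V x (vscale V (of_real t) y)) - t * q y"
  shows "b \<le> sublinear_reduct q y x"
  unfolding sublinear_reduct_def using assms by (auto intro: cINF_greatest)

lemma (in normed_space) sublinear_reduct_le_self:
  assumes q: "sublinear q" and y: "y \<in> vcarrier V" and x: "x \<in> vcarrier V"
  shows "sublinear_reduct q y x \<le> q x"
  using sublinear_reduct_le[OF q y x, of 0] by (simp add: scale_zero_left y plus_zero x)

lemma (in normed_space) sublinear_reduct_at_minus:
  assumes q: "sublinear q" and y: "y \<in> vcarrier V"
  shows "sublinear_reduct q y (vscale V (- 1) y) \<le> - q y"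
  using sublinear_reduct_le[OF q y scale_closed[OF y, of "- 1"], of 1]
  by (simp add: scale_one y plus_commute[OF scale_closed[OF y] y] scale_minus_one sublinear_zero[OF q])

lemma (in normed_space) sublinear_reduct_sublinear:
  assumes q: "sublinear q" and y: "y \<in> vcarrier V"
  shows "sublinear (sublinear_reduct q y)"
  unfolding sublinear_def
proof (intro conjI ballI allI impI)
  fix x x' assume x: "x \<in> vcarrier V" and x': "x' \<in> vcarrier V"
  let ?r = "sublinear_reduct q y"
  have ts: "?r (vplus V x x') \<le> (q (vplus V x (vscale V (of_real t) y)) - t * q y)
        + (q (vplus V x' (vscale V (of_real s) y)) - s * q y)" if t: "0 \<le> t" and s: "0 \<le> s" for t s
  proof -
    have m: "vscale V c y \<in> vcarrier V" for c by (rule scale_closed[OF y])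
    have "?r (vplus V x x') \<le> q (vplus V (vplus V x x') (vscale V (of_real (t + s)) y)) - (t + s) * q y"
      by (rule sublinear_reduct_le[OF q y plus_closed[OF x x']]) (use t s in simp)
    also have "vplus V (vplus V x x') (vscale V (of_real (t + s)) y)
        = vplus V (vplus V x (vscale V (of_real t) y)) (vplus V x' (vscale V (of_real s) y))"
      by (simp add: scale_plus_left[OF y] plus_exchange x x' m)
    also have "q \<dots> \<le> q (vplus V x (vscale V (of_real t) y)) + q (vplus V x' (vscale V (of_real s) y))"
      by (intro sublinear_plus[OF q] plus_closed x x' m)
    finally show ?thesis by (simp add: algebra_simps)
  qed
  have "?r (vplus V x x') - (q (vplus V x (vscale V (of_real t) y)) - t * q y) \<le> ?r x'" if "0 \<le> t" for t
    by (rule sublinear_reduct_greatest[OF x']) (use ts[OF that] in \<open>simp add: algebra_simps\<close>)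
  then have "?r (vplus V x x') - ?r x' \<le> ?r x"
    by (intro sublinear_reduct_greatest[OF x]) (simp add: algebra_simps)
  then show "?r (vplus V x x') \<le> ?r x + ?r x'" by simp
next
  fix x and t :: real assume x: "x \<in> vcarrier V" and t: "0 \<le> t"
  let ?r = "sublinear_reduct q y"
  have m: "vscale V c y \<in> vcarrier V" for c by (rule scale_closed[OF y])
  show "?r (vscale V (of_real t) x) \<le> t * ?r x"
  proof (cases "t = 0")
    case True
    then show ?thesis
      using sublinear_reduct_le_self[OF q y zero_closed] sublinear_zero[OF q] by (simp add: scale_zero_left x)
  next
    case False
    have "?r (vscale V (of_real t) x) / t \<le> q (vplus V x (vscale V (of_real s) y)) - s * q y" if s: "0 \<le> s" for s
    proof -
      have "?r (vscale V (of_real t) x)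
          \<le> q (vplus V (vscale V (of_real t) x) (vscale V (of_real (t * s)) y)) - (t * s) * q y"
        by (rule sublinear_reduct_le[OF q y scale_closed[OF x]]) (use t s in simp)
      also have "vplus V (vscale V (of_real t) x) (vscale V (of_real (t * s)) y)
          = vscale V (of_real t) (vplus V x (vscale V (of_real s) y))"
        by (simp add: scale_plus_right x m scale_scale y)
      also have "q \<dots> = t * q (vplus V x (vscale V (of_real s) y))"
        by (rule sublinear_scale[OF q plus_closed[OF x m] t])
      finally show ?thesis using False t by (simp add: field_simps)
    qed
    then have "?r (vscale V (of_real t) x) / t \<le> ?r x" by (rule sublinear_reduct_greatest[OF x])
    then show ?thesis using False t by (simp add: field_simps)
  qed
qed

lemma (in normed_space) odd_sublinear_additive:
  assumes q: "sublinear q" and odd: "\<And>x. x \<in> vcarrier V \<Longrightarrow> q (vscale V (- 1) x) = - q x"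
    and x: "x \<in> vcarrier V" and y: "y \<in> vcarrier V"
  shows "q (vplus V x y) = q x + q y"
proof (rule antisym)
  show "q (vplus V x y) \<le> q x + q y" by (rule sublinear_plus[OF q x y])
  have "- q (vplus V x y) = q (vplus V (vscale V (- 1) x) (vscale V (- 1) y))"
    using odd[OF plus_closed[OF x y]] by (simp add: scale_plus_right x y)
  also have "\<dots> \<le> - q x - q y"
    using sublinear_plus[OF q scale_closed[OF x] scale_closed[OF y], of "- 1" "- 1"] odd[OF x] odd[OF y] by simp
  finally show "q x + q y \<le> q (vplus V x y)" by simp
qed

text \<open>Zorn's lemma applies because the pointwise infimum of a chain is again sublinear; the
  values at \<open>x\<close> are bounded below by \<open>- q0 (- x)\<close>.\<close>

lemma (in normed_space) minimal_sublinear_exists: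
  assumes q0: "sublinear q0"
  obtains m where "sublinear m" "\<And>x. x \<in> vcarrier V \<Longrightarrow> m x \<le> q0 x"
    "\<And>q x. sublinear q \<Longrightarrow> (\<And>x. x \<in> vcarrier V \<Longrightarrow> q x \<le> m x) \<Longrightarrow> x \<in> vcarrier V \<Longrightarrow> q x = m x"
proof -
  define restr where "restr q x = (if x \<in> vcarrier V then q x else 0)" for q :: "'a \<Rightarrow> real" and x
  have restr: "sublinear (restr q)" if "sublinear q" for q
    using that by (simp add: restr_def sublinear_def plus_closed scale_closed)
  define A where "A = {q. sublinear q \<and> q \<le> restr q0 \<and> (\<forall>x. x \<notin> vcarrier V \<longrightarrow> q x = 0)}"
  have restr_A: "restr q \<in> A" if "sublinear q" "\<And>x. x \<in> vcarrier V \<Longrightarrow> q x \<le> q0 x" for q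
    using that restr[of q] by (auto simp: A_def le_fun_def restr_def)
  have "\<exists>m\<in>A. \<forall>a\<in>A. m \<ge> a \<longrightarrow> a = m"
  proof (rule predicate_Zorn)
    show "partial_order_on A (relation_of (\<ge>) A)"
      by (auto simp: partial_order_on_def preorder_on_def refl_on_def trans_def antisym_def relation_of_def)
  next
    fix C assume C: "C \<in> Chains (relation_of (\<ge>) A)"
    show "\<exists>u\<in>A. \<forall>a\<in>C. u \<le> a"
    proof (cases "C = {}")
      case True
      then show ?thesis using restr_A[OF q0] by auto
    next
      case False
      have CA: "sublinear q" "q \<le> restr q0" "x \<notin> vcarrier V \<Longrightarrow> q x = 0" if "q \<in> C" for q x
        using C that by (auto simp: Chains_def relation_of_def A_def)
      have total: "q \<le> q' \<or> q' \<le> q" if "q \<in> C" "q' \<in> C" for q q'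
        using C that by (auto simp: Chains_def relation_of_def)
      define u where "u x = (INF q\<in>C. q x)" for x
      have bdd: "bdd_below ((\<lambda>q. q x) ` C)" for x
      proof (cases "x \<in> vcarrier V")
        case True
        have "- restr q0 (vscale V (- 1) x) \<le> q x" if "q \<in> C" for q
          using sublinear_minus[OF CA(1)[OF that] True] le_funD[OF CA(2)[OF that], of "vscale V (- 1) x"] by linarith
        then show ?thesis by (intro bdd_belowI2)
      next
        case False
        have "0 \<le> q x" if "q \<in> C" for q using CA(3)[OF that False] by simp
        then show ?thesis by (intro bdd_belowI2)
      qed
      have u_le: "u x \<le> q x" if "q \<in> C" for q x
        unfolding u_def by (rule cINF_lower[OF bdd that])
      have u_greatest: "b \<le> u x" if "\<And>q. q \<in> C \<Longrightarrow> b \<le> q x" for b x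
        unfolding u_def using False that by (rule cINF_greatest)
      have "sublinear u"
        unfolding sublinear_def
      proof (intro conjI ballI allI impI)
        fix x y assume x: "x \<in> vcarrier V" and y: "y \<in> vcarrier V"
        have two: "u (vplus V x y) \<le> q x + q' y" if "q \<in> C" "q' \<in> C" for q q'
        proof -
          obtain r where "r \<in> C" "r \<le> q" "r \<le> q'" using total[OF \<open>q \<in> C\<close> \<open>q' \<in> C\<close>] \<open>q \<in> C\<close> \<open>q' \<in> C\<close> by auto
          then have "u (vplus V x y) \<le> r (vplus V x y)" "r x \<le> q x" "r y \<le> q' y"
            using u_le by (auto simp: le_fun_def)
          then show ?thesis using sublinear_plus[OF CA(1)[OF \<open>r \<in> C\<close>] x y] by linarith
        qed
        have "u (vplus V x y) - q x \<le> u y" if "q \<in> C" for q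
          by (rule u_greatest) (use two[OF that] in \<open>simp add: algebra_simps\<close>)
        then have "u (vplus V x y) - u y \<le> u x"
          by (intro u_greatest) (simp add: algebra_simps)
        then show "u (vplus V x y) \<le> u x + u y" by simp
      next
        fix x and t :: real assume x: "x \<in> vcarrier V" and t: "0 \<le> t"
        have le: "u (vscale V (of_real t) x) \<le> t * q x" if "q \<in> C" for q
          using u_le[OF that, of "vscale V (of_real t) x"] sublinear_scale[OF CA(1)[OF that] x t] by simp
        show "u (vscale V (of_real t) x) \<le> t * u x"
        proof (cases "t = 0")
          case True
          then show ?thesis using le False by auto
        next
          case False
          then have "u (vscale V (of_real t) x) / t \<le> u x"
            using le t by (intro u_greatest) (simp add: field_simps)
          then show ?thesis using False t by (simp add: field_simps)
        qed
      qed
      moreover have "u x = 0" if "x \<notin> vcarrier V" for x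
      proof (rule antisym)
        obtain q where "q \<in> C" using False by blast
        then show "u x \<le> 0" using u_le[of q x] CA(3)[OF _ that, of q] by simp
        have "0 \<le> q x" if "q \<in> C" for q using CA(3)[OF that \<open>x \<notin> vcarrier V\<close>] by simp
        then show "0 \<le> u x" by (rule u_greatest)
      qed
      moreover obtain q where "q \<in> C" using False by blast
      moreover have "u \<le> restr q0" using u_le[OF \<open>q \<in> C\<close>] CA(2)[OF \<open>q \<in> C\<close>] by (meson le_funI order_trans)
      ultimately show ?thesis using u_le by (intro bexI[of _ u]) (auto simp: A_def le_fun_def)
    qed
  qed
  then obtain m where m: "m \<in> A" "\<And>a. a \<in> A \<Longrightarrow> a \<le> m \<Longrightarrow> a = m" by blast
  show ?thesis
  proof (rule that)
    show "sublinear m" using m(1) by (simp add: A_def)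
    show le: "m x \<le> q0 x" if "x \<in> vcarrier V" for x
      using m(1) that by (simp add: A_def le_fun_def restr_def split: if_splits)
    fix q x assume q: "sublinear q" "\<And>x. x \<in> vcarrier V \<Longrightarrow> q x \<le> m x" and x: "x \<in> vcarrier V"
    have "restr q \<in> A" using q le by (intro restr_A) (auto intro: order_trans)
    moreover have "restr q \<le> m" using q(2) m(1) by (auto simp: restr_def le_fun_def A_def)
    ultimately have "restr q = m" by (rule m(2))
    then show "q x = m x" using x by (auto simp: restr_def)
  qed
qed

text \<open>The Hahn-Banach theorem in the form needed here: a minimal sublinear functional below the
  reduct of the norm at \<open>x0\<close> is linear, and it is nonzero at \<open>x0\<close> because it is at most
  \<open>- \<parallel>x0\<parallel>\<close> at \<open>- x0\<close>.\<close>

lemma (in normed_space) real_functional_exists: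
  assumes x0: "x0 \<in> vcarrier V" "x0 \<noteq> vzero V"
  obtains f :: "'a \<Rightarrow> real" where
    "\<And>x y. x \<in> vcarrier V \<Longrightarrow> y \<in> vcarrier V \<Longrightarrow> f (vplus V x y) = f x + f y"
    "\<And>r x. x \<in> vcarrier V \<Longrightarrow> f (vscale V (of_real r) x) = r * f x"
    "\<And>x. x \<in> vcarrier V \<Longrightarrow> \<bar>f x\<bar> \<le> vnorm V x"
    "f x0 \<noteq> 0"
proof -
  have "sublinear (sublinear_reduct (vnorm V) x0)"
    by (rule sublinear_reduct_sublinear[OF sublinear_norm x0(1)])
  then obtain f where f: "sublinear f"
    and f_le: "\<And>x. x \<in> vcarrier V \<Longrightarrow> f x \<le> sublinear_reduct (vnorm V) x0 x"
    and min: "\<And>q x. sublinear q \<Longrightarrow> (\<And>x. x \<in> vcarrier V \<Longrightarrow> q x \<le> f x) \<Longrightarrow> x \<in> vcarrier V \<Longrightarrow> q x = f x"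
    by (rule minimal_sublinear_exists) blast
  have m: "vscale V c x \<in> vcarrier V" if "x \<in> vcarrier V" for c x using that by (rule scale_closed)
  have odd: "f (vscale V (- 1) y) = - f y" if y: "y \<in> vcarrier V" for y
  proof -
    have "sublinear_reduct f y (vscale V (- 1) y) = f (vscale V (- 1) y)"
      using min[OF sublinear_reduct_sublinear[OF f y]] sublinear_reduct_le_self[OF f y] m[OF y] by blast
    then show ?thesis using sublinear_reduct_at_minus[OF f y] sublinear_minus[OF f y] by simp
  qed
  have f_le_norm: "f x \<le> vnorm V x" if "x \<in> vcarrier V" for x
    using f_le[OF that] sublinear_reduct_le_self[OF sublinear_norm x0(1) that] by simp
  show ?thesis
  proof (rule that)
    show "f (vplus V x y) = f x + f y" if "x \<in> vcarrier V" "y \<in> vcarrier V" for x y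
      using odd_sublinear_additive[OF f odd] that by blast
    show "f (vscale V (of_real r) x) = r * f x" if x: "x \<in> vcarrier V" for r x
    proof (cases "0 \<le> r")
      case True
      then show ?thesis using sublinear_scale[OF f x] by simp
    next
      case False
      have "vscale V (of_real r) x = vscale V (- 1) (vscale V (of_real (- r)) x)"
        by (simp add: scale_scale[OF x])
      then show ?thesis using False sublinear_scale[OF f x, of "- r"] odd[OF m[OF x], of "of_real (- r)"] by simp
    qed
    show "\<bar>f x\<bar> \<le> vnorm V x" if x: "x \<in> vcarrier V" for x
      using f_le_norm[OF x] f_le_norm[OF m[OF x, of "- 1"]] odd[OF x] norm_scale[OF x, of "- 1"] by (simp add: abs_le_iff)
    have "- f x0 \<le> - vnorm V x0"
      using f_le[OF m[OF x0(1), of "- 1"]] sublinear_reduct_at_minus[OF sublinear_norm x0(1)] odd[OF x0(1)] by simp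
    then show "f x0 \<noteq> 0" using norm_nonneg[OF x0(1)] norm_eq_zero[OF x0(1)] x0(2) by auto
  qed
qed

text \<open>A real functional \<open>f\<close> becomes a functional over the scalar field as in the classical
  complexification \<open>f(x) - \<i> f(\<i> x)\<close>; this is where the list of possible scalar fields enters.\<close>

theorem (in normed_space) dual_space_separates:
  assumes x0: "x0 \<in> vcarrier V" "x0 \<noteq> vzero V"
  obtains \<phi> where "\<phi> \<in> dual_space V" "\<phi> x0 \<noteq> 0"
proof -
  obtain f where add: "\<And>x y. x \<in> vcarrier V \<Longrightarrow> y \<in> vcarrier V \<Longrightarrow> f (vplus V x y) = f x + f y"
    and scale: "\<And>r x. x \<in> vcarrier V \<Longrightarrow> f (vscale V (of_real r) x) = r * f x"
    and bound: "\<And>x. x \<in> vcarrier V \<Longrightarrow> \<bar>f x\<bar> \<le> vnorm V x"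
    and ne: "f x0 \<noteq> 0"
    using real_functional_exists[OF x0] by blast
  note m = scale_closed
  consider "\<forall>a::'k. \<exists>r. a = of_real r"
    | j :: 'k where "j\<^sup>2 = - 1" "\<forall>a. \<exists>r s. a = of_real r + of_real s * j"
    using real_normed_field_real_or_complex by blast
  then show ?thesis
  proof cases
    case 1
    show ?thesis
    proof (rule that)
      have "(of_real (f (vscale V c x)) :: 'k) = c * of_real (f x)" if "x \<in> vcarrier V" for c x
      proof -
        obtain r where c: "c = of_real r" using 1 by blast
        show ?thesis unfolding c scale[OF that] by simp
      qed
      then show "(\<lambda>x. of_real (f x)) \<in> dual_space V"
        unfolding dual_space_def using add bound by (auto intro!: exI[of _ 1])
      show "of_real (f x0) \<noteq> (0::'k)" using ne by simp
    qed
  next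
    case 2
    define \<phi> where "\<phi> x = of_real (f x) - j * of_real (f (vscale V j x))" for x
    have jj: "j * j = - 1" using 2(1) by (simp add: power2_eq_square)
    have \<phi>_add: "\<phi> (vplus V x y) = \<phi> x + \<phi> y" if "x \<in> vcarrier V" "y \<in> vcarrier V" for x y
      using that by (simp add: \<phi>_def add scale_plus_right m algebra_simps)
    have \<phi>_real: "\<phi> (vscale V (of_real r) x) = of_real r * \<phi> x" if x: "x \<in> vcarrier V" for r x
    proof -
      have "vscale V j (vscale V (of_real r) x) = vscale V (of_real r) (vscale V j x)"
        using x by (simp add: scale_scale mult.commute)
      then show ?thesis using x by (simp add: \<phi>_def scale m algebra_simps)
    qed
    have \<phi>_j: "\<phi> (vscale V j x) = j * \<phi> x" if x: "x \<in> vcarrier V" for x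
    proof -
      have "f (vscale V j (vscale V j x)) = - f x"
        using scale[OF x, of "- 1"] x by (simp add: scale_scale jj)
      then have "\<phi> (vscale V j x) = of_real (f (vscale V j x)) + j * of_real (f x)" by (simp add: \<phi>_def)
      also have "\<dots> = j * of_real (f x) - (j * j) * of_real (f (vscale V j x))" by (simp add: jj)
      finally show ?thesis by (simp add: \<phi>_def algebra_simps)
    qed
    have \<phi>_scale: "\<phi> (vscale V c x) = c * \<phi> x" if x: "x \<in> vcarrier V" for c x
    proof -
      obtain r s where c: "c = of_real r + of_real s * j" using 2(2) by blast
      have "\<phi> (vscale V c x) = \<phi> (vscale V (of_real r) x) + \<phi> (vscale V (of_real s) (vscale V j x))"
        by (simp add: c scale_plus_left x scale_scale \<phi>_add m)
      then show ?thesis by (simp add: \<phi>_real \<phi>_j x m c algebra_simps)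
    qed
    have \<phi>_bound: "norm (\<phi> x) \<le> (1 + norm j * norm j) * vnorm V x" if x: "x \<in> vcarrier V" for x
    proof -
      have "norm (\<phi> x) \<le> \<bar>f x\<bar> + norm j * \<bar>f (vscale V j x)\<bar>"
        unfolding \<phi>_def by (rule order_trans[OF norm_triangle_ineq4]) (simp add: norm_mult)
      also have "\<dots> \<le> vnorm V x + norm j * (norm j * vnorm V x)"
        using bound[OF x] bound[OF m[OF x], of j] by (intro add_mono mult_left_mono) (simp_all add: norm_scale x)
      finally show ?thesis by (simp add: algebra_simps)
    qed
    have dual: "\<phi> \<in> dual_space V"
      unfolding dual_space_def using \<phi>_add \<phi>_scale \<phi>_bound by blast
    \<comment> \<open>The real numbers \<open>f x0\<close> and \<open>f (j x0)\<close> cannot cancel: their squares would have opposite signs.\<close>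
    have "\<phi> x0 \<noteq> 0"
    proof
      assume "\<phi> x0 = 0"
      then have "(of_real (f x0))\<^sup>2 = (j * of_real (f (vscale V j x0)))\<^sup>2" by (simp add: \<phi>_def)
      also have "\<dots> = of_real (- ((f (vscale V j x0))\<^sup>2))" by (simp add: power_mult_distrib 2(1))
      finally have "(f x0)\<^sup>2 = - ((f (vscale V j x0))\<^sup>2)" unfolding of_real_power[symmetric] of_real_eq_iff .
      then show False using ne zero_le_power2[of "f (vscale V j x0)"] zero_less_power2[of "f x0"] by linarith
    qed
    then show ?thesis using dual that by blast
  qed
qed

section \<open>Finite-rank operators that fix finitely many vectors\<close>

lemma dual_space_plus:
  "\<lbrakk>\<phi> \<in> dual_space V; x \<in> vcarrier V; y \<in> vcarrier V\<rbrakk> \<Longrightarrow> \<phi> (vplus V x y) = \<phi> x + \<phi> y"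
  by (simp add: dual_space_def)

lemma dual_space_scale:
  "\<lbrakk>\<phi> \<in> dual_space V; x \<in> vcarrier V\<rbrakk> \<Longrightarrow> \<phi> (vscale V c x) = c * \<phi> x"
  by (simp add: dual_space_def)

lemma (in normed_space) dual_space_bound:
  assumes "\<phi> \<in> dual_space V"
  obtains C where "0 \<le> C" "\<And>x. x \<in> vcarrier V \<Longrightarrow> norm (\<phi> x) \<le> C * vnorm V x"
proof -
  obtain C where C: "\<And>x. x \<in> vcarrier V \<Longrightarrow> norm (\<phi> x) \<le> C * vnorm V x"
    using assms unfolding dual_space_def by blast
  have "norm (\<phi> x) \<le> max C 0 * vnorm V x" if "x \<in> vcarrier V" for x
    using C[OF that] mult_right_mono[OF max.cobounded1[of C 0] norm_nonneg[OF that]] by linarith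
  then show ?thesis using that[of "max C 0"] by auto
qed

text \<open>The operator \<open>x \<mapsto> \<phi>\<^sub>1(x) e\<^sub>1 + \<dots> + \<phi>\<^sub>d(x) e\<^sub>d\<close>.\<close>

fun finite_rank :: "('k, 'a) nspace \<Rightarrow> (('a \<Rightarrow> 'k) \<times> 'a) list \<Rightarrow> 'a \<Rightarrow> 'a" where
  "finite_rank V [] x = vzero V"
| "finite_rank V ((\<phi>, e) # L) x = vplus V (vscale V (\<phi> x) e) (finite_rank V L x)"

lemma (in normed_space) finite_rank_closed:
  "snd ` set L \<subseteq> vcarrier V \<Longrightarrow> finite_rank V L x \<in> vcarrier V"
  by (induction L) (auto simp: zero_closed plus_closed scale_closed)

lemma (in normed_space) scale_zero_right: "vscale V c (vzero V) = vzero V"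
  using scale_scale[OF zero_closed, of c 0] by (simp add: scale_zero_left zero_closed)

lemma (in normed_space) finite_rank_linear:
  assumes "set L \<subseteq> dual_space V \<times> vcarrier V" and x: "x \<in> vcarrier V"
  shows "y \<in> vcarrier V \<Longrightarrow> finite_rank V L (vplus V x y) = vplus V (finite_rank V L x) (finite_rank V L y)"
    and "finite_rank V L (vscale V c x) = vscale V c (finite_rank V L x)"
  using assms(1)
proof (induction L)
  case Nil
  { case 1 then show ?case by (simp add: plus_zero zero_closed) }
  { case 2 then show ?case by (simp add: scale_zero_right) }
next
  case (Cons p L)
  obtain \<phi> e where p: "p = (\<phi>, e)" by fastforce
  { case 1
    then have "\<phi> \<in> dual_space V" "e \<in> vcarrier V" "snd ` set L \<subseteq> vcarrier V" by (auto simp: p)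
    then show ?case using Cons.IH(1) 1 x
      by (simp add: p dual_space_plus scale_plus_left plus_exchange scale_closed finite_rank_closed) }
  { case 2
    then have "\<phi> \<in> dual_space V" "e \<in> vcarrier V" "snd ` set L \<subseteq> vcarrier V" by (auto simp: p)
    then show ?case using Cons.IH(2) 2 x
      by (simp add: p dual_space_scale scale_plus_right scale_scale scale_closed finite_rank_closed) }
qed

lemma (in normed_space) finite_rank_bounded:
  assumes "set L \<subseteq> dual_space V \<times> vcarrier V"
  shows "\<exists>C\<ge>0. \<forall>x\<in>vcarrier V. vnorm V (finite_rank V L x) \<le> C * vnorm V x"
  using assms
proof (induction L)
  case Nil
  then show ?case using norm_eq_zero[OF zero_closed] by (auto intro!: exI[of _ 0])
next
  case (Cons p L)
  obtain \<phi> e where p: "p = (\<phi>, e)" by fastforce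
  have \<phi>: "\<phi> \<in> dual_space V" and e: "e \<in> vcarrier V" and L: "snd ` set L \<subseteq> vcarrier V"
    using Cons.prems by (auto simp: p)
  obtain C where C: "0 \<le> C" "\<And>x. x \<in> vcarrier V \<Longrightarrow> vnorm V (finite_rank V L x) \<le> C * vnorm V x"
    using Cons by auto
  obtain D where D: "0 \<le> D" "\<And>x. x \<in> vcarrier V \<Longrightarrow> norm (\<phi> x) \<le> D * vnorm V x"
    using dual_space_bound[OF \<phi>] by blast
  have "vnorm V (finite_rank V (p # L) x) \<le> (D * vnorm V e + C) * vnorm V x" if x: "x \<in> vcarrier V" for x
  proof -
    have "vnorm V (finite_rank V (p # L) x) \<le> norm (\<phi> x) * vnorm V e + vnorm V (finite_rank V L x)"
      using norm_triangle[OF scale_closed[OF e] finite_rank_closed[OF L]] by (simp add: p norm_scale e)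
    also have "\<dots> \<le> D * vnorm V x * vnorm V e + C * vnorm V x"
      using C(2)[OF x] D(2)[OF x] norm_nonneg[OF e] by (intro add_mono mult_right_mono)
    finally show ?thesis by (simp add: algebra_simps)
  qed
  moreover have "0 \<le> D * vnorm V e + C" using C(1) D(1) norm_nonneg[OF e] by simp
  ultimately show ?case by blast
qed

text \<open>A substitute for dual bases of finite-dimensional subspaces. If \<open>P\<close> fixes \<open>A\<close> but moves \<open>a\<close>, let
  \<open>r = a - P a\<close> and let \<open>\<phi> r = 1\<close>; the operator \<open>x \<mapsto> P x + \<phi>(x - P x) r\<close> still fixes \<open>A\<close>, and it
  also fixes \<open>a\<close>.\<close>

theorem (in normed_space) finite_rank_identity_on_finite:
  assumes "finite A" "A \<subseteq> vcarrier V"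
  shows "\<exists>L. set L \<subseteq> dual_space V \<times> vcarrier V \<and> (\<forall>x\<in>A. finite_rank V L x = x)"
  using assms
proof (induction A)
  case empty
  then show ?case by (auto intro: exI[of _ "[]"])
next
  case (insert a A)
  then obtain L where L: "set L \<subseteq> dual_space V \<times> vcarrier V" "\<And>x. x \<in> A \<Longrightarrow> finite_rank V L x = x" by auto
  let ?P = "finite_rank V L"
  have P: "?P x \<in> vcarrier V" for x using L(1) by (intro finite_rank_closed) auto
  have a: "a \<in> vcarrier V" using insert by simp
  define r where "r = vplus V a (vscale V (- 1) (?P a))"
  have r: "r \<in> vcarrier V" unfolding r_def by (intro plus_closed scale_closed a P)
  have aP: "vplus V r (?P a) = a"
    using plus_commute[OF scale_closed[OF P] P, of "- 1"] plus_assoc[OF a scale_closed[OF P] P, of "- 1"]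
    by (simp add: r_def scale_minus_one[OF P] plus_zero[OF a])
  show ?case
  proof (cases "r = vzero V")
    case True
    then have "?P a = a" using aP plus_commute[OF zero_closed P] plus_zero[OF P] by simp
    then show ?thesis using L by auto
  next
    case False
    then obtain \<phi> where \<phi>: "\<phi> \<in> dual_space V" "\<phi> r \<noteq> 0" using dual_space_separates[OF r] by blast
    define \<psi> where "\<psi> x = (\<phi> x - \<phi> (?P x)) / \<phi> r" for x
    have "\<phi> r = \<phi> a - \<phi> (?P a)"
      using \<phi>(1) P a by (simp add: r_def dual_space_plus dual_space_scale scale_closed)
    then have \<psi>a: "\<psi> a = 1" using \<phi>(2) by (simp add: \<psi>_def)
    obtain C where C: "0 \<le> C" "\<And>x. x \<in> vcarrier V \<Longrightarrow> vnorm V (?P x) \<le> C * vnorm V x"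
      using finite_rank_bounded[OF L(1)] by blast
    obtain D where D: "0 \<le> D" "\<And>x. x \<in> vcarrier V \<Longrightarrow> norm (\<phi> x) \<le> D * vnorm V x"
      using dual_space_bound[OF \<phi>(1)] by blast
    have "norm (\<psi> x) \<le> ((D + D * C) / norm (\<phi> r)) * vnorm V x" if x: "x \<in> vcarrier V" for x
    proof -
      have "norm (\<phi> x - \<phi> (?P x)) \<le> norm (\<phi> x) + norm (\<phi> (?P x))" by (rule norm_triangle_ineq4)
      also have "\<dots> \<le> D * vnorm V x + D * (C * vnorm V x)"
        using D(2)[OF x] order_trans[OF D(2)[OF P] mult_left_mono[OF C(2)[OF x] D(1)]] by (rule add_mono)
      finally show ?thesis using \<phi>(2) by (simp add: \<psi>_def norm_divide field_simps)
    qed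
    moreover have "\<psi> (vplus V x y) = \<psi> x + \<psi> y" if "x \<in> vcarrier V" "y \<in> vcarrier V" for x y
      using that \<phi>(1) P by (simp add: \<psi>_def finite_rank_linear[OF L(1)] dual_space_plus add_divide_distrib diff_divide_distrib)
    moreover have "\<psi> (vscale V c x) = c * \<psi> x" if "x \<in> vcarrier V" for x c
      using that \<phi>(1) P by (simp add: \<psi>_def finite_rank_linear[OF L(1)] dual_space_scale right_diff_distrib)
    ultimately have "\<psi> \<in> dual_space V" unfolding dual_space_def by blast
    moreover have "finite_rank V ((\<psi>, r) # L) x = x" if x: "x \<in> A" for x
    proof -
      have "\<psi> x = 0" using L(2)[OF x] by (simp add: \<psi>_def)
      moreover have "x \<in> vcarrier V" using x insert.prems by auto
      ultimately show ?thesis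
        using L(2)[OF x] r plus_commute[OF zero_closed] by (simp add: scale_zero_left plus_zero)
    qed
    moreover have "finite_rank V ((\<psi>, r) # L) a = a" using aP r by (simp add: \<psi>a scale_one)
    ultimately show ?thesis using L(1) r by (intro exI[of _ "(\<psi>, r) # L"]) auto
  qed
qed

section \<open>The projective norm on the algebraic tensor product\<close>

interpretation fs: vector_space "fscale :: 'k::field \<Rightarrow> ('x \<Rightarrow>\<^sub>0 'k) \<Rightarrow> ('x \<Rightarrow>\<^sub>0 'k)"
  by (rule vector_space_fscale)

abbreviation pure :: "'x \<Rightarrow> ('x \<Rightarrow>\<^sub>0 'k::real_normed_field)" where
  "pure x \<equiv> Poly_Mapping.single x 1"

text \<open>The linear functional on formal sums that extends a function on tuples; for multilinear
  \<open>\<phi>\<close> it descends to the tensor product.\<close>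

definition linearize :: "('x \<Rightarrow> 'k::real_normed_field) \<Rightarrow> ('x \<Rightarrow>\<^sub>0 'k) \<Rightarrow> 'k" where
  "linearize \<phi> f = (\<Sum>x\<in>Poly_Mapping.keys f. poly_mapping.lookup f x * \<phi> x)"

lemma linearize_superset:
  assumes "finite S" "Poly_Mapping.keys f \<subseteq> S"
  shows "linearize \<phi> f = (\<Sum>x\<in>S. poly_mapping.lookup f x * \<phi> x)"
  unfolding linearize_def using assms by (intro sum.mono_neutral_left) (auto simp: in_keys_iff)

lemma linearize_add: "linearize \<phi> (f + g) = linearize \<phi> f + linearize \<phi> g"
proof -
  let ?S = "Poly_Mapping.keys f \<union> Poly_Mapping.keys g"
  have "linearize \<phi> h = (\<Sum>x\<in>?S. poly_mapping.lookup h x * \<phi> x)" if "h \<in> {f, g, f + g}" for h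
    using that Poly_Mapping.keys_add[of f g] by (intro linearize_superset) auto
  then show ?thesis by (simp add: lookup_add distrib_right sum.distrib)
qed

lemma linearize_fscale: "linearize \<phi> (fscale c f) = c * linearize \<phi> f"
proof -
  have "Poly_Mapping.keys (fscale c f) \<subseteq> Poly_Mapping.keys f" by (auto simp: in_keys_iff)
  then have "linearize \<phi> (fscale c f) = (\<Sum>x\<in>Poly_Mapping.keys f. poly_mapping.lookup (fscale c f) x * \<phi> x)"
    by (intro linearize_superset) auto
  then show ?thesis by (simp add: linearize_def sum_distrib_left mult.assoc)
qed

lemma linearize_pure [simp]: "linearize \<phi> (pure x) = \<phi> x"
  by (simp add: linearize_def)

lemma linearize_0 [simp]: "linearize \<phi> 0 = 0"
  by (simp add: linearize_def)

lemma linearize_diff: "linearize \<phi> (f - g) = linearize \<phi> f - linearize \<phi> g"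
  using linearize_add[of \<phi> "f - g" g] by simp

lemma linearize_sum_list: "linearize \<phi> (\<Sum>x\<leftarrow>xs. F x) = (\<Sum>x\<leftarrow>xs. linearize \<phi> (F x))"
  by (induction xs) (simp_all add: linearize_add)

lemma expand_pure: "f = (\<Sum>x\<in>Poly_Mapping.keys f. fscale (poly_mapping.lookup f x) (pure x))"
  by (rule poly_mapping_eqI) (simp add: lookup_sum lookup_single when_def in_keys_iff if_distrib cong: if_cong)

lemma formal_sums_subspace: "fs.subspace (formal_sums X)"
proof (rule fs.subspaceI)
  show "0 \<in> formal_sums X" by (simp add: formal_sums_def)
  show "f + g \<in> formal_sums X" if "f \<in> formal_sums X" "g \<in> formal_sums X" for f g
    using that Poly_Mapping.keys_add[of f g] by (auto simp: formal_sums_def)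
  show "fscale c f \<in> formal_sums X" if "f \<in> formal_sums X" for c f
    using that by (auto simp: formal_sums_def in_keys_iff)
qed

lemmas formal_sums_closed =
  fs.subspace_0[OF formal_sums_subspace] fs.subspace_add[OF formal_sums_subspace]
  fs.subspace_scale[OF formal_sums_subspace] fs.subspace_diff[OF formal_sums_subspace]

lemma pure_formal_sum: "x \<in> tuples X \<Longrightarrow> pure x \<in> formal_sums X"
  by (simp add: formal_sums_def)

definition tensor_eq ::
    "('n::finite \<Rightarrow> ('k::real_normed_field, 'a) nspace) \<Rightarrow> (('n \<Rightarrow> 'a) \<Rightarrow>\<^sub>0 'k) \<Rightarrow> (('n \<Rightarrow> 'a) \<Rightarrow>\<^sub>0 'k) \<Rightarrow> bool"
  where "tensor_eq X f g \<longleftrightarrow> f - g \<in> fs.span (multilinear_relations X)"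

lemma tensor_eq_refl [simp]: "tensor_eq X f f"
  by (simp add: tensor_eq_def fs.span_zero)

lemma tensor_eq_sym: "tensor_eq X f g \<Longrightarrow> tensor_eq X g f"
  unfolding tensor_eq_def using fs.span_neg by fastforce

lemma tensor_eq_trans: "tensor_eq X f g \<Longrightarrow> tensor_eq X g h \<Longrightarrow> tensor_eq X f h"
  unfolding tensor_eq_def using fs.span_add by fastforce

lemma tensor_eq_add: "tensor_eq X f f' \<Longrightarrow> tensor_eq X g g' \<Longrightarrow> tensor_eq X (f + g) (f' + g')"
  unfolding tensor_eq_def using fs.span_add by (fastforce simp: algebra_simps)

lemma tensor_eq_scale: "tensor_eq X f f' \<Longrightarrow> tensor_eq X (fscale c f) (fscale c f')"
  unfolding tensor_eq_def using fs.span_scale by (metis fs.scale_right_diff_distrib)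

lemma tensor_eq_sum: "(\<And>x. x \<in> S \<Longrightarrow> tensor_eq X (F x) (G x)) \<Longrightarrow> tensor_eq X (sum F S) (sum G S)"
  unfolding tensor_eq_def sum_subtractf[symmetric] by (rule fs.span_sum)

lemma tensor_eq_sum_list:
  "(\<And>x. x \<in> set xs \<Longrightarrow> tensor_eq X (F x) (G x)) \<Longrightarrow> tensor_eq X (\<Sum>x\<leftarrow>xs. F x) (\<Sum>x\<leftarrow>xs. G x)"
  by (induction xs) (auto intro: tensor_eq_add)

lemma tensor_eq_pure_plus:
  assumes "x \<in> tuples X" "a \<in> vcarrier (X i)" "b \<in> vcarrier (X i)"
  shows "tensor_eq X (pure (x(i := vplus (X i) a b))) (pure (x(i := a)) + pure (x(i := b)))"
  unfolding tensor_eq_def diff_diff_eq[symmetric]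
  by (rule fs.span_base) (use assms in \<open>unfold multilinear_relations_def, blast\<close>)

lemma tensor_eq_pure_scale:
  assumes "x \<in> tuples X" "a \<in> vcarrier (X i)"
  shows "tensor_eq X (pure (x(i := vscale (X i) c a))) (fscale c (pure (x(i := a))))"
  unfolding tensor_eq_def
  by (rule fs.span_base) (use assms in \<open>unfold multilinear_relations_def, blast\<close>)

lemma tensor_class_iff: "g \<in> tensor_class X f \<longleftrightarrow> g \<in> formal_sums X \<and> tensor_eq X g f"
  by (simp add: tensor_class_def tensor_eq_def)

lemma tensor_class_eq: "tensor_eq X f g \<Longrightarrow> tensor_class X f = tensor_class X g"
  unfolding set_eq_iff tensor_class_iff by (metis tensor_eq_trans tensor_eq_sym)

lemma tensor_class_self: "f \<in> formal_sums X \<Longrightarrow> f \<in> tensor_class X f"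
  by (simp add: tensor_class_iff)

lemma alg_tensor_simps:
  "vcarrier (alg_tensor X) = tensor_class X ` formal_sums X"
  "vzero (alg_tensor X) = tensor_class X 0"
  by (simp_all add: alg_tensor_def)

lemma alg_tensor_plus:
  assumes "f \<in> formal_sums X" "g \<in> formal_sums X"
  shows "vplus (alg_tensor X) (tensor_class X f) (tensor_class X g) = tensor_class X (f + g)"
proof -
  have "tensor_class X (f' + g') = tensor_class X (f + g)"
    if "f' \<in> tensor_class X f" "g' \<in> tensor_class X g" for f' g'
    using that by (intro tensor_class_eq tensor_eq_add) (auto simp: tensor_class_iff)
  then have "(\<Union>f'\<in>tensor_class X f. \<Union>g'\<in>tensor_class X g. tensor_class X (f' + g')) = tensor_class X (f + g)"
    using tensor_class_self[OF assms(1)] tensor_class_self[OF assms(2)] by blast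
  then show ?thesis by (simp add: alg_tensor_def)
qed

lemma alg_tensor_scale:
  assumes "f \<in> formal_sums X"
  shows "vscale (alg_tensor X) c (tensor_class X f) = tensor_class X (fscale c f)"
proof -
  have "tensor_class X (fscale c f') = tensor_class X (fscale c f)" if "f' \<in> tensor_class X f" for f'
    using that by (intro tensor_class_eq tensor_eq_scale) (auto simp: tensor_class_iff)
  then have "(\<Union>f'\<in>tensor_class X f. tensor_class X (fscale c f')) = tensor_class X (fscale c f)"
    using tensor_class_self[OF assms(1)] by blast
  then show ?thesis by (simp add: alg_tensor_def)
qed

lemma tuples_update: "\<lbrakk>x \<in> tuples X; a \<in> vcarrier (X i)\<rbrakk> \<Longrightarrow> x(i := a) \<in> tuples X"
  by (simp add: tuples_def)

lemma bounded_forms_iff: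
  "\<phi> \<in> bounded_forms X \<longleftrightarrow>
    (\<forall>x\<in>tuples X. \<forall>i. \<forall>a\<in>vcarrier (X i). \<forall>b\<in>vcarrier (X i).
      \<phi> (x(i := vplus (X i) a b)) = \<phi> (x(i := a)) + \<phi> (x(i := b))) \<and>
    (\<forall>x\<in>tuples X. \<forall>i. \<forall>a\<in>vcarrier (X i). \<forall>c. \<phi> (x(i := vscale (X i) c a)) = c * \<phi> (x(i := a))) \<and>
    (\<exists>C. \<forall>x\<in>tuples X. norm (\<phi> x) \<le> C * (\<Prod>i\<in>UNIV. vnorm (X i) (x i)))"
  by (simp add: bounded_multilinear_def scalar_space_def)

lemma linearize_tensor_eq:
  assumes \<phi>: "\<phi> \<in> bounded_forms X" and eq: "tensor_eq X f g"
  shows "linearize \<phi> f = linearize \<phi> g"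
proof -
  have "linearize \<phi> (f - g) = 0"
    using eq unfolding tensor_eq_def
  proof (induction rule: fs.span_induct)
    show "fs.subspace {h. linearize \<phi> h = 0}"
      by (rule fs.subspaceI) (simp_all add: linearize_add linearize_fscale)
    show "linearize \<phi> r = 0" if "r \<in> multilinear_relations X" for r
      using that \<phi> unfolding multilinear_relations_def bounded_forms_iff
      by (auto simp: linearize_diff linearize_fscale)
  qed
  then show ?thesis by (simp add: linearize_diff)
qed

locale normed_family =
  fixes X :: "'n::finite \<Rightarrow> ('k::real_normed_field, 'a) nspace"
  assumes normed: "normed_space (X i)"
begin

definition cost :: "('n \<Rightarrow> 'a) \<Rightarrow> real" where
  "cost x = (\<Prod>i\<in>UNIV. vnorm (X i) (x i))"

lemma cost_nonneg: "x \<in> tuples X \<Longrightarrow> 0 \<le> cost x"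
  unfolding cost_def by (intro prod_nonneg) (simp add: tuples_def normed_space.norm_nonneg[OF normed])

lemma bounded_form_bound:
  assumes "\<phi> \<in> bounded_forms X"
  obtains C where "0 \<le> C" "\<And>x. x \<in> tuples X \<Longrightarrow> norm (\<phi> x) \<le> C * cost x"
proof -
  obtain C where C: "\<And>x. x \<in> tuples X \<Longrightarrow> norm (\<phi> x) \<le> C * cost x"
    using assms unfolding bounded_forms_iff cost_def by blast
  have "norm (\<phi> x) \<le> max C 0 * cost x" if "x \<in> tuples X" for x
    using C[OF that] mult_right_mono[OF max.cobounded1[of C 0] cost_nonneg[OF that]] by linarith
  then show ?thesis using that[of "max C 0"] by auto
qed

lemma cost_scale_coordinate:
  assumes "x \<in> tuples X"
  shows "cost (x(i := vscale (X i) c (x i))) = norm c * cost x"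
proof -
  have "cost (x(i := vscale (X i) c (x i)))
      = vnorm (X i) (vscale (X i) c (x i)) * (\<Prod>k\<in>UNIV - {i}. vnorm (X k) (x k))"
    unfolding cost_def by (subst prod.remove[of _ i]) auto
  also have "\<dots> = norm c * (vnorm (X i) (x i) * (\<Prod>k\<in>UNIV - {i}. vnorm (X k) (x k)))"
    using assms by (simp add: normed_space.norm_scale[OF normed] tuples_def)
  also have "vnorm (X i) (x i) * (\<Prod>k\<in>UNIV - {i}. vnorm (X k) (x k)) = cost x"
    unfolding cost_def by (subst (2) prod.remove[of _ i]) auto
  finally show ?thesis .
qed

lemma tuples_scale: "x \<in> tuples X \<Longrightarrow> x(i := vscale (X i) c (x i)) \<in> tuples X"
  by (simp add: tuples_def normed_space.scale_closed[OF normed])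

lemma tensor_eq_scale_coordinate:
  assumes "x \<in> tuples X"
  shows "tensor_eq X (pure (x(i := vscale (X i) c (x i)))) (fscale c (pure x))"
  using tensor_eq_pure_scale[OF assms, of "x i" i c] assms by (simp add: tuples_def)

text \<open>The families of elementary tensors over which the projective norm is an infimum.\<close>

definition represents :: "('n \<Rightarrow> 'a) list \<Rightarrow> (('n \<Rightarrow> 'a) \<Rightarrow>\<^sub>0 'k) \<Rightarrow> bool" where
  "represents xs f \<longleftrightarrow> set xs \<subseteq> tuples X \<and> tensor_eq X (\<Sum>x\<leftarrow>xs. pure x) f"

lemma sum_list_pure_formal: "set xs \<subseteq> tuples X \<Longrightarrow> (\<Sum>x\<leftarrow>xs. pure x) \<in> formal_sums X"
  by (induction xs) (auto intro: formal_sums_closed pure_formal_sum)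

lemma norm_alg_tensor:
  "vnorm (alg_tensor X) (tensor_class X f) = Inf {\<Sum>x\<leftarrow>xs. cost x | xs. represents xs f}"
proof -
  have "set xs \<subseteq> tuples X \<and> (\<Sum>x\<leftarrow>xs. pure x) \<in> tensor_class X f \<longleftrightarrow> represents xs f" for xs
    using sum_list_pure_formal[of xs] by (auto simp: represents_def tensor_class_iff)
  then show ?thesis by (simp add: alg_tensor_def cost_def)
qed

lemma represents_append: "represents xs f \<Longrightarrow> represents ys g \<Longrightarrow> represents (xs @ ys) (f + g)"
  by (simp add: represents_def tensor_eq_add)

lemma represents_scale:
  assumes "represents xs f"
  shows "represents (map (\<lambda>x. x(i := vscale (X i) c (x i))) xs) (fscale c f)"
proof -
  have "tensor_eq X (\<Sum>x\<leftarrow>xs. pure (x(i := vscale (X i) c (x i)))) (\<Sum>x\<leftarrow>xs. fscale c (pure x))"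
    using assms by (intro tensor_eq_sum_list tensor_eq_scale_coordinate) (auto simp: represents_def)
  also have "(\<Sum>x\<leftarrow>xs. fscale c (pure x)) = fscale c (\<Sum>x\<leftarrow>xs. pure x)"
    by (induction xs) (simp_all add: fs.scale_right_distrib)
  finally have "tensor_eq X (\<Sum>x\<leftarrow>xs. pure (x(i := vscale (X i) c (x i)))) (fscale c (\<Sum>x\<leftarrow>xs. pure x))" .
  then show ?thesis
    using assms tuples_scale by (auto simp: represents_def o_def intro: tensor_eq_trans tensor_eq_scale)
qed

text \<open>A coefficient can be absorbed into a coordinate of its tuple, so plain sums of elementary
  tensors reach every class.\<close>

lemma represents_exists:
  assumes "f \<in> formal_sums X" obtains xs where "represents xs f"
proof -
  have "\<exists>xs. represents xs (\<Sum>x\<in>S. fscale (poly_mapping.lookup f x) (pure x))"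
    if "finite S" "S \<subseteq> tuples X" for S
    using that
  proof (induction S)
    case empty
    then show ?case by (auto simp: represents_def intro!: exI[of _ "[]"])
  next
    case (insert x S)
    then obtain xs where xs: "represents xs (\<Sum>x\<in>S. fscale (poly_mapping.lookup f x) (pure x))" by auto
    have "represents [x] (pure x)" using insert.prems by (simp add: represents_def)
    from represents_append[OF represents_scale[OF this, of undefined "poly_mapping.lookup f x"] xs] show ?case
      unfolding sum.insert[OF insert.hyps] by (rule exI)
  qed
  from this[of "Poly_Mapping.keys f"] show ?thesis
    using assms that by (auto simp: formal_sums_def simp flip: expand_pure)
qed

lemma norm_le_cost:
  assumes "represents xs f"
  shows "vnorm (alg_tensor X) (tensor_class X f) \<le> (\<Sum>x\<leftarrow>xs. cost x)"
proof -
  have "0 \<le> (\<Sum>x\<leftarrow>ys. cost x)" if "represents ys f" for ys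
    using that cost_nonneg by (intro sum_list_nonneg) (auto simp: represents_def)
  then show ?thesis unfolding norm_alg_tensor
    using assms by (intro cInf_lower) (auto intro!: bdd_belowI[of _ 0])
qed

lemma norm_alg_tensor_greatest:
  assumes "f \<in> formal_sums X" "\<And>xs. represents xs f \<Longrightarrow> b \<le> (\<Sum>x\<leftarrow>xs. cost x)"
  shows "b \<le> vnorm (alg_tensor X) (tensor_class X f)"
proof -
  obtain xs where "represents xs f" using represents_exists[OF assms(1)] .
  then show ?thesis unfolding norm_alg_tensor using assms(2) by (intro cInf_greatest) auto
qed

lemma norm_alg_tensor_triangle:
  assumes f: "f \<in> formal_sums X" and g: "g \<in> formal_sums X"
  shows "vnorm (alg_tensor X) (tensor_class X (f + g))
    \<le> vnorm (alg_tensor X) (tensor_class X f) + vnorm (alg_tensor X) (tensor_class X g)" (is "?h \<le> ?f + ?g")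
proof -
  have "?h - (\<Sum>x\<leftarrow>xs. cost x) \<le> ?g" if "represents xs f" for xs
  proof (rule norm_alg_tensor_greatest[OF g])
    fix ys assume "represents ys g"
    from norm_le_cost[OF represents_append[OF that this]]
    show "?h - (\<Sum>x\<leftarrow>xs. cost x) \<le> (\<Sum>x\<leftarrow>ys. cost x)" by simp
  qed
  then have "?h - ?g \<le> ?f" by (intro norm_alg_tensor_greatest[OF f]) (simp add: algebra_simps)
  then show ?thesis by simp
qed

lemma norm_alg_tensor_nonneg: "f \<in> formal_sums X \<Longrightarrow> 0 \<le> vnorm (alg_tensor X) (tensor_class X f)"
  by (rule norm_alg_tensor_greatest) (auto simp: represents_def intro!: sum_list_nonneg cost_nonneg)

lemma norm_alg_tensor_zero: "vnorm (alg_tensor X) (tensor_class X 0) = 0"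
  using norm_le_cost[of "[]" 0] norm_alg_tensor_nonneg[OF formal_sums_closed(1)] by (simp add: represents_def)

lemma norm_alg_tensor_scale_le:
  assumes f: "f \<in> formal_sums X"
  shows "vnorm (alg_tensor X) (tensor_class X (fscale c f)) \<le> norm c * vnorm (alg_tensor X) (tensor_class X f)"
proof (cases "c = 0")
  case True
  then show ?thesis by (simp add: norm_alg_tensor_zero)
next
  case False
  have "vnorm (alg_tensor X) (tensor_class X (fscale c f)) / norm c \<le> (\<Sum>x\<leftarrow>xs. cost x)"
    if xs: "represents xs f" for xs
  proof -
    have "(\<Sum>x\<leftarrow>xs. cost (x(i := vscale (X i) c (x i)))) = (\<Sum>x\<leftarrow>xs. norm c * cost x)" for i
      using xs by (intro arg_cong[of _ _ sum_list] map_cong) (auto simp: represents_def cost_scale_coordinate)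
    then show ?thesis using norm_le_cost[OF represents_scale[OF xs, of undefined c]] False
      by (simp add: o_def sum_list_const_mult field_simps)
  qed
  from norm_alg_tensor_greatest[OF f this] show ?thesis using False by (simp add: field_simps)
qed

lemma norm_alg_tensor_scale:
  assumes f: "f \<in> formal_sums X"
  shows "vnorm (alg_tensor X) (tensor_class X (fscale c f)) = norm c * vnorm (alg_tensor X) (tensor_class X f)"
proof (cases "c = 0")
  case True
  then show ?thesis by (simp add: norm_alg_tensor_zero)
next
  case False
  have "vnorm (alg_tensor X) (tensor_class X f) \<le> norm (inverse c) * vnorm (alg_tensor X) (tensor_class X (fscale c f))"
    using norm_alg_tensor_scale_le[OF formal_sums_closed(3)[OF f, of c], of "inverse c"] False by simp
  then show ?thesis using norm_alg_tensor_scale_le[OF f, of c] False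
    by (simp add: norm_inverse norm_divide field_simps)
qed

text \<open>One half of the duality between the projective norm and bounded multilinear forms: a form
  bounded by \<open>C\<close> on tuples has a linearization bounded by \<open>C\<close>.\<close>

lemma norm_linearize_le:
  assumes \<phi>: "\<phi> \<in> bounded_forms X" and C: "\<And>x. x \<in> tuples X \<Longrightarrow> norm (\<phi> x) \<le> C * cost x" "0 \<le> C"
    and f: "f \<in> formal_sums X"
  shows "norm (linearize \<phi> f) \<le> C * vnorm (alg_tensor X) (tensor_class X f)"
proof -
  have le: "norm (linearize \<phi> f) \<le> C * (\<Sum>x\<leftarrow>xs. cost x)" if xs: "represents xs f" for xs
  proof -
    have "linearize \<phi> f = (\<Sum>x\<leftarrow>xs. \<phi> x)"
      using linearize_tensor_eq[OF \<phi>, of "\<Sum>x\<leftarrow>xs. pure x" f] xs by (simp add: represents_def linearize_sum_list)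
    also have "norm \<dots> \<le> (\<Sum>x\<leftarrow>xs. norm (\<phi> x))"
      by (induction xs) (auto intro: norm_triangle_mono)
    also have "\<dots> \<le> (\<Sum>x\<leftarrow>xs. C * cost x)"
      using xs C(1) by (intro sum_list_mono) (auto simp: represents_def)
    finally show ?thesis by (simp add: sum_list_const_mult)
  qed
  show ?thesis
  proof (cases "C = 0")
    case True
    then show ?thesis using le represents_exists[OF f] by (metis mult_zero_left)
  next
    case False
    then have "norm (linearize \<phi> f) / C \<le> vnorm (alg_tensor X) (tensor_class X f)"
      using le C(2) by (intro norm_alg_tensor_greatest[OF f]) (simp add: field_simps)
    then show ?thesis using False C(2) by (simp add: field_simps)
  qed
qed

lemma tensor_eq_finite_rank:
  assumes y: "y \<in> tuples X" and L: "set L \<subseteq> UNIV \<times> vcarrier (X i)"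
  shows "tensor_eq X (pure (y(i := finite_rank (X i) L (y i)))) (\<Sum>(\<phi>, e)\<leftarrow>L. fscale (\<phi> (y i)) (pure (y(i := e))))"
  using L
proof (induction L)
  case Nil
  have "vscale (X i) 0 (y i) = vzero (X i)"
    using y by (simp add: tuples_def normed_space.scale_zero_left[OF normed])
  then have "tensor_eq X (pure (y(i := vzero (X i)))) 0"
    using tensor_eq_pure_scale[OF y, of "y i" i 0] y by (simp add: tuples_def del: fun_upd_apply)
  then show ?case by (simp only: finite_rank.simps list.map sum_list.Nil)
next
  case (Cons p L)
  obtain \<phi> e where p: "p = (\<phi>, e)" by fastforce
  have e: "e \<in> vcarrier (X i)" and L: "snd ` set L \<subseteq> vcarrier (X i)" using Cons.prems by (auto simp: p)
  have "set L \<subseteq> UNIV \<times> vcarrier (X i)" using Cons.prems by auto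
  note IH = Cons.IH[OF this]
  have "tensor_eq X (pure (y(i := finite_rank (X i) (p # L) (y i))))
     (pure (y(i := vscale (X i) (\<phi> (y i)) e)) + pure (y(i := finite_rank (X i) L (y i))))"
    using tensor_eq_pure_plus[OF y normed_space.scale_closed[OF normed e] normed_space.finite_rank_closed[OF normed L]]
    by (simp add: p)
  moreover have "tensor_eq X (pure (y(i := vscale (X i) (\<phi> (y i)) e)) + pure (y(i := finite_rank (X i) L (y i))))
     (fscale (\<phi> (y i)) (pure (y(i := e))) + (\<Sum>(\<phi>, e)\<leftarrow>L. fscale (\<phi> (y i)) (pure (y(i := e)))))"
    by (intro tensor_eq_add tensor_eq_pure_scale[OF y e] IH)
  ultimately have "tensor_eq X (pure (y(i := finite_rank (X i) (p # L) (y i))))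
     (fscale (\<phi> (y i)) (pure (y(i := e))) + (\<Sum>(\<phi>, e)\<leftarrow>L. fscale (\<phi> (y i)) (pure (y(i := e)))))"
    by (rule tensor_eq_trans)
  then show ?case unfolding p list.map sum_list.Cons prod.case .
qed

text \<open>Replacing one coordinate after the other by its finite-rank expansion writes the elementary
  tensors of all tuples \<open>x\<close> that are fixed coordinatewise in terms of tensors of tuples \<open>w\<close> that do not
  depend on \<open>x\<close> in the coordinates \<open>I\<close>. The list \<open>M\<close> holds, for each such \<open>w\<close>, the functionals whose product is its
  coefficient.\<close>

lemma pure_expansion:
  assumes L: "\<And>i. set (L i) \<subseteq> dual_space (X i) \<times> vcarrier (X i)" and "finite I"
  shows "\<exists>M. (\<forall>(\<Phi>, w)\<in>set M. \<forall>i\<in>I. \<Phi> i \<in> dual_space (X i) \<and> w i \<in> vcarrier (X i)) \<and>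
    (\<forall>x\<in>tuples X. (\<forall>i\<in>I. finite_rank (X i) (L i) (x i) = x i) \<longrightarrow>
      tensor_eq X (pure x) (\<Sum>(\<Phi>, w)\<leftarrow>M. fscale (\<Prod>i\<in>I. \<Phi> i (x i)) (pure (\<lambda>i. if i \<in> I then w i else x i))))"
  using \<open>finite I\<close>
proof (induction I)
  case empty
  show ?case by (rule exI[of _ "[(undefined, undefined)]"]) simp
next
  case (insert i I)
  then obtain M where M: "\<And>\<Phi> w k. (\<Phi>, w) \<in> set M \<Longrightarrow> k \<in> I \<Longrightarrow> \<Phi> k \<in> dual_space (X k) \<and> w k \<in> vcarrier (X k)"
    and eq: "\<And>x. x \<in> tuples X \<Longrightarrow> (\<And>k. k \<in> I \<Longrightarrow> finite_rank (X k) (L k) (x k) = x k) \<Longrightarrow>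
      tensor_eq X (pure x) (\<Sum>(\<Phi>, w)\<leftarrow>M. fscale (\<Prod>k\<in>I. \<Phi> k (x k)) (pure (\<lambda>k. if k \<in> I then w k else x k)))"
    by blast
  define N where "N = concat (map (\<lambda>(\<Phi>, w). map (\<lambda>(\<phi>, e). (\<Phi>(i := \<phi>), w(i := e))) (L i)) M)"
  have "\<Phi> k \<in> dual_space (X k) \<and> w k \<in> vcarrier (X k)" if "(\<Phi>, w) \<in> set N" "k \<in> insert i I" for \<Phi> w k
    using that M L[of i] by (fastforce simp: N_def)
  moreover have "tensor_eq X (pure x) (\<Sum>(\<Phi>, w)\<leftarrow>N. fscale (\<Prod>k\<in>insert i I. \<Phi> k (x k))
      (pure (\<lambda>k. if k \<in> insert i I then w k else x k)))"
    if x: "x \<in> tuples X" and fixed: "\<And>k. k \<in> insert i I \<Longrightarrow> finite_rank (X k) (L k) (x k) = x k" for x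
  proof -
    let ?y = "\<lambda>w k. if k \<in> I then w k else x k"
    let ?S = "\<lambda>(\<Phi>, w). \<Sum>(\<phi>, e)\<leftarrow>L i. fscale (\<Prod>k\<in>insert i I. (\<Phi>(i := \<phi>)) k (x k))
      (pure (\<lambda>k. if k \<in> insert i I then (w(i := e)) k else x k))"
    have S: "tensor_eq X (case p of (\<Phi>, w) \<Rightarrow> fscale (\<Prod>k\<in>I. \<Phi> k (x k)) (pure (?y w))) (?S p)"
      if p: "p \<in> set M" for p
    proof -
      obtain \<Phi> w where pe: "p = (\<Phi>, w)" by fastforce
      have y: "?y w \<in> tuples X" using x M[of \<Phi> w] p by (auto simp: tuples_def pe)
      have "tensor_eq X (pure (?y w)) (\<Sum>(\<phi>, e)\<leftarrow>L i. fscale (\<phi> (x i)) (pure ((?y w)(i := e))))"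
      proof -
        have "(?y w)(i := finite_rank (X i) (L i) (?y w i)) = ?y w"
          using fixed[of i] insert.hyps by auto
        then show ?thesis using tensor_eq_finite_rank[OF y, of "L i" i] L[of i] insert.hyps by auto
      qed
      from tensor_eq_scale[OF this]
      have "tensor_eq X (fscale (\<Prod>k\<in>I. \<Phi> k (x k)) (pure (?y w)))
        (fscale (\<Prod>k\<in>I. \<Phi> k (x k)) (\<Sum>(\<phi>, e)\<leftarrow>L i. fscale (\<phi> (x i)) (pure ((?y w)(i := e)))))" .
      also have "fscale (\<Prod>k\<in>I. \<Phi> k (x k)) (\<Sum>(\<phi>, e)\<leftarrow>L i. fscale (\<phi> (x i)) (pure ((?y w)(i := e)))) = ?S p"
      proof -
        have key: "fscale (\<Prod>k\<in>I. \<Phi> k (x k)) (fscale (\<phi> (x i)) (pure ((?y w)(i := e)))) =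
          fscale (\<Prod>k\<in>insert i I. (\<Phi>(i := \<phi>)) k (x k)) (pure (\<lambda>k. if k \<in> insert i I then (w(i := e)) k else x k))" for \<phi> e
        proof -
          have "(\<Prod>k\<in>I. (\<Phi>(i := \<phi>)) k (x k)) = (\<Prod>k\<in>I. \<Phi> k (x k))"
            using insert.hyps by (intro prod.cong) auto
          moreover have "(?y w)(i := e) = (\<lambda>k. if k \<in> insert i I then (w(i := e)) k else x k)" by auto
          ultimately show ?thesis using insert.hyps by (simp add: mult.commute)
        qed
        have "fscale c (\<Sum>(\<phi>, e)\<leftarrow>K. G \<phi> e) = (\<Sum>(\<phi>, e)\<leftarrow>K. fscale c (G \<phi> e))"
          for c and K :: "(('a \<Rightarrow> 'k) \<times> 'a) list" and G :: "_ \<Rightarrow> _ \<Rightarrow> (('n \<Rightarrow> 'a) \<Rightarrow>\<^sub>0 'k)"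
          by (induction K) (auto simp: fs.scale_right_distrib)
        then show ?thesis by (simp only: pe prod.case key)
      qed
      finally show ?thesis by (simp add: pe)
    qed
    have "tensor_eq X (pure x) (\<Sum>p\<leftarrow>M. ?S p)"
      using tensor_eq_trans[OF eq[OF x fixed] tensor_eq_sum_list[of M, OF S]] by simp
    also have "(\<Sum>p\<leftarrow>M. ?S p) = (\<Sum>(\<Phi>, w)\<leftarrow>N. fscale (\<Prod>k\<in>insert i I. \<Phi> k (x k))
      (pure (\<lambda>k. if k \<in> insert i I then w k else x k)))"
    proof -
      have "(\<Sum>(\<Phi>, w)\<leftarrow>concat (map (\<lambda>(\<Phi>, w). map (\<lambda>(\<phi>, e). (g \<Phi> \<phi>, h w e)) K) M). F \<Phi> w)
        = (\<Sum>(\<Phi>, w)\<leftarrow>M. \<Sum>(\<phi>, e)\<leftarrow>K. F (g \<Phi> \<phi>) (h w e))"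
        for g h and K :: "(('a \<Rightarrow> 'k) \<times> 'a) list" and F :: "('n \<Rightarrow> 'a \<Rightarrow> 'k) \<Rightarrow> ('n \<Rightarrow> 'a) \<Rightarrow> (('n \<Rightarrow> 'a) \<Rightarrow>\<^sub>0 'k)"
        by (induction M) (simp_all add: case_prod_unfold o_def)
      then show ?thesis unfolding N_def by simp
    qed
    finally show ?thesis .
  qed
  ultimately show ?case by (intro exI[of _ N] conjI ballI impI) (blast, blast)
qed

lemma product_form_bounded:
  assumes \<Phi>: "\<And>i. \<Phi> i \<in> dual_space (X i)"
  shows "(\<lambda>x. \<Prod>i\<in>UNIV. \<Phi> i (x i)) \<in> bounded_forms X"
proof -
  have upd: "(\<Prod>k\<in>UNIV. \<Phi> k ((x(i := a)) k)) = \<Phi> i a * (\<Prod>k\<in>UNIV - {i}. \<Phi> k (x k))" for x i a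
    by (subst prod.remove[of _ i]) auto
  have "\<exists>C\<ge>0. \<forall>a\<in>vcarrier (X i). norm (\<Phi> i a) \<le> C * vnorm (X i) a" for i
    using normed_space.dual_space_bound[OF normed \<Phi>] by metis
  then obtain C where C: "\<And>i. 0 \<le> C i" "\<And>i a. a \<in> vcarrier (X i) \<Longrightarrow> norm (\<Phi> i a) \<le> C i * vnorm (X i) a"
    by metis
  have "norm (\<Prod>i\<in>UNIV. \<Phi> i (x i)) \<le> (\<Prod>i\<in>UNIV. C i) * (\<Prod>i\<in>UNIV. vnorm (X i) (x i))" if "x \<in> tuples X" for x
    unfolding prod_norm[symmetric] prod.distrib[symmetric]
    using that C(2) by (intro prod_mono) (auto simp: tuples_def)
  then show ?thesis unfolding bounded_forms_iff upd
    using \<Phi> by (auto simp: dual_space_plus dual_space_scale algebra_simps)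
qed

text \<open>In the expansion of \<open>f\<close> along tensors independent of \<open>f\<close>'s terms, each coefficient is the
  value at \<open>f\<close> of a product of functionals, which is a bounded form.\<close>

theorem bounded_forms_separate:
  assumes f: "f \<in> formal_sums X" and zero: "\<And>\<phi>. \<phi> \<in> bounded_forms X \<Longrightarrow> linearize \<phi> f = 0"
  shows "tensor_eq X f 0"
proof -
  have "\<exists>L. set L \<subseteq> dual_space (X i) \<times> vcarrier (X i) \<and>
      (\<forall>a\<in>(\<lambda>x. x i) ` Poly_Mapping.keys f. finite_rank (X i) L a = a)" for i
    using f by (intro normed_space.finite_rank_identity_on_finite[OF normed]) (auto simp: formal_sums_def tuples_def)
  then obtain L where L: "\<And>i. set (L i) \<subseteq> dual_space (X i) \<times> vcarrier (X i)"
    and fixed: "\<And>i x. x \<in> Poly_Mapping.keys f \<Longrightarrow> finite_rank (X i) (L i) (x i) = x i"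
    by (metis imageI)
  obtain M where M: "\<And>\<Phi> w i. (\<Phi>, w) \<in> set M \<Longrightarrow> \<Phi> i \<in> dual_space (X i)"
    and eq: "\<And>x. x \<in> tuples X \<Longrightarrow> (\<And>i. finite_rank (X i) (L i) (x i) = x i) \<Longrightarrow>
      tensor_eq X (pure x) (\<Sum>(\<Phi>, w)\<leftarrow>M. fscale (\<Prod>i\<in>UNIV. \<Phi> i (x i)) (pure w))"
    using pure_expansion[OF L, of UNIV] by (fastforce simp: fun_eq_iff)
  let ?c = "poly_mapping.lookup f"
  have "tensor_eq X (\<Sum>x\<in>Poly_Mapping.keys f. fscale (?c x) (pure x))
    (\<Sum>x\<in>Poly_Mapping.keys f. fscale (?c x) (\<Sum>(\<Phi>, w)\<leftarrow>M. fscale (\<Prod>i\<in>UNIV. \<Phi> i (x i)) (pure w)))"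
    using f fixed by (intro tensor_eq_sum tensor_eq_scale eq) (auto simp: formal_sums_def)
  also have "(\<Sum>x\<in>Poly_Mapping.keys f. fscale (?c x) (\<Sum>(\<Phi>, w)\<leftarrow>M. fscale (\<Prod>i\<in>UNIV. \<Phi> i (x i)) (pure w)))
    = (\<Sum>(\<Phi>, w)\<leftarrow>M. fscale (linearize (\<lambda>x. \<Prod>i\<in>UNIV. \<Phi> i (x i)) f) (pure w))"
    by (induction M) (auto simp: fs.scale_right_distrib sum.distrib linearize_def fs.scale_sum_left)
  also have "\<dots> = (\<Sum>(\<Phi>, w)\<leftarrow>M. 0)"
    using zero[OF product_form_bounded] M by (intro arg_cong[of _ _ sum_list] map_cong) auto
  finally show ?thesis by (simp add: case_prod_unfold flip: expand_pure)
qed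

text \<open>The one axiom that is not formal is definiteness: a class of norm zero is killed by all
  bounded forms, and these separate the points of the algebraic tensor product.\<close>

theorem normed_space_alg_tensor: "normed_space (alg_tensor X)"
proof -
  have definite: "tensor_class X f = tensor_class X 0"
    if f: "f \<in> formal_sums X" and n: "vnorm (alg_tensor X) (tensor_class X f) = 0" for f
  proof (intro tensor_class_eq bounded_forms_separate[OF f])
    fix \<phi> assume \<phi>: "\<phi> \<in> bounded_forms X"
    then obtain C where C: "0 \<le> C" "\<And>x. x \<in> tuples X \<Longrightarrow> norm (\<phi> x) \<le> C * cost x"
      using bounded_form_bound by blast
    from norm_linearize_le[OF \<phi> C(2,1) f] show "linearize \<phi> f = 0" by (simp add: n)
  qed
  let ?V = "alg_tensor X"
  note ts = alg_tensor_simps alg_tensor_plus alg_tensor_scale formal_sums_closed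
  show ?thesis
  proof
    fix s t u :: "(('n \<Rightarrow> 'a) \<Rightarrow>\<^sub>0 'k) set" and c d :: 'k
    show "vzero ?V \<in> vcarrier ?V" by (simp add: ts)
    assume "s \<in> vcarrier ?V"
    then obtain f where f: "f \<in> formal_sums X" and s: "s = tensor_class X f" by (auto simp: ts)
    show "vscale ?V c s \<in> vcarrier ?V" "vplus ?V s (vzero ?V) = s" "vscale ?V 1 s = s"
      "vscale ?V c (vscale ?V d s) = vscale ?V (c * d) s"
      using f by (simp_all add: s ts)
    show "vscale ?V (c + d) s = vplus ?V (vscale ?V c s) (vscale ?V d s)"
      using f by (simp add: s ts fs.scale_left_distrib)
    show "\<exists>t\<in>vcarrier ?V. vplus ?V s t = vzero ?V"
      using f fs.subspace_neg[OF formal_sums_subspace f]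
      by (intro bexI[of _ "tensor_class X (- f)"]) (simp_all add: s ts)
    show "0 \<le> vnorm ?V s" "vnorm ?V (vscale ?V c s) = norm c * vnorm ?V s"
      using f by (simp_all add: s ts norm_alg_tensor_nonneg norm_alg_tensor_scale)
    show "vnorm ?V s = 0 \<longleftrightarrow> s = vzero ?V"
      using definite[OF f] norm_alg_tensor_zero by (auto simp: s ts)
    assume "t \<in> vcarrier ?V"
    then obtain g where g: "g \<in> formal_sums X" and t: "t = tensor_class X g" by (auto simp: ts)
    show "vplus ?V s t \<in> vcarrier ?V" "vplus ?V s t = vplus ?V t s"
      using f g by (simp_all add: s t ts add.commute)
    show "vscale ?V c (vplus ?V s t) = vplus ?V (vscale ?V c s) (vscale ?V c t)"
      using f g by (simp add: s t ts fs.scale_right_distrib)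
    show "vnorm ?V (vplus ?V s t) \<le> vnorm ?V s + vnorm ?V t"
      using f g by (simp add: s t ts norm_alg_tensor_triangle)
    assume "u \<in> vcarrier ?V"
    then obtain h where h: "h \<in> formal_sums X" and u: "u = tensor_class X h" by (auto simp: ts)
    show "vplus ?V (vplus ?V s t) u = vplus ?V s (vplus ?V t u)"
      using f g h by (simp add: s t u ts add.assoc)
  qed
qed

end

section \<open>Functionals on the completion\<close>

context normed_space
begin

lemma vdist_eq: "\<lbrakk>x \<in> vcarrier V; y \<in> vcarrier V\<rbrakk> \<Longrightarrow> vdist V x y = vnorm V (vplus V x (vscale V (- 1) y))"
  by (simp add: vdist_def)

lemma vdist_plus:
  assumes "x \<in> vcarrier V" "x' \<in> vcarrier V" "y \<in> vcarrier V" "y' \<in> vcarrier V"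
  shows "vdist V (vplus V x x') (vplus V y y') \<le> vdist V x y + vdist V x' y'"
  using assms norm_triangle[of "vplus V x (vscale V (- 1) y)" "vplus V x' (vscale V (- 1) y')"]
  by (simp add: vdist_eq plus_closed scale_plus_right plus_exchange scale_closed)

lemma vdist_scale:
  assumes "x \<in> vcarrier V" "y \<in> vcarrier V"
  shows "vdist V (vscale V c x) (vscale V c y) = norm c * vdist V x y"
  using assms norm_scale[of "vplus V x (vscale V (- 1) y)" c]
  by (simp add: vdist_eq scale_closed scale_plus_right scale_scale plus_closed)

lemma vdist_commute: "vdist V x y = vdist V y x"
  by (rule Metric_space.commute[OF Metric_space_vdist])

lemma norm_diff_le_vdist:
  assumes x: "x \<in> vcarrier V" and y: "y \<in> vcarrier V"
  shows "\<bar>vnorm V x - vnorm V y\<bar> \<le> vdist V x y"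
proof -
  have "vnorm V x \<le> vdist V x y + vnorm V y" if x: "x \<in> vcarrier V" and y: "y \<in> vcarrier V" for x y
  proof -
    have "x = vplus V (vplus V x (vscale V (- 1) y)) y"
      using x y plus_commute[OF scale_closed[OF y] y, of "- 1"]
      by (simp add: plus_assoc scale_closed scale_minus_one plus_zero)
    then show ?thesis
      using norm_triangle[OF plus_closed[OF x scale_closed[OF y]] y, of "- 1"] x y by (simp add: vdist_eq)
  qed
  from this[OF x y] this[OF y x] show ?thesis using vdist_commute[of x y] by simp
qed

lemma dual_diff_le_vdist:
  assumes "\<phi> \<in> dual_space V" and C: "\<And>x. x \<in> vcarrier V \<Longrightarrow> norm (\<phi> x) \<le> C * vnorm V x"
    and "x \<in> vcarrier V" "y \<in> vcarrier V"
  shows "norm (\<phi> x - \<phi> y) \<le> C * vdist V x y"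
  using assms C[of "vplus V x (vscale V (- 1) y)"]
  by (simp add: vdist_eq plus_closed scale_closed dual_space_plus dual_space_scale)

lemma vCauchy_iff:
  "vCauchy V s \<longleftrightarrow> range s \<subseteq> vcarrier V \<and> (\<forall>\<epsilon>>0. \<exists>N. \<forall>m\<ge>N. \<forall>n\<ge>N. vdist V (s m) (s n) < \<epsilon>)"
  unfolding Metric_space.MCauchy_def[OF Metric_space_vdist] by simp

lemma vCauchy_closed: "vCauchy V s \<Longrightarrow> s m \<in> vcarrier V"
  by (auto simp: vCauchy_iff)

lemma vCauchy_plus:
  assumes s: "vCauchy V s" and t: "vCauchy V t"
  shows "vCauchy V (\<lambda>m. vplus V (s m) (t m))"
  unfolding vCauchy_iff
proof (intro conjI allI impI)
  show "range (\<lambda>m. vplus V (s m) (t m)) \<subseteq> vcarrier V"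
    using vCauchy_closed[OF s] vCauchy_closed[OF t] plus_closed by auto
  fix \<epsilon> :: real assume "0 < \<epsilon>"
  then have "0 < \<epsilon> / 2" by simp
  then obtain M N where "\<forall>m\<ge>M. \<forall>n\<ge>M. vdist V (s m) (s n) < \<epsilon> / 2" "\<forall>m\<ge>N. \<forall>n\<ge>N. vdist V (t m) (t n) < \<epsilon> / 2"
    using s t unfolding vCauchy_iff by meson
  then have "vdist V (s m) (s n) + vdist V (t m) (t n) < \<epsilon>" if "m \<ge> max M N" "n \<ge> max M N" for m n
    using that by (smt (verit) field_sum_of_halves max.bounded_iff)
  then show "\<exists>N. \<forall>m\<ge>N. \<forall>n\<ge>N. vdist V (vplus V (s m) (t m)) (vplus V (s n) (t n)) < \<epsilon>"
    using vdist_plus[OF vCauchy_closed[OF s] vCauchy_closed[OF t] vCauchy_closed[OF s] vCauchy_closed[OF t]]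
    by (meson order_le_less_trans)
qed

lemma vCauchy_scale:
  assumes s: "vCauchy V s"
  shows "vCauchy V (\<lambda>m. vscale V c (s m))"
  unfolding vCauchy_iff
proof (intro conjI allI impI)
  show "range (\<lambda>m. vscale V c (s m)) \<subseteq> vcarrier V"
    using vCauchy_closed[OF s] scale_closed by auto
  fix \<epsilon> :: real assume \<epsilon>: "0 < \<epsilon>"
  have c: "0 < norm c + 1" by (simp add: add_nonneg_pos)
  then have "0 < \<epsilon> / (norm c + 1)" using \<epsilon> by simp
  then obtain N where N: "\<forall>m\<ge>N. \<forall>n\<ge>N. vdist V (s m) (s n) < \<epsilon> / (norm c + 1)"
    using s unfolding vCauchy_iff by meson
  have "vdist V (vscale V c (s m)) (vscale V c (s n)) < \<epsilon>" if "m \<ge> N" "n \<ge> N" for m n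
  proof -
    have d: "0 \<le> vdist V (s m) (s n)" by (rule Metric_space.nonneg[OF Metric_space_vdist])
    have "norm c * vdist V (s m) (s n) \<le> (norm c + 1) * vdist V (s m) (s n)"
      using d by (intro mult_right_mono) auto
    also have "\<dots> < \<epsilon>" using N that c by (simp add: field_simps)
    finally show ?thesis by (simp add: vdist_scale vCauchy_closed[OF s])
  qed
  then show "\<exists>N. \<forall>m\<ge>N. \<forall>n\<ge>N. vdist V (vscale V c (s m)) (vscale V c (s n)) < \<epsilon>" by blast
qed

lemma cauchy_class_self: "vCauchy V s \<Longrightarrow> s \<in> cauchy_class V s"
  using Metric_space.mdist_zero[OF Metric_space_vdist] vCauchy_closed by (simp add: cauchy_class_def)

lemma vCauchy_const: "x \<in> vcarrier V \<Longrightarrow> vCauchy V (\<lambda>_. x)"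
  using Metric_space.mdist_zero[OF Metric_space_vdist, of x] by (auto simp: vCauchy_iff)

text \<open>Equivalent Cauchy sequences have images with a common limit. It serves both the norm of the
  completion and the extension of functionals.\<close>

lemma Lipschitz_limit_on_cauchy_class:
  fixes F :: "'a \<Rightarrow> 'm::{real_normed_vector, complete_space}"
  assumes F: "\<And>x y. x \<in> vcarrier V \<Longrightarrow> y \<in> vcarrier V \<Longrightarrow> norm (F x - F y) \<le> K * vdist V x y"
    and s: "vCauchy V s"
  shows "\<exists>r. \<forall>t\<in>cauchy_class V s. (\<lambda>m. F (t m)) \<longlonglongrightarrow> r"
proof -
  have F': "norm (F x - F y) \<le> (\<bar>K\<bar> + 1) * vdist V x y" if "x \<in> vcarrier V" "y \<in> vcarrier V" for x y
  proof -
    have "K * vdist V x y \<le> (\<bar>K\<bar> + 1) * vdist V x y"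
      using Metric_space.nonneg[OF Metric_space_vdist] by (intro mult_right_mono) auto
    then show ?thesis using F[OF that] by linarith
  qed
  have "Cauchy (\<lambda>m. F (s m))"
  proof (rule CauchyI)
    fix e :: real assume "0 < e"
    then have "0 < e / (\<bar>K\<bar> + 1)" by simp
    then obtain N where "\<forall>m\<ge>N. \<forall>n\<ge>N. vdist V (s m) (s n) < e / (\<bar>K\<bar> + 1)"
      using s unfolding vCauchy_iff by meson
    then have "(\<bar>K\<bar> + 1) * vdist V (s m) (s n) < e" if "m \<ge> N" "n \<ge> N" for m n
      using that by (simp add: field_simps)
    then show "\<exists>N. \<forall>m\<ge>N. \<forall>n\<ge>N. norm (F (s m) - F (s n)) < e"
      using F'[OF vCauchy_closed[OF s] vCauchy_closed[OF s]] by (meson order_le_less_trans)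
  qed
  then obtain r where r: "(\<lambda>m. F (s m)) \<longlonglongrightarrow> r" using Cauchy_convergent convergent_def by blast
  have "(\<lambda>m. F (t m)) \<longlonglongrightarrow> r" if t: "t \<in> cauchy_class V s" for t
  proof -
    have d: "(\<lambda>m. (\<bar>K\<bar> + 1) * vdist V (s m) (t m)) \<longlonglongrightarrow> 0"
      using t by (auto simp: cauchy_class_def intro: tendsto_mult_right_zero)
    have "vCauchy V t" using t by (simp add: cauchy_class_def)
    then have "(\<lambda>m. F (s m) - F (t m)) \<longlonglongrightarrow> 0"
      using F' vCauchy_closed[OF s] vCauchy_closed[of t] by (intro Lim_null_comparison[OF always_eventually d]) auto
    from tendsto_diff[OF r this] show ?thesis by simp
  qed
  then show ?thesis by blast
qed

end

text \<open>The extension by continuity to classes of Cauchy sequences.\<close>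

definition completion_extend :: "('a \<Rightarrow> 'm::topological_space) \<Rightarrow> (nat \<Rightarrow> 'a) set \<Rightarrow> 'm" where
  "completion_extend F S = (THE r. \<forall>s\<in>S. (\<lambda>m. F (s m)) \<longlonglongrightarrow> r)"

lemma completion_extend_eqI:
  fixes F :: "'a \<Rightarrow> 'm::t2_space"
  assumes "s \<in> S" "\<And>s. s \<in> S \<Longrightarrow> (\<lambda>m. F (s m)) \<longlonglongrightarrow> r"
  shows "completion_extend F S = r"
  unfolding completion_extend_def
  by (rule the_equality) (use assms LIMSEQ_unique in blast)+

theorem completion_extend_dual:
  fixes V :: "('k::{real_normed_field, complete_space}, 'a) nspace"
  assumes V: "normed_space V" and \<phi>: "\<phi> \<in> dual_space V"
  shows "completion_extend \<phi> \<in> dual_space (completion V)"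
    and "x \<in> vcarrier V \<Longrightarrow> completion_extend \<phi> (completion_embed V x) = \<phi> x"
proof -
  interpret normed_space V by (rule V)
  let ?\<psi> = "completion_extend \<phi>" and ?c = "cauchy_class V"
  obtain C where C: "0 \<le> C" "\<And>x. x \<in> vcarrier V \<Longrightarrow> norm (\<phi> x) \<le> C * vnorm V x"
    using dual_space_bound[OF \<phi>] by blast
  have lim: "(\<lambda>m. \<phi> (t m)) \<longlonglongrightarrow> ?\<psi> (?c s)" if s: "vCauchy V s" and "t \<in> ?c s" for s t
  proof -
    obtain r where r: "\<And>t. t \<in> ?c s \<Longrightarrow> (\<lambda>m. \<phi> (t m)) \<longlonglongrightarrow> r"
      using Lipschitz_limit_on_cauchy_class[OF dual_diff_le_vdist[OF \<phi> C(2)] s] by blast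
    have "?\<psi> (?c s) = r" using cauchy_class_self[OF s] r by (rule completion_extend_eqI)
    then show ?thesis using r that by simp
  qed
  have eqI: "?\<psi> (?c s) = r" if s: "vCauchy V s" and "(\<lambda>m. \<phi> (s m)) \<longlonglongrightarrow> r" for s r
    using lim[OF s cauchy_class_self[OF s]] that(2) by (rule LIMSEQ_unique)
  have cauchy: "vCauchy V t" if "t \<in> ?c s" for s t using that by (simp add: cauchy_class_def)
  show "?\<psi> (completion_embed V x) = \<phi> x" if "x \<in> vcarrier V" for x
    unfolding completion_embed_def by (rule eqI[OF vCauchy_const[OF that]]) simp
  have "?\<psi> (vplus (completion V) S T) = ?\<psi> S + ?\<psi> T"
    if ST: "S \<in> vcarrier (completion V)" "T \<in> vcarrier (completion V)" for S T
  proof -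
    obtain s0 t0 where st0: "vCauchy V s0" "S = ?c s0" "vCauchy V t0" "T = ?c t0"
      using ST by (auto simp: Defs.completion_def)
    have "(\<lambda>m. \<phi> (u m)) \<longlonglongrightarrow> ?\<psi> S + ?\<psi> T" if "u \<in> vplus (completion V) S T" for u
    proof -
      obtain s t where s: "s \<in> S" and t: "t \<in> T" and u: "u \<in> ?c (\<lambda>m. vplus V (s m) (t m))"
        using \<open>u \<in> vplus (completion V) S T\<close> by (auto simp: Defs.completion_def)
      have st: "vCauchy V s" "vCauchy V t" using s t cauchy st0 by auto
      have "(\<lambda>m. \<phi> (s m) + \<phi> (t m)) \<longlonglongrightarrow> ?\<psi> S + ?\<psi> T"
        using s t lim st0 by (auto intro!: tendsto_add)
      then have "(\<lambda>m. \<phi> (vplus V (s m) (t m))) \<longlonglongrightarrow> ?\<psi> S + ?\<psi> T"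
        by (simp add: dual_space_plus[OF \<phi>] vCauchy_closed st)
      with eqI[OF vCauchy_plus[OF st]] lim[OF vCauchy_plus[OF st] u] show ?thesis by simp
    qed
    moreover have "(\<lambda>m. vplus V (s0 m) (t0 m)) \<in> vplus (completion V) S T"
      using cauchy_class_self[OF st0(1)] cauchy_class_self[OF st0(3)]
        cauchy_class_self[OF vCauchy_plus[OF st0(1,3)]] st0 by (auto simp: Defs.completion_def)
    ultimately show ?thesis by (intro completion_extend_eqI)
  qed
  moreover have "?\<psi> (vscale (completion V) c S) = c * ?\<psi> S" if S: "S \<in> vcarrier (completion V)" for c S
  proof -
    obtain s0 where s0: "vCauchy V s0" "S = ?c s0" using S by (auto simp: Defs.completion_def)
    have "(\<lambda>m. \<phi> (u m)) \<longlonglongrightarrow> c * ?\<psi> S" if "u \<in> vscale (completion V) c S" for u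
    proof -
      obtain s where s: "s \<in> S" and u: "u \<in> ?c (\<lambda>m. vscale V c (s m))"
        using \<open>u \<in> vscale (completion V) c S\<close> by (auto simp: Defs.completion_def)
      have cs: "vCauchy V s" using s cauchy s0 by auto
      have "(\<lambda>m. c * \<phi> (s m)) \<longlonglongrightarrow> c * ?\<psi> S"
        using s lim s0 by (auto intro!: tendsto_mult)
      then have "(\<lambda>m. \<phi> (vscale V c (s m))) \<longlonglongrightarrow> c * ?\<psi> S"
        by (simp add: dual_space_scale[OF \<phi>] vCauchy_closed cs)
      with eqI[OF vCauchy_scale[OF cs]] lim[OF vCauchy_scale[OF cs] u] show ?thesis by simp
    qed
    moreover have "(\<lambda>m. vscale V c (s0 m)) \<in> vscale (completion V) c S"
      using cauchy_class_self[OF s0(1)] cauchy_class_self[OF vCauchy_scale[OF s0(1)]] s0 by (auto simp: Defs.completion_def)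
    ultimately show ?thesis by (intro completion_extend_eqI)
  qed
  moreover have "norm (?\<psi> S) \<le> C * vnorm (completion V) S" if S: "S \<in> vcarrier (completion V)" for S
  proof -
    obtain s where s: "vCauchy V s" "S = ?c s" using S by (auto simp: Defs.completion_def)
    have "norm (vnorm V x - vnorm V y) \<le> 1 * vdist V x y" if "x \<in> vcarrier V" "y \<in> vcarrier V" for x y
      using norm_diff_le_vdist[OF that] by simp
    from Lipschitz_limit_on_cauchy_class[OF this s(1)]
    obtain r where r: "\<And>t. t \<in> S \<Longrightarrow> (\<lambda>m. vnorm V (t m)) \<longlonglongrightarrow> r" using s(2) by blast
    have sS: "s \<in> S" using cauchy_class_self[OF s(1)] s(2) by simp
    have "vnorm (completion V) S = completion_extend (vnorm V) S"
      by (simp add: Defs.completion_def completion_extend_def)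
    also have "\<dots> = r" using sS r by (rule completion_extend_eqI)
    finally have upper: "(\<lambda>m. C * vnorm V (s m)) \<longlonglongrightarrow> C * vnorm (completion V) S"
      using r[OF sS] by (auto intro: tendsto_mult_left)
    have "(\<lambda>m. norm (\<phi> (s m))) \<longlonglongrightarrow> norm (?\<psi> S)"
      using lim[OF s(1)] sS s(2) by (intro tendsto_norm) simp
    then show ?thesis
      by (rule LIMSEQ_le[OF _ upper]) (use C(2) vCauchy_closed[OF s(1)] in auto)
  qed
  ultimately show "?\<psi> \<in> dual_space (completion V)" unfolding dual_space_def by blast
qed

text \<open>Bounded multilinear forms are functionals on the completed projective tensor product, so a
  weakly Cauchy sequence of elementary tensors is Cauchy under each of them.\<close>

theorem bounded_form_factors_proj_tensor:
  fixes X :: "'n::finite \<Rightarrow> ('k::{real_normed_field, complete_space}, 'a) nspace"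
  assumes X: "\<And>i. normed_space (X i)" and \<phi>: "\<phi> \<in> bounded_forms X"
  obtains \<psi> where "\<psi> \<in> dual_space (proj_tensor X)" "\<And>x. x \<in> tuples X \<Longrightarrow> \<psi> (elem_tensor X x) = \<phi> x"
proof -
  interpret normed_family X by (rule normed_family.intro) (rule X)
  define \<Lambda> where "\<Lambda> t = linearize \<phi> (SOME f. f \<in> t)" for t :: "(('n \<Rightarrow> 'a) \<Rightarrow>\<^sub>0 'k) set"
  have \<Lambda>: "\<Lambda> (tensor_class X f) = linearize \<phi> f" if "f \<in> formal_sums X" for f
  proof -
    have "(SOME g. g \<in> tensor_class X f) \<in> tensor_class X f"
      using tensor_class_self[OF that] by (rule someI)
    then show ?thesis unfolding \<Lambda>_def by (intro linearize_tensor_eq[OF \<phi>]) (simp add: tensor_class_iff)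
  qed
  obtain C where C: "0 \<le> C" "\<And>x. x \<in> tuples X \<Longrightarrow> norm (\<phi> x) \<le> C * cost x"
    using bounded_form_bound[OF \<phi>] by blast
  from norm_linearize_le[OF \<phi> C(2,1)]
  have "\<forall>t\<in>vcarrier (alg_tensor X). norm (\<Lambda> t) \<le> C * vnorm (alg_tensor X) t"
    by (auto simp: alg_tensor_simps \<Lambda>)
  then have "\<Lambda> \<in> dual_space (alg_tensor X)"
    unfolding dual_space_def
    by (auto simp: alg_tensor_simps alg_tensor_plus alg_tensor_scale \<Lambda> formal_sums_closed linearize_add linearize_fscale)
  note ext = completion_extend_dual[OF normed_space_alg_tensor this]
  show ?thesis
  proof (rule that)
    show "completion_extend \<Lambda> \<in> dual_space (proj_tensor X)"
      unfolding proj_tensor_def by (rule ext(1))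
    show "completion_extend \<Lambda> (elem_tensor X x) = \<phi> x" if "x \<in> tuples X" for x
      using ext(2)[of "tensor_class X (pure x)"] \<Lambda>[OF pure_formal_sum[OF that]] pure_formal_sum[OF that]
      by (simp add: elem_tensor_def alg_tensor_simps)
  qed
qed

section \<open>Compact sets of functions and pointwise convergence\<close>

text \<open>A uniform boundedness principle, proved by a gliding hump inside \<open>K\<close>. If the values were unbounded, one could choose nested sets
  \<open>D (S n) (3 ^ (- n))\<close>, where \<open>D S r = S + r K\<close>, such that all members of the set of index \<open>n + 1\<close> have
  norm at least \<open>n\<close> at some point \<open>x (m n)\<close>. By compactness some element of \<open>K\<close> satisfies all these closed conditions.\<close>

theorem pointwise_bounded_on_compact_absconvex:
  fixes K :: "('c \<Rightarrow> 'k::real_normed_field) set" and x :: "nat \<Rightarrow> 'c"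
  assumes K: "compact K"
    and absconvex: "\<And>\<phi> \<psi> a b. \<lbrakk>\<phi> \<in> K; \<psi> \<in> K; \<bar>a\<bar> + \<bar>b\<bar> \<le> 1\<rbrakk>
      \<Longrightarrow> (\<lambda>x. of_real a * \<phi> x + of_real b * \<psi> x) \<in> K"
    and bounded: "\<And>\<phi>. \<phi> \<in> K \<Longrightarrow> \<exists>B. \<forall>m. norm (\<phi> (x m)) \<le> B"
  shows "\<exists>B. \<forall>\<phi>\<in>K. \<forall>m. norm (\<phi> (x m)) \<le> B"
proof (rule ccontr)
  assume unbounded: "\<not> ?thesis"
  then have "K \<noteq> {}" by blast
  then have zero: "(\<lambda>_. 0) \<in> K" using absconvex[of _ _ 0 0] by auto
  have cont: "continuous_on A (\<lambda>\<phi>. norm (\<phi> c))" for A and c :: 'c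
    by (intro continuous_on_norm continuous_on_subset[OF continuous_on_product_coordinates]) simp
  define D where "D S r = {\<lambda>y. S y + of_real r * \<eta> y | \<eta>. \<eta> \<in> K}" for S :: "'c \<Rightarrow> 'k" and r :: real
  have step: "\<exists>S'. D S' (r / 3) \<subseteq> D S r \<and> (\<exists>m. \<forall>\<phi>\<in>D S' (r / 3). real n \<le> norm (\<phi> (x m)))"
    if r: "0 < r" for S r and n :: nat
  proof -
    obtain \<eta> m where \<eta>: "\<eta> \<in> K" "3 * real n / r < norm (\<eta> (x m))"
      using unbounded by (meson not_le)
    obtain \<psi> where \<psi>: "\<psi> \<in> K" and max: "\<And>\<phi>. \<phi> \<in> K \<Longrightarrow> norm (\<phi> (x m)) \<le> norm (\<psi> (x m))"
      using continuous_attains_sup[OF K \<open>K \<noteq> {}\<close> cont] by blast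
    have large: "real n \<le> r / 3 * norm (\<psi> (x m))"
    proof -
      have "3 * real n / r \<le> norm (\<psi> (x m))" using \<eta>(2) max[OF \<eta>(1)] by linarith
      then show ?thesis using r by (simp add: field_simps)
    qed
    \<comment> \<open>One of \<open>u + v\<close> and \<open>u - v\<close> has norm at least that of \<open>v\<close>, whatever \<open>S\<close> is at \<open>x m\<close>.\<close>
    obtain s :: real where s: "\<bar>s\<bar> = 1"
      and grow: "2 * r / 3 * norm (\<psi> (x m)) \<le> norm (S (x m) + of_real (s * (2 * r / 3)) * \<psi> (x m))"
    proof -
      define u v where "u = S (x m)" and "v = of_real (2 * r / 3) * \<psi> (x m)"
      have "2 * norm v = norm ((u + v) - (u - v))" by (simp flip: mult_2)
      also have "\<dots> \<le> norm (u + v) + norm (u - v)" by (rule norm_triangle_ineq4)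
      finally have "norm v \<le> norm (u + v) \<or> norm v \<le> norm (u - v)" by linarith
      moreover have "norm v = 2 * r / 3 * norm (\<psi> (x m))" unfolding v_def norm_mult norm_of_real using r by simp
      ultimately show ?thesis using that[of 1] that[of "- 1"] by (auto simp: u_def v_def)
    qed
    define S' where "S' y = S y + of_real (s * (2 * r / 3)) * \<psi> y" for y
    have "D S' (r / 3) \<subseteq> D S r"
    proof
      fix \<phi> assume "\<phi> \<in> D S' (r / 3)"
      then obtain \<eta> where \<eta>: "\<eta> \<in> K" "\<phi> = (\<lambda>y. S' y + of_real (r / 3) * \<eta> y)" by (auto simp: D_def)
      have "(\<lambda>y. of_real (s * (2 / 3)) * \<psi> y + of_real (1 / 3) * \<eta> y) \<in> K"
        using s by (intro absconvex \<psi> \<eta>) (simp add: abs_mult)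
      moreover have "\<phi> = (\<lambda>y. S y + of_real r * (of_real (s * (2 / 3)) * \<psi> y + of_real (1 / 3) * \<eta> y))"
        by (simp add: \<eta>(2) S'_def algebra_simps)
      ultimately show "\<phi> \<in> D S r" unfolding D_def by (intro CollectI exI conjI)
    qed
    moreover have "real n \<le> norm (\<phi> (x m))" if "\<phi> \<in> D S' (r / 3)" for \<phi>
    proof -
      obtain \<eta> where \<eta>: "\<eta> \<in> K" "\<phi> = (\<lambda>y. S' y + of_real (r / 3) * \<eta> y)" using \<open>\<phi> \<in> D S' (r / 3)\<close> by (auto simp: D_def)
      have "norm (S' (x m)) - norm (of_real (r / 3) * \<eta> (x m)) \<le> norm (\<phi> (x m))"
        unfolding \<eta>(2) by (rule norm_diff_ineq)
      moreover have "norm (of_real (r / 3) * \<eta> (x m)) \<le> r / 3 * norm (\<psi> (x m))"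
        unfolding norm_mult norm_of_real using r max[OF \<eta>(1)] by simp
      ultimately show ?thesis using grow large by (simp add: S'_def)
    qed
    ultimately show ?thesis by blast
  qed
  have "\<exists>S. \<forall>n. (n = 0 \<longrightarrow> S n = (\<lambda>_. 0)) \<and> (D (S (Suc n)) ((1 / 3) ^ Suc n) \<subseteq> D (S n) ((1 / 3) ^ n) \<and>
      (\<exists>m. \<forall>\<phi>\<in>D (S (Suc n)) ((1 / 3) ^ Suc n). real n \<le> norm (\<phi> (x m))))"
    by (rule dependent_nat_choice) (use step[of "(1 / 3) ^ _"] in \<open>auto\<close>)
  then obtain S where S0: "S 0 = (\<lambda>_. 0)"
    and decr: "\<And>n. D (S (Suc n)) ((1 / 3) ^ Suc n) \<subseteq> D (S n) ((1 / 3) ^ n)"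
    and "\<And>n. \<exists>m. \<forall>\<phi>\<in>D (S (Suc n)) ((1 / 3) ^ Suc n). real n \<le> norm (\<phi> (x m))"
    by blast
  then obtain m where m: "\<And>n \<phi>. \<phi> \<in> D (S (Suc n)) ((1 / 3) ^ Suc n) \<Longrightarrow> real n \<le> norm (\<phi> (x (m n)))"
    by metis
  define E where "E n = D (S n) ((1 / 3) ^ n)" for n
  have E_mono: "E j \<subseteq> E i" if "i \<le> j" for i j
    using that decr unfolding E_def by (rule lift_Suc_antimono_le[rotated])
  have E0: "E 0 \<subseteq> K" by (auto simp: E_def D_def S0)
  have E_ne: "S n \<in> E n" for n using zero unfolding E_def D_def by force
  have "K \<inter> (\<Inter>n\<in>UNIV. {\<phi>. real n \<le> norm (\<phi> (x (m n)))}) \<noteq> {}"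
  proof (rule compact_imp_fip_image[OF K])
    show "closed {\<phi>. real n \<le> norm (\<phi> (x (m n)))}" for n
      by (intro closed_Collect_le continuous_on_const cont)
    fix I :: "nat set" assume "finite I"
    then obtain N where N: "\<And>i. i \<in> I \<Longrightarrow> Suc i \<le> N" by (metis finite_nat_set_iff_bounded Suc_leI)
    have "S N \<in> K" using E_ne[of N] E_mono[of 0 N] E0 by blast
    moreover have "real i \<le> norm (S N (x (m i)))" if "i \<in> I" for i
      using m[of "S N" i] E_ne[of N] E_mono[OF N[OF that]] by (auto simp: E_def)
    ultimately show "K \<inter> (\<Inter>n\<in>I. {\<phi>. real n \<le> norm (\<phi> (x (m n)))}) \<noteq> {}" by blast
  qed
  then obtain \<phi> where "\<phi> \<in> K" and \<phi>: "\<And>n. real n \<le> norm (\<phi> (x (m n)))" by auto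
  then obtain B where "\<And>k. norm (\<phi> (x k)) \<le> B" using bounded by blast
  then have "real n \<le> B" for n using \<phi>[of n] by (meson order_trans)
  then show False using reals_Archimedean2[of B] by (meson not_le)
qed

text \<open>The convex hull of the functions \<open>f n\<close> with \<open>n \<ge> k\<close>, generated by binary mixtures, so
  that properties closed under mixtures pass to it by induction.\<close>

inductive_set convex_tail :: "(nat \<Rightarrow> 'd \<Rightarrow> real) \<Rightarrow> nat \<Rightarrow> ('d \<Rightarrow> real) set"
  for f k where
  base: "k \<le> n \<Longrightarrow> f n \<in> convex_tail f k"
| mix: "\<lbrakk>g \<in> convex_tail f k; h \<in> convex_tail f k; 0 \<le> t; t \<le> 1\<rbrakk>
    \<Longrightarrow> (\<lambda>x. (1 - t) * g x + t * h x) \<in> convex_tail f k"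

lemma convex_tail_antimono: "g \<in> convex_tail f k \<Longrightarrow> j \<le> k \<Longrightarrow> g \<in> convex_tail f j"
  by (induction rule: convex_tail.induct) (auto intro: convex_tail.intros)

lemma convex_tail_continuous:
  "g \<in> convex_tail f k \<Longrightarrow> (\<And>n. continuous_on K (f n)) \<Longrightarrow> continuous_on K g"
  by (induction rule: convex_tail.induct) (auto intro!: continuous_intros)

lemma convex_tail_bound:
  "g \<in> convex_tail f k \<Longrightarrow> (\<And>n. k \<le> n \<Longrightarrow> f n x \<in> {a..b}) \<Longrightarrow> g x \<in> {a..b}"
proof (induction rule: convex_tail.induct)
  case (mix g h t)
  then have "(1 - t) *\<^sub>R g x + t *\<^sub>R h x \<in> {a..b}"
    by (intro convexD[OF convex_real_interval(5)]) auto
  then show ?case by simp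
qed auto

lemma convex_tail_weights:
  assumes "g \<in> convex_tail f k"
  shows "\<exists>N w. (\<forall>n. 0 \<le> w n) \<and> (\<Sum>n<N. w n) = 1 \<and> (\<forall>n\<ge>N. w n = 0) \<and> (\<forall>x. g x = (\<Sum>n<N. w n * f n x))"
  using assms
proof (induction rule: convex_tail.induct)
  case (base n)
  have "(\<Sum>i<Suc n. (if i = n then 1 else 0) * F i) = F n" for F :: "nat \<Rightarrow> real" by simp
  from this[of "\<lambda>_. 1"] this show ?case
    by (intro exI[of _ "Suc n"] exI[of _ "\<lambda>i. if i = n then 1 else 0"]) auto
next
  case (mix g h t)
  then obtain N v M w where
    v: "\<forall>n. 0 \<le> v n" "(\<Sum>n<N. v n) = 1" "\<forall>n\<ge>N. v n = 0" "\<forall>x. g x = (\<Sum>n<N. v n * f n x)" and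
    w: "\<forall>n. 0 \<le> w n" "(\<Sum>n<M. w n) = 1" "\<forall>n\<ge>M. w n = 0" "\<forall>x. h x = (\<Sum>n<M. w n * f n x)"
    by blast
  let ?L = "max N M"
  have ext: "(\<Sum>n<?L. v n * F n) = (\<Sum>n<N. v n * F n)" "(\<Sum>n<?L. w n * F n) = (\<Sum>n<M. w n * F n)" for F
    using v(3) w(3) by (intro sum.mono_neutral_right; auto)+
  have "(\<Sum>n<?L. ((1 - t) * v n + t * w n) * F n) = (1 - t) * (\<Sum>n<N. v n * F n) + t * (\<Sum>n<M. w n * F n)" for F
    unfolding ext[symmetric] by (simp add: distrib_right sum.distrib sum_distrib_left mult.assoc)
  from this[of "\<lambda>_. 1"] this show ?case
    using v w mix.hyps(3,4)
    by (intro exI[of _ ?L] exI[of _ "\<lambda>n. (1 - t) * v n + t * w n"]) auto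
qed

text \<open>The infimum over \<open>g\<close> of the suprema of \<open>h + a g\<close> on \<open>K\<close> is approached; the suprema are spelled
  out pointwise.\<close>

lemma nearly_minimal_perturbation:
  fixes h :: "'d \<Rightarrow> real"
  assumes K: "K \<noteq> {}" and C: "C \<noteq> {}"
    and h: "bdd_above (h ` K)" and g: "\<And>g x. g \<in> C \<Longrightarrow> x \<in> K \<Longrightarrow> g x \<in> {0..M}"
    and a: "0 \<le> a" and \<epsilon>: "0 < \<epsilon>"
  shows "\<exists>g\<in>C. \<forall>g'\<in>C. \<forall>x\<in>K. \<exists>x'\<in>K. h x + a * g x \<le> h x' + a * g' x' + \<epsilon>"
proof -
  define \<sigma> where "\<sigma> g = (SUP x\<in>K. h x + a * g x)" for g
  obtain B where B: "\<And>x. x \<in> K \<Longrightarrow> h x \<le> B" using h by (auto simp: bdd_above_def)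
  have bdd: "bdd_above ((\<lambda>x. h x + a * g x) ` K)" if "g \<in> C" for g
    using B g[OF that] a by (intro bdd_aboveI2[of _ _ "B + a * M"] add_mono mult_left_mono) auto
  obtain x0 where x0: "x0 \<in> K" using K by blast
  have "h x0 \<le> \<sigma> g" if "g \<in> C" for g
  proof -
    have "h x0 \<le> h x0 + a * g x0" using g[OF that x0] a by simp
    also have "\<dots> \<le> \<sigma> g" unfolding \<sigma>_def by (rule cSUP_upper[OF x0 bdd[OF that]])
    finally show ?thesis .
  qed
  then have bdd_inf: "bdd_below (\<sigma> ` C)" by (intro bdd_belowI2)
  have "(INF g\<in>C. \<sigma> g) < (INF g\<in>C. \<sigma> g) + \<epsilon> / 2" using \<epsilon> by simp
  then obtain g where gC: "g \<in> C" and g_less: "\<sigma> g < (INF g\<in>C. \<sigma> g) + \<epsilon> / 2"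
    using cINF_less_iff[OF C bdd_inf] by blast
  have "\<exists>x'\<in>K. h x + a * g x \<le> h x' + a * g' x' + \<epsilon>" if g': "g' \<in> C" and x: "x \<in> K" for g' x
  proof -
    have "h x + a * g x \<le> \<sigma> g" unfolding \<sigma>_def by (rule cSUP_upper[OF x bdd[OF gC]])
    also have "\<dots> < \<sigma> g' + \<epsilon> / 2" using g_less cINF_lower[OF bdd_inf g'] by linarith
    finally have less: "h x + a * g x - \<epsilon> / 2 < \<sigma> g'" by simp
    then have "\<exists>x'\<in>K. h x + a * g x - \<epsilon> / 2 < h x' + a * g' x'"
      unfolding \<sigma>_def using less_cSUP_iff[OF K bdd[OF g']] by blast
    then show ?thesis using \<epsilon> by (auto intro!: bexI less_imp_le)
  qed
  then show ?thesis using gC by blast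
qed

lemma le_if_le_plus_geometric:
  fixes a b M :: real
  assumes "\<And>N. a \<le> b + (1 / 2) ^ (k + N) * M"
  shows "a \<le> b"
proof (rule LIMSEQ_le_const)
  have "(\<lambda>N. (1 / 2 :: real) ^ (k + N)) \<longlonglongrightarrow> 0"
    using LIMSEQ_ignore_initial_segment[OF LIMSEQ_power_zero[of "1 / 2 :: real"], of k] by (simp add: add.commute)
  then show "(\<lambda>N. b + (1 / 2) ^ (k + N) * M) \<longlonglongrightarrow> b" by (auto intro!: tendsto_eq_intros)
  show "\<exists>N. \<forall>n\<ge>N. a \<le> b + (1 / 2) ^ (k + n) * M" using assms by blast
qed

text \<open>A consequence of dominated convergence and the separation theorem, obtained here by Simons'
  elementary argument in place of measures on \<open>K\<close>. If all convex combinations had supremum at least \<open>\<delta>\<close>, choose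
  \<open>g k\<close> in the hull of the \<open>f n\<close> with \<open>n > k\<close>, greedily, so that the supremum of
  \<open>h k + 2 ^ (- k) g k\<close> is almost minimal, where \<open>h k\<close> is the sum of the \<open>2 ^ (- (j + 1)) g j\<close> with \<open>j < k\<close>.
  The full sum \<open>H\<close> competes in each of these minimizations, and at a point \<open>b\<close> where it attains its maximum
  this forces the remainder \<open>H b - h k b\<close> to stay above \<open>2 ^ (- k) \<delta> / 2\<close>.
  So the \<open>g j b\<close>, and hence the \<open>f n b\<close>, do not tend to zero.\<close>

theorem convex_combination_uniformly_small:
  fixes f :: "nat \<Rightarrow> 'd::topological_space \<Rightarrow> real"
  assumes K: "compact K" "K \<noteq> {}" and cont: "\<And>n. continuous_on K (f n)"
    and bound: "\<And>n x. x \<in> K \<Longrightarrow> f n x \<in> {0..M}"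
    and null: "\<And>x. x \<in> K \<Longrightarrow> (\<lambda>n. f n x) \<longlonglongrightarrow> 0"
    and \<delta>: "0 < \<delta>"
  obtains N w where "\<And>n. 0 \<le> w n" "(\<Sum>n<N. w n) = 1" "\<And>x. x \<in> K \<Longrightarrow> (\<Sum>n<N. w n * f n x) < \<delta>"
proof -
  let ?C = "convex_tail f"
  have "\<exists>g\<in>?C 0. \<forall>x\<in>K. g x < \<delta>"
  proof (rule ccontr)
    assume "\<not> ?thesis"
    then have large: "\<exists>x\<in>K. \<delta> \<le> g x" if "g \<in> ?C 0" for g using that by (meson not_le)
    have C_bound: "g x \<in> {0..M}" if "g \<in> ?C k" "x \<in> K" for g k x
      using convex_tail_bound[OF that(1)] bound[OF that(2)] by blast
    \<comment> \<open>The errors are multiplied by \<open>2 ^ k\<close> below and must still sum to at most \<open>\<delta> / 2\<close>.\<close>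
    define \<epsilon> where "\<epsilon> k = \<delta> / 4 * (1 / 4) ^ k" for k :: nat
    have \<epsilon>: "0 < \<epsilon> k" for k using \<delta> by (simp add: \<epsilon>_def)
    define opt where "opt k h g \<longleftrightarrow> g \<in> ?C (Suc k) \<and> (\<forall>g'\<in>?C (Suc k). \<forall>x\<in>K. \<exists>x'\<in>K.
      h x + (1 / 2) ^ k * g x \<le> h x' + (1 / 2) ^ k * g' x' + \<epsilon> k)" for k h g
    have "\<exists>h. \<forall>k. (continuous_on K (h k) \<and> (k = 0 \<longrightarrow> h k = (\<lambda>_. 0))) \<and>
      (\<exists>g. opt k (h k) g \<and> h (Suc k) = (\<lambda>x. h k x + (1 / 2) ^ Suc k * g x))"
    proof (rule dependent_nat_choice)
      show "\<exists>h. continuous_on K h \<and> (0 = (0::nat) \<longrightarrow> h = (\<lambda>_. 0::real))" by auto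
      fix h :: "'d \<Rightarrow> real" and k :: nat assume h: "continuous_on K h \<and> (k = 0 \<longrightarrow> h = (\<lambda>_. 0))"
      have "bdd_above (h ` K)"
        using h K by (intro bounded_imp_bdd_above compact_imp_bounded compact_continuous_image) auto
      moreover have "?C (Suc k) \<noteq> {}" using convex_tail.base by blast
      ultimately obtain g where g: "opt k h g"
        using nearly_minimal_perturbation[OF K(2), of "?C (Suc k)" h M "(1 / 2) ^ k" "\<epsilon> k"] C_bound \<epsilon>
        unfolding opt_def by (metis zero_le_power divide_nonneg_nonneg zero_le_one zero_le_numeral)
      then have "continuous_on K g" using convex_tail_continuous cont by (auto simp: opt_def)
      then have "continuous_on K (\<lambda>x. h x + (1 / 2) ^ Suc k * g x)" using h by (intro continuous_intros) auto
      then show "\<exists>h'. (continuous_on K h' \<and> (Suc k = 0 \<longrightarrow> h' = (\<lambda>_. 0))) \<and>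
        (\<exists>g. opt k h g \<and> h' = (\<lambda>x. h x + (1 / 2) ^ Suc k * g x))" using g by blast
    qed
    then obtain h where h_cont: "\<And>k. continuous_on K (h k)" and h0: "h 0 = (\<lambda>_. 0)"
      and "\<And>k. \<exists>g. opt k (h k) g \<and> h (Suc k) = (\<lambda>x. h k x + (1 / 2) ^ Suc k * g x)" by metis
    then obtain g where opt: "\<And>k. opt k (h k) (g k)"
      and h_Suc: "\<And>k x. h (Suc k) x = h k x + (1 / 2) ^ Suc k * g k x" by metis
    have g_C: "g k \<in> ?C (Suc k)" for k using opt by (simp add: opt_def)
    have h_eq: "h k x = (\<Sum>j<k. (1 / 2) ^ Suc j * g j x)" for k x
      by (induction k) (simp_all add: h0 h_Suc)
    define H where "H x = suminf (\<lambda>j. (1 / 2) ^ Suc j * g j x)" for x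
    have summable_half: "summable (\<lambda>j. (1 / 2) ^ Suc j * M)"
      by (intro summable_mult2 summable_Suc_iff[THEN iffD2] summable_geometric) simp
    have term_le: "norm ((1 / 2) ^ Suc j * g j x) \<le> (1 / 2) ^ Suc j * M" if "x \<in> K" for j x
      using C_bound[OF g_C that, of j] by (simp add: abs_mult mult_left_mono)
    have "uniform_limit K h H sequentially"
      using Weierstrass_m_test[OF term_le summable_half] unfolding h_eq[abs_def] H_def .
    then have H_cont: "continuous_on K H"
      by (rule uniform_limit_theorem[rotated]) (use h_cont in auto)
    have summable: "summable (\<lambda>j. (1 / 2) ^ Suc j * g j x)" if "x \<in> K" for x
      by (rule summable_comparison_test'[OF summable_half]) (use term_le[OF that] in auto)
    have h_le_H: "h k x \<le> H x" if "x \<in> K" for k x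
      unfolding h_eq H_def using C_bound[OF g_C that] by (intro sum_le_suminf summable that) auto
    have h_lim: "(\<lambda>k. h k x) \<longlonglongrightarrow> H x" if "x \<in> K" for x
      unfolding h_eq H_def by (rule summable_LIMSEQ[OF summable[OF that]])
    obtain b where b: "b \<in> K" and b_max: "\<And>x. x \<in> K \<Longrightarrow> H x \<le> H b"
      using continuous_attains_sup[OF K H_cont] by blast
    \<comment> \<open>The partial sum \<open>h (k + N)\<close> becomes a full convex combination when the remaining weight \<open>2 ^ (- (k + N))\<close> goes to \<open>g (k + N)\<close>; these finite combinations stand in for \<open>H\<close> in the minimizations.\<close>
    have tail: "\<exists>G\<in>?C (Suc k). \<forall>x. h k x + (1 / 2) ^ k * G x = h (k + N) x + (1 / 2) ^ (k + N) * g (k + N) x" for k N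
    proof (induction N arbitrary: k)
      case 0
      then show ?case using g_C by auto
    next
      case (Suc N)
      obtain G where G: "G \<in> ?C (Suc (Suc k))"
        "\<And>x. h (Suc k) x + (1 / 2) ^ Suc k * G x = h (Suc k + N) x + (1 / 2) ^ (Suc k + N) * g (Suc k + N) x"
        using Suc[of "Suc k"] by blast
      have "(\<lambda>x. (1 - 1 / 2) * g k x + 1 / 2 * G x) \<in> ?C (Suc k)"
        using g_C convex_tail_antimono[OF G(1)] by (intro convex_tail.mix) auto
      moreover have "h k x + (1 / 2) ^ k * ((1 - 1 / 2) * g k x + 1 / 2 * G x) = h (Suc k) x + (1 / 2) ^ Suc k * G x" for x
        by (simp add: h_Suc algebra_simps)
      ultimately show ?case using G(2) by (intro bexI) auto
    qed
    have end_le: "h (k + N) x + (1 / 2) ^ (k + N) * g (k + N) x \<le> H b + (1 / 2) ^ (k + N) * M" if x: "x \<in> K" for k N x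
      using h_le_H[OF x, of "k + N"] b_max[OF x] C_bound[OF g_C x, of "k + N"]
      by (intro add_mono mult_left_mono) auto
    have "\<delta> \<le> H b"
    proof (rule le_if_le_plus_geometric)
      fix N
      obtain G where G: "G \<in> ?C (Suc 0)" "\<And>x. h 0 x + (1 / 2) ^ 0 * G x = h (0 + N) x + (1 / 2) ^ (0 + N) * g (0 + N) x"
        using tail[of 0 N] by blast
      obtain x where x: "x \<in> K" "\<delta> \<le> G x" using large[of G] convex_tail_antimono[OF G(1)] by auto
      then show "\<delta> \<le> H b + (1 / 2) ^ (0 + N) * M" using end_le[OF x(1), of 0 N] G(2)[of x] h0 by simp
    qed
    have decay: "2 * h (Suc k) b - h k b \<le> H b + \<epsilon> k" for k
    proof (rule le_if_le_plus_geometric)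
      fix N
      obtain G where G: "G \<in> ?C (Suc k)" "\<And>x. h k x + (1 / 2) ^ k * G x = h (k + N) x + (1 / 2) ^ (k + N) * g (k + N) x"
        using tail[of k N] by blast
      obtain x where x: "x \<in> K" and le: "h k b + (1 / 2) ^ k * g k b \<le> h k x + (1 / 2) ^ k * G x + \<epsilon> k"
        using opt[of k] G(1) b unfolding opt_def by blast
      have "2 * h (Suc k) b - h k b = h k b + (1 / 2) ^ k * g k b" by (simp add: h_Suc)
      then show "2 * h (Suc k) b - h k b \<le> H b + \<epsilon> k + (1 / 2) ^ (k + N) * M"
        using le end_le[OF x, of k N] G(2)[of x] by simp
    qed
    have remainder: "\<delta> / 2 + \<delta> / 2 * (1 / 2) ^ k \<le> 2 ^ k * (H b - h k b)" for k
    proof (induction k)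
      case 0
      then show ?case using \<open>\<delta> \<le> H b\<close> h0 by simp
    next
      case (Suc k)
      have "2 ^ k * (2 * h (Suc k) b - h k b) \<le> 2 ^ k * (H b + \<epsilon> k)"
        using decay[of k] by (intro mult_left_mono) auto
      moreover have "2 ^ k * \<epsilon> k = \<delta> / 4 * (1 / 2) ^ k"
        by (simp add: \<epsilon>_def power_divide field_simps flip: power_mult_distrib)
      ultimately have "2 ^ k * (H b - h k b) - \<delta> / 4 * (1 / 2) ^ k \<le> 2 ^ Suc k * (H b - h (Suc k) b)"
        by (simp add: algebra_simps)
      then show ?case using Suc by simp
    qed
    have "\<forall>\<^sub>F n in sequentially. f n b < \<delta> / 4"
      using null[OF b] \<delta> by (intro order_tendstoD(2)) auto
    then obtain k where k: "\<And>n. k \<le> n \<Longrightarrow> f n b < \<delta> / 4" by (auto simp: eventually_sequentially)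
    have "h (k + N) b \<le> h k b + (1 / 2) ^ k * (\<delta> / 4)" for N
    proof -
      obtain G where G: "G \<in> ?C (Suc k)" "\<And>x. h k x + (1 / 2) ^ k * G x = h (k + N) x + (1 / 2) ^ (k + N) * g (k + N) x"
        using tail[of k N] by blast
      have "G b \<in> {0..\<delta> / 4}" using k bound[OF b] by (intro convex_tail_bound[OF G(1)]) (auto intro: less_imp_le)
      then have "(1 / 2) ^ k * G b \<le> (1 / 2) ^ k * (\<delta> / 4)" by (intro mult_left_mono) auto
      moreover have "0 \<le> (1 / 2) ^ (k + N) * g (k + N) b" using C_bound[OF g_C b, of "k + N"] by simp
      ultimately show ?thesis using G(2)[of b] by linarith
    qed
    moreover have "(\<lambda>N. h (k + N) b) \<longlonglongrightarrow> H b"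
      using LIMSEQ_ignore_initial_segment[OF h_lim[OF b], of k] by (simp add: add.commute)
    ultimately have "H b \<le> h k b + (1 / 2) ^ k * (\<delta> / 4)" by (intro LIMSEQ_le_const2) auto
    then have "2 ^ k * (H b - h k b) \<le> 2 ^ k * ((1 / 2) ^ k * (\<delta> / 4))" by (intro mult_left_mono) auto
    also have "\<dots> = \<delta> / 4" by (simp add: power_divide)
    finally have "\<delta> / 2 + \<delta> / 2 * (1 / 2) ^ k \<le> \<delta> / 4" using remainder[of k] by linarith
    moreover have "0 \<le> \<delta> / 2 * (1 / 2) ^ k" using \<delta> by simp
    ultimately show False using \<delta> by linarith
  qed
  then obtain g where g: "g \<in> ?C 0" "\<And>x. x \<in> K \<Longrightarrow> g x < \<delta>" by blast
  then show ?thesis using convex_tail_weights[OF g(1)] that by metis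
qed

section \<open>The summing inequality on the compact ball of forms\<close>

lemma compact_pointwise:
  fixes S :: "'c \<Rightarrow> 'k::topological_space set"
  assumes "\<And>x. compact (S x)"
  shows "compact {\<phi>. \<forall>x. \<phi> x \<in> S x}"
proof -
  have "compactin (product_topology (\<lambda>_. euclidean) UNIV) (Pi\<^sub>E UNIV S)"
    using assms by (simp add: compactin_PiE)
  moreover have "Pi\<^sub>E UNIV S = {\<phi>. \<forall>x. \<phi> x \<in> S x}" by auto
  ultimately show ?thesis by (simp add: euclidean_product_topology)
qed

text \<open>The unit ball of the bounded forms, with the values off the tuples normalized to \<open>0\<close>. The
  normalization makes it a closed subset of a product of compact balls.\<close>

definition form_compact ::
    "('n::finite \<Rightarrow> ('k::real_normed_field, 'a) nspace) \<Rightarrow> (('n \<Rightarrow> 'a) \<Rightarrow> 'k) set" where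
  "form_compact X = {\<phi> \<in> bounded_forms X. \<forall>x.
    norm (\<phi> x) \<le> (if x \<in> tuples X then \<Prod>i\<in>UNIV. vnorm (X i) (x i) else 0)}"

lemma compact_form_compact:
  fixes X :: "'n::finite \<Rightarrow> ('k::{real_normed_field, heine_borel}, 'a) nspace"
  shows "compact (form_compact X)"
proof -
  let ?r = "\<lambda>x. if x \<in> tuples X then \<Prod>i\<in>UNIV. vnorm (X i) (x i) else 0"
  define P where "P = {(x, i, a, b). x \<in> tuples X \<and> a \<in> vcarrier (X i) \<and> b \<in> vcarrier (X i)}"
  define Q where "Q = {(x, i, a, c). x \<in> tuples X \<and> a \<in> vcarrier (X i) \<and> (c::'k) \<in> UNIV}"
  have "form_compact X = {\<phi>. \<forall>x. \<phi> x \<in> cball 0 (?r x)}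
    \<inter> (\<Inter>(x, i, a, b)\<in>P. {\<phi>. \<phi> (x(i := vplus (X i) a b)) = \<phi> (x(i := a)) + \<phi> (x(i := b))})
    \<inter> (\<Inter>(x, i, a, c)\<in>Q. {\<phi>. \<phi> (x(i := vscale (X i) c a)) = c * \<phi> (x(i := a))})"
    (is "_ = ?B \<inter> ?P \<inter> ?Q")
  proof -
    have "\<exists>C. \<forall>x\<in>tuples X. norm (\<phi> x) \<le> C * (\<Prod>i\<in>UNIV. vnorm (X i) (x i))" if "\<phi> \<in> ?B" for \<phi>
    proof (intro exI[of _ 1] ballI)
      fix x assume "x \<in> tuples X"
      moreover have "\<phi> x \<in> cball 0 (?r x)" using that by blast
      ultimately show "norm (\<phi> x) \<le> 1 * (\<Prod>i\<in>UNIV. vnorm (X i) (x i))" by simp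
    qed
    then show ?thesis unfolding form_compact_def bounded_forms_iff P_def Q_def by auto
  qed
  moreover have "compact ?B" by (rule compact_pointwise) simp
  moreover have cont: "continuous_on UNIV (\<lambda>\<phi> :: ('n \<Rightarrow> 'a) \<Rightarrow> 'k. \<phi> y)" for y :: "'n \<Rightarrow> 'a"
    by (rule continuous_on_product_coordinates)
  have "closed {\<phi> :: ('n \<Rightarrow> 'a) \<Rightarrow> 'k. \<phi> y = \<phi> y' + \<phi> y''}" for y y' y'' :: "'n \<Rightarrow> 'a"
    by (intro closed_Collect_eq continuous_on_add cont)
  then have "closed ?P" by (intro closed_INT) (simp add: case_prod_unfold)
  moreover have "closed {\<phi> :: ('n \<Rightarrow> 'a) \<Rightarrow> 'k. \<phi> y = c * \<phi> y'}" for y y' :: "'n \<Rightarrow> 'a" and c :: 'k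
    by (intro closed_Collect_eq continuous_on_mult continuous_on_const cont)
  then have "closed ?Q" by (intro closed_INT) (simp add: case_prod_unfold)
  ultimately show ?thesis by (simp add: compact_Int_closed)
qed

lemma form_compact_absconvex:
  assumes \<phi>: "\<phi> \<in> form_compact X" and \<psi>: "\<psi> \<in> form_compact X" and ab: "\<bar>a\<bar> + \<bar>b\<bar> \<le> 1"
  shows "(\<lambda>x. of_real a * \<phi> x + of_real b * \<psi> x) \<in> form_compact X"
proof -
  let ?r = "\<lambda>x. if x \<in> tuples X then \<Prod>i\<in>UNIV. vnorm (X i) (x i) else 0"
  have le: "norm (of_real a * \<phi> x + of_real b * \<psi> x) \<le> ?r x" for x
  proof -
    have r: "norm (\<phi> x) \<le> ?r x" "norm (\<psi> x) \<le> ?r x"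
      using \<phi> \<psi> unfolding form_compact_def by blast+
    have "norm (of_real a * \<phi> x + of_real b * \<psi> x) \<le> \<bar>a\<bar> * norm (\<phi> x) + \<bar>b\<bar> * norm (\<psi> x)"
      by (rule order_trans[OF norm_triangle_ineq]) (simp add: norm_mult)
    also have "\<dots> \<le> \<bar>a\<bar> * ?r x + \<bar>b\<bar> * ?r x" by (intro add_mono mult_left_mono r) auto
    also have "\<dots> = (\<bar>a\<bar> + \<bar>b\<bar>) * ?r x" by (simp add: distrib_right)
    also have "\<dots> \<le> 1 * ?r x" using ab order_trans[OF norm_ge_zero r(1)] by (intro mult_right_mono)
    finally show ?thesis by simp
  qed
  have "\<exists>C. \<forall>x\<in>tuples X. norm (of_real a * \<phi> x + of_real b * \<psi> x) \<le> C * (\<Prod>i\<in>UNIV. vnorm (X i) (x i))"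
  proof (intro exI[of _ 1] ballI)
    fix x assume "x \<in> tuples X"
    then show "norm (of_real a * \<phi> x + of_real b * \<psi> x) \<le> 1 * (\<Prod>i\<in>UNIV. vnorm (X i) (x i))"
      using le[of x] by simp
  qed
  moreover have "\<phi> \<in> bounded_forms X" "\<psi> \<in> bounded_forms X" using \<phi> \<psi> by (auto simp: form_compact_def)
  ultimately have "(\<lambda>x. of_real a * \<phi> x + of_real b * \<psi> x) \<in> bounded_forms X"
    unfolding bounded_forms_iff by (simp add: algebra_simps)
  then show ?thesis using le by (simp add: form_compact_def)
qed

context normed_family
begin

lemma zero_form: "(\<lambda>_. 0) \<in> bounded_forms X"
  unfolding bounded_forms_iff by (auto intro: exI[of _ 0])

lemma zero_form_compact: "(\<lambda>_. 0) \<in> form_compact X"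
  using zero_form cost_nonneg by (simp add: form_compact_def cost_def)

lemma bounded_form_scale_all:
  assumes \<phi>: "\<phi> \<in> bounded_forms X" and x: "x \<in> tuples X" and "finite I"
  shows "\<phi> (\<lambda>i. if i \<in> I then vscale (X i) (c i) (x i) else x i) = (\<Prod>i\<in>I. c i) * \<phi> x"
  using \<open>finite I\<close>
proof (induction I)
  case (insert i I)
  let ?y = "\<lambda>k. if k \<in> I then vscale (X k) (c k) (x k) else x k"
  have y: "?y \<in> tuples X" using x by (auto simp: tuples_def normed_space.scale_closed[OF normed])
  have upd: "(\<lambda>k. if k \<in> insert i I then vscale (X k) (c k) (x k) else x k) = ?y(i := vscale (X i) (c i) (x i))"
    by auto
  have "\<phi> (\<lambda>k. if k \<in> insert i I then vscale (X k) (c k) (x k) else x k) = c i * \<phi> (?y(i := x i))"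
    using \<phi> y x unfolding bounded_forms_iff upd tuples_def by blast
  also have "?y(i := x i) = ?y" using insert.hyps by auto
  finally show ?case using insert by simp
qed simp

text \<open>Scaling every coordinate to norm one turns the supremum bound into the product bound; if some
  coordinate has norm zero, boundedness already gives the value zero.\<close>

lemma form_ball_le:
  assumes \<phi>: "\<phi> \<in> form_ball X" and x: "x \<in> tuples X"
  shows "norm (\<phi> x) \<le> cost x"
proof -
  have \<phi>f: "\<phi> \<in> bounded_forms X" and n: "form_norm X \<phi> \<le> 1" using \<phi> by (auto simp: form_ball_def)
  obtain C where C0: "0 \<le> C" and C: "\<And>x. x \<in> tuples X \<Longrightarrow> norm (\<phi> x) \<le> C * cost x"
    using bounded_form_bound[OF \<phi>f] by blast
  have ball: "norm (\<phi> y) \<le> 1" if y: "y \<in> ball_tuples X" for y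
  proof -
    have "norm (\<phi> y) \<le> C" if y: "y \<in> ball_tuples X" for y
    proof -
      have yt: "y \<in> tuples X" using y by (simp add: ball_tuples_def)
      have "cost y \<le> 1" unfolding cost_def
        using y by (intro prod_le_1) (auto simp: ball_tuples_def tuples_def normed_space.norm_nonneg[OF normed])
      then have "C * cost y \<le> C * 1" using C0 by (intro mult_left_mono)
      then show ?thesis using C[OF yt] by simp
    qed
    then have "bdd_above ((\<lambda>x. norm (\<phi> x)) ` ball_tuples X)" by (intro bdd_aboveI2)
    then have "norm (\<phi> y) \<le> form_norm X \<phi>" unfolding form_norm_def by (intro cSUP_upper y)
    then show ?thesis using n by simp
  qed
  show ?thesis
  proof (cases "\<exists>i. vnorm (X i) (x i) = 0")
    case True
    then have "cost x = 0" by (auto simp: cost_def)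
    then show ?thesis using C[OF x] by simp
  next
    case False
    define r where "r i = vnorm (X i) (x i)" for i
    have r: "0 < r i" for i
      using False normed_space.norm_nonneg[OF normed, of "x i" i] x by (simp add: r_def tuples_def order_less_le)
    define y where "y i = vscale (X i) (of_real (inverse (r i))) (x i)" for i
    have yt: "y \<in> tuples X" using x by (simp add: y_def tuples_def normed_space.scale_closed[OF normed])
    have "vnorm (X i) (y i) = 1" for i
      using x r[of i] by (simp add: y_def tuples_def normed_space.norm_scale[OF normed] norm_inverse flip: r_def)
    then have "y \<in> ball_tuples X" using yt by (simp add: ball_tuples_def)
    then have le: "norm (\<phi> y) \<le> 1" by (rule ball)
    have "\<phi> y = (\<Prod>i\<in>UNIV. of_real (inverse (r i))) * \<phi> x"
      using bounded_form_scale_all[OF \<phi>f x, of UNIV "\<lambda>i. of_real (inverse (r i))"] by (simp add: y_def[abs_def])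
    moreover have "norm (\<Prod>i\<in>UNIV. of_real (inverse (r i)) :: 'k) = inverse (cost x)"
      using r unfolding cost_def prod_norm[symmetric] norm_of_real
      by (simp add: r_def[symmetric] prod_inversef[symmetric] o_def less_imp_le)
    ultimately have "norm (\<phi> y) = inverse (cost x) * norm (\<phi> x)" by (simp only: norm_mult)
    moreover have "0 < cost x" using r unfolding cost_def r_def by (intro prod_pos) auto
    ultimately show ?thesis using mult_left_mono[OF le, of "cost x"] by (simp add: field_simps)
  qed
qed

lemma form_ball_restrict:
  assumes "\<phi> \<in> form_ball X"
  shows "(\<lambda>x. if x \<in> tuples X then \<phi> x else 0) \<in> form_compact X"
proof -
  have "vplus (X i) a b \<in> vcarrier (X i)" "vscale (X i) c a \<in> vcarrier (X i)"
    if "a \<in> vcarrier (X i)" "b \<in> vcarrier (X i)" for i a b c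
    using that by (simp_all add: normed_space.plus_closed[OF normed] normed_space.scale_closed[OF normed])
  moreover have "\<phi> \<in> bounded_forms X" using assms by (simp add: form_ball_def)
  ultimately show ?thesis
    using form_ball_le[OF assms] unfolding form_compact_def bounded_forms_iff
    by (auto simp: tuples_update cost_def)
qed

text \<open>Weights come for free: multiplying one coordinate of \<open>u n\<close> and of \<open>v n\<close> by the \<open>p\<close>-th root of \<open>w n\<close>
  multiplies the \<open>p\<close>-th powers on both sides of the summing inequality by \<open>w n\<close>.\<close>

lemma weighted_summing_inequality:
  assumes p: "1 \<le> p" and Y: "normed_space Y" and T: "T \<in> lip_summing p X Y"
  obtains c where "0 < c" "\<And>(N::nat) w u v B. \<lbrakk>\<And>n. 0 \<le> w n; \<And>n. u n \<in> tuples X; \<And>n. v n \<in> tuples X;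
    \<And>\<phi>. \<phi> \<in> form_compact X \<Longrightarrow> (\<Sum>n<N. w n * norm (\<phi> (u n) - \<phi> (v n)) powr p) \<le> B\<rbrakk>
    \<Longrightarrow> (\<Sum>n<N. w n * vdist Y (T (u n)) (T (v n)) powr p) \<le> c * B"
proof -
  obtain c where c: "0 < c" and summing: "\<forall>k::nat. \<forall>u v. (\<forall>i\<in>{1..k}. u i \<in> tuples X \<and> v i \<in> tuples X) \<longrightarrow>
      (\<Sum>i=1..k. vdist Y (T (u i)) (T (v i)) powr p) powr (1 / p)
        \<le> c * (SUP \<phi>\<in>form_ball X. (\<Sum>i=1..k. norm (\<phi> (u i) - \<phi> (v i)) powr p) powr (1 / p))"
    using T unfolding lip_summing_def by blast
  have T_scale: "T (x(i := vscale (X i) a (x i))) = vscale Y a (T x)" and T_closed: "T x \<in> vcarrier Y"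
    if "x \<in> tuples X" for x i a
  proof -
    have "T (x(i := vscale (X i) a (x i))) = vscale Y a (T (x(i := x i)))"
      using T that unfolding lip_summing_def bounded_multilinear_def tuples_def by blast
    then show "T (x(i := vscale (X i) a (x i))) = vscale Y a (T x)" by simp
    show "T x \<in> vcarrier Y" using T that unfolding lip_summing_def bounded_multilinear_def by blast
  qed
  have ball_ne: "form_ball X \<noteq> {}"
  proof -
    have "form_norm X (\<lambda>_. 0) \<le> 1" unfolding form_norm_def
    proof (rule cSUP_least)
      have "(\<lambda>i. vzero (X i)) \<in> ball_tuples X"
        using normed_space.zero_closed[OF normed]
        by (simp add: ball_tuples_def tuples_def normed_space.norm_eq_zero[OF normed, THEN iffD2])
      then show "ball_tuples X \<noteq> {}" by blast
    qed simp
    then show ?thesis using zero_form by (auto simp: form_ball_def)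
  qed
  show ?thesis
  proof (rule that)
    show "0 < c powr p" using c by simp
    fix N w u v B
    assume w: "\<And>n::nat. 0 \<le> w n" and u: "\<And>n. u n \<in> tuples X" and v: "\<And>n. v n \<in> tuples X"
      and B: "\<And>\<phi>. \<phi> \<in> form_compact X \<Longrightarrow> (\<Sum>n<N. w n * norm (\<phi> (u n) - \<phi> (v n)) powr p) \<le> B"
    let ?i = "undefined :: 'n"
    define s where "s x n = x(?i := vscale (X ?i) (of_real (w n powr (1 / p))) (x ?i))" for x :: "'n \<Rightarrow> 'a" and n
    have s: "s x n \<in> tuples X" if "x \<in> tuples X" for x n
      unfolding s_def by (rule tuples_scale[OF that])
    have pow: "(w n powr (1 / p) * d) powr p = w n * d powr p" if "0 \<le> d" for n d
      using that w[of n] p by (simp add: powr_mult powr_powr)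
    have \<phi>s: "\<phi> (s x n) = of_real (w n powr (1 / p)) * \<phi> x" if \<phi>: "\<phi> \<in> bounded_forms X" and x: "x \<in> tuples X" for \<phi> x n
    proof -
      have "\<phi> (s x n) = of_real (w n powr (1 / p)) * \<phi> (x(?i := x ?i))"
        using \<phi> x unfolding s_def bounded_forms_iff tuples_def by blast
      then show ?thesis by simp
    qed
    have B0: "0 \<le> B" using B[OF zero_form_compact] by simp
    have "(\<Sum>i=1..N. vdist Y (T (s (u (i - 1)) (i - 1))) (T (s (v (i - 1)) (i - 1))) powr p) powr (1 / p)
        \<le> c * (SUP \<phi>\<in>form_ball X. (\<Sum>i=1..N. norm (\<phi> (s (u (i - 1)) (i - 1)) - \<phi> (s (v (i - 1)) (i - 1))) powr p) powr (1 / p))"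
      by (rule summing[rule_format]) (simp add: s u v)
    also have "(\<Sum>i=1..N. vdist Y (T (s (u (i - 1)) (i - 1))) (T (s (v (i - 1)) (i - 1))) powr p)
        = (\<Sum>n<N. w n * vdist Y (T (u n)) (T (v n)) powr p)" (is "_ = ?L")
    proof -
      have "vdist Y (T (s (u n) n)) (T (s (v n) n)) = w n powr (1 / p) * vdist Y (T (u n)) (T (v n))" for n
        unfolding s_def by (simp add: T_scale u v normed_space.vdist_scale[OF Y] T_closed)
      then show ?thesis
        by (simp add: sum.atLeast1_atMost_eq pow Metric_space.nonneg[OF normed_space.Metric_space_vdist[OF Y]])
    qed
    also have "c * (SUP \<phi>\<in>form_ball X. (\<Sum>i=1..N. norm (\<phi> (s (u (i - 1)) (i - 1)) - \<phi> (s (v (i - 1)) (i - 1))) powr p) powr (1 / p))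
        \<le> c * B powr (1 / p)"
    proof (intro mult_left_mono cSUP_least ball_ne)
      fix \<phi> assume \<phi>: "\<phi> \<in> form_ball X"
      then have \<phi>f: "\<phi> \<in> bounded_forms X" by (simp add: form_ball_def)
      have "norm (\<phi> (s (u n) n) - \<phi> (s (v n) n)) = w n powr (1 / p) * norm (\<phi> (u n) - \<phi> (v n))" for n
      proof -
        have "\<phi> (s (u n) n) - \<phi> (s (v n) n) = of_real (w n powr (1 / p)) * (\<phi> (u n) - \<phi> (v n))"
          by (simp add: \<phi>s[OF \<phi>f] u v algebra_simps)
        then show ?thesis by (simp add: norm_mult)
      qed
      then have "(\<Sum>i=1..N. norm (\<phi> (s (u (i - 1)) (i - 1)) - \<phi> (s (v (i - 1)) (i - 1))) powr p)
          = (\<Sum>n<N. w n * norm (\<phi> (u n) - \<phi> (v n)) powr p)"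
        by (simp add: sum.atLeast1_atMost_eq pow)
      also have "\<dots> \<le> B" using B[OF form_ball_restrict[OF \<phi>]] by (simp add: u v)
      finally show "(\<Sum>i=1..N. norm (\<phi> (s (u (i - 1)) (i - 1)) - \<phi> (s (v (i - 1)) (i - 1))) powr p) powr (1 / p) \<le> B powr (1 / p)"
        using p by (intro powr_mono2) (auto intro!: sum_nonneg)
    qed (use c in simp)
    finally have "(?L powr (1 / p)) powr p \<le> (c * B powr (1 / p)) powr p"
      using p by (intro powr_mono2) auto
    moreover have "0 \<le> ?L" using w by (intro sum_nonneg) simp
    ultimately show "?L \<le> c powr p * B" using p c B0 by (simp add: powr_powr powr_mult)
  qed
qed

end

section \<open>Summing operators are Dunford-Pettis\<close>

theorem proposition4p6:
  fixes p :: real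
    and X :: "'n::finite \<Rightarrow> ('k::{real_normed_field, heine_borel}, 'a) nspace"
    and Y :: "('k, 'b) nspace"
  assumes "1 \<le> p"
    and "\<And>i. banach_space (X i)"
    and "banach_space Y"
  shows "lip_summing p X Y \<subseteq> dunford_pettis X Y"
proof
  fix T assume T: "T \<in> lip_summing p X Y"
  have X: "normed_space (X i)" for i by (rule banach_space.axioms(1)[OF assms(2)])
  have Y: "normed_space Y" by (rule banach_space.axioms(1)[OF assms(3)])
  interpret normed_family X by (rule normed_family.intro) (rule X)
  interpret Y: normed_space Y by (rule Y)
  interpret dY: Metric_space "vcarrier Y" "vdist Y" by (rule Y.Metric_space_vdist)
  have T_ml: "T \<in> bounded_multilinear X Y" using T by (simp add: lip_summing_def)
  have T_closed: "T x \<in> vcarrier Y" if "x \<in> tuples X" for x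
    using T_ml that unfolding bounded_multilinear_def by blast
  obtain c where c: "0 < c" and summing: "\<And>(N::nat) w u v B. \<lbrakk>\<And>n. 0 \<le> w n; \<And>n. u n \<in> tuples X; \<And>n. v n \<in> tuples X;
    \<And>\<phi>. \<phi> \<in> form_compact X \<Longrightarrow> (\<Sum>n<N. w n * norm (\<phi> (u n) - \<phi> (v n)) powr p) \<le> B\<rbrakk>
    \<Longrightarrow> (\<Sum>n<N. w n * vdist Y (T (u n)) (T (v n)) powr p) \<le> c * B"
    using weighted_summing_inequality[OF assms(1) Y T] by blast
  have "\<exists>l. limitin (vtopology Y) (\<lambda>m. segre_map X T (z m)) l sequentially"
    if z: "range z \<subseteq> segre X" "weakly_Cauchy (proj_tensor X) z" for z
  proof -
    have "\<exists>x. x \<in> tuples X \<and> z m = elem_tensor X x" for m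
      using z(1) unfolding segre_def by blast
    then obtain x where x: "\<And>m. x m \<in> tuples X" and zx: "\<And>m. z m = elem_tensor X (x m)" by metis
    have segre: "segre_map X T (z m) = T (x m)" for m
      unfolding segre_map_def
    proof (rule the_equality)
      show "\<exists>y\<in>tuples X. z m = elem_tensor X y \<and> T (x m) = T y" using x zx by blast
      fix t assume "\<exists>y\<in>tuples X. z m = elem_tensor X y \<and> t = T y"
      then obtain y where y: "y \<in> tuples X" "elem_tensor X (x m) = elem_tensor X y" "t = T y" using zx by auto
      \<comment> \<open>Equal elementary tensors agree under every bounded form, so the summing inequality for a single pair shows that \<open>T\<close> agrees on them.\<close>
      have "\<phi> (x m) = \<phi> y" if "\<phi> \<in> form_compact X" for \<phi>
      proof -
        have "\<phi> \<in> bounded_forms X" using that by (simp add: form_compact_def)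
        then obtain \<psi> where "\<And>x. x \<in> tuples X \<Longrightarrow> \<psi> (elem_tensor X x) = \<phi> x"
          using bounded_form_factors_proj_tensor[where X = X, OF X] by blast
        from this[OF x, of m] this[OF y(1)] show ?thesis using y(2) by simp
      qed
      then have "(\<Sum>n<Suc 0. 1 * vdist Y (T (x m)) (T y) powr p) \<le> c * 0"
        using x y(1)
        by (intro summing[of "\<lambda>_. 1" "\<lambda>_. x m" "\<lambda>_. y" "Suc 0" 0]) auto
      then have "vdist Y (T (x m)) (T y) = 0" using powr_ge_zero[of "vdist Y (T (x m)) (T y)" p] by simp
      then show "t = T (x m)" using y(3) T_closed x y(1) by simp
    qed
    have weak: "Cauchy (\<lambda>m. \<phi> (x m))" if \<phi>: "\<phi> \<in> form_compact X" for \<phi>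
    proof -
      have "\<phi> \<in> bounded_forms X" using \<phi> by (simp add: form_compact_def)
      then obtain \<psi> where "\<psi> \<in> dual_space (proj_tensor X)" "\<And>x. x \<in> tuples X \<Longrightarrow> \<psi> (elem_tensor X x) = \<phi> x"
        using bounded_form_factors_proj_tensor[where X = X, OF X] by blast
      then show ?thesis using z(2) x zx unfolding weakly_Cauchy_def by fastforce
    qed
    have "\<exists>B. \<forall>\<phi>\<in>form_compact X. \<forall>m. norm (\<phi> (x m)) \<le> B"
    proof (rule pointwise_bounded_on_compact_absconvex[OF compact_form_compact form_compact_absconvex])
      show "\<exists>B. \<forall>m. norm (\<phi> (x m)) \<le> B" if "\<phi> \<in> form_compact X" for \<phi>
        using cauchy_imp_bounded[OF weak[OF that]] by (auto simp: bounded_iff)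
    qed
    then obtain B where B: "\<And>\<phi> m. \<phi> \<in> form_compact X \<Longrightarrow> norm (\<phi> (x m)) \<le> B" by blast
    have "vCauchy Y (\<lambda>m. T (x m))"
    proof (rule ccontr)
      assume "\<not> vCauchy Y (\<lambda>m. T (x m))"
      then obtain \<epsilon> where \<epsilon>: "0 < \<epsilon>" and "\<forall>N. \<exists>m\<ge>N. \<exists>n\<ge>N. \<epsilon> \<le> vdist Y (T (x m)) (T (x n))"
        unfolding Y.vCauchy_iff using T_closed x by (auto simp: not_less)
      then obtain a b where a: "\<And>N::nat. N \<le> a N" and b: "\<And>N. N \<le> b N"
        and far: "\<And>N. \<epsilon> \<le> vdist Y (T (x (a N))) (T (x (b N)))" by metis
      define f where "f n \<phi> = norm (\<phi> (x (a n)) - \<phi> (x (b n))) powr p" for n and \<phi> :: "('n \<Rightarrow> 'a) \<Rightarrow> 'k"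
      have lim: "filterlim a sequentially sequentially" "filterlim b sequentially sequentially"
        using a b by (auto intro: filterlim_at_top_mono[OF filterlim_ident])
      have f_cont: "continuous_on (form_compact X) (f n)" for n
        unfolding f_def using assms(1)
        by (intro continuous_on_powr' continuous_on_norm continuous_on_diff continuous_on_const
            continuous_on_subset[OF continuous_on_product_coordinates]) auto
      have f_bound: "f n \<phi> \<in> {0..(B + B) powr p}" if "\<phi> \<in> form_compact X" for n \<phi>
      proof -
        have "norm (\<phi> (x (a n)) - \<phi> (x (b n))) \<le> B + B"
          by (rule order_trans[OF norm_triangle_ineq4]) (intro add_mono B that)
        then show ?thesis using assms(1) by (auto simp: f_def intro: powr_mono2)
      qed
      have f_null: "(\<lambda>n. f n \<phi>) \<longlonglongrightarrow> 0" if \<phi>: "\<phi> \<in> form_compact X" for \<phi>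
      proof -
        obtain l where l: "(\<lambda>m. \<phi> (x m)) \<longlonglongrightarrow> l"
          using weak[OF \<phi>] Cauchy_convergent convergent_def by blast
        have "(\<lambda>n. norm (\<phi> (x (a n)) - \<phi> (x (b n)))) \<longlonglongrightarrow> norm (l - l)"
          by (intro tendsto_norm tendsto_diff filterlim_compose[OF l] lim)
        then show ?thesis unfolding f_def using assms(1)
          by (intro tendsto_zero_powrI[of _ _ _ p]) auto
      qed
      define \<delta> where "\<delta> = \<epsilon> powr p / (2 * c)"
      have \<delta>: "0 < \<delta>" using \<epsilon> c by (simp add: \<delta>_def)
      obtain N w where w: "\<And>n. 0 \<le> w n" "(\<Sum>n<N. w n) = 1"
        and small: "\<And>\<phi>. \<phi> \<in> form_compact X \<Longrightarrow> (\<Sum>n<N. w n * f n \<phi>) < \<delta>"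
        using convex_combination_uniformly_small[OF compact_form_compact _ f_cont f_bound f_null \<delta>]
          zero_form_compact by (metis empty_iff)
      have "\<epsilon> powr p = (\<Sum>n<N. w n * \<epsilon> powr p)" by (simp add: w(2) flip: sum_distrib_right)
      also have "\<dots> \<le> (\<Sum>n<N. w n * vdist Y (T (x (a n))) (T (x (b n))) powr p)"
        using \<epsilon> far w(1) assms(1) by (intro sum_mono mult_left_mono powr_mono2) auto
      also have "\<dots> \<le> c * \<delta>"
        using small w(1) x
        by (intro summing[of w "\<lambda>n. x (a n)" "\<lambda>n. x (b n)"])
          (auto simp: f_def intro: less_imp_le)
      also have "\<dots> = \<epsilon> powr p / 2" using c by (simp add: \<delta>_def)
      finally show False using \<epsilon> by simp
    qed
    then show ?thesis
      using banach_space.complete[OF assms(3)] unfolding dY.mcomplete_def segre by blast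
  qed
  then show "T \<in> dunford_pettis X Y" using T_ml unfolding dunford_pettis_def by blast
qed

end
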